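(* Let $G$ be a topological group and let $X$ be a CW-complex based at a vertex. The pullback of the universal bundle $\tilde EG$ induces a bijection $$(-)^\star\tilde EG:\mathcal Top_\star(X,\tilde BG)/_{\simeq}\longrightarrow{}_X\mathcal Bun_G/_{\simeq},\qquad [f]\mapsto[f^\star\tilde EG],$$ between the (unpointed) homotopy classes of pointed continuous maps $X\to\tilde BG$ and the equivalence classes of $G$-bundles over $X$.
   Context: For a topological group $G$ and a space $X$, a $G$-bundle over $X$ is a space $P$ with a continuous right $G$-action and a continuous map $\pi:P\to X$ with $\pi(p\cdot g)=\pi(p)$, which is locally trivial: $X$ has an open cover $\{U_i\}$ with $G$-equivariant homeomorphisms $\pi^{-1}(U_i)\cong U_i\times G$ over $U_i$. An equivalence of $G$-bundles over $X$ is a $G$-equivariant homeomorphism over $X$, and ${}_X\mathcal Bun_G/_{\simeq}$ is the set of equivalence classes. For $f:X\to Y$ and a $G$-bundle $Q$ over $Y$, $f^\star Q:=X\times_YQ$. $\tilde EG$ is Milnor's infinite join of copies of $G$: points are formal sums $\sum_{i\in\mathbb N}t_i g_i$ with $t_i\in[0,1]$, finitely many nonzero, $\sum t_i=1$, $g_i\in G$ ($g_i$ disregarded when $t_i=0$), with the coarsest topology making all $t_i:\tilde EG\to[0,1]$ and all $g_i:t_i^{-1}((0,1])\to G$ continuous, and right $G$-action by right multiplication on every $g_i$. $\tilde BG$ is its orbit space, pointed at the orbit of the points with $t_0=1$. By Milnor, $\tilde EG$ is contractible and is a $G$-bundle over $\tilde BG$. The set $\mathcal Top_\star(X,\tilde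 BG)/_{\simeq}$ is the set of pointed continuous maps, two being identified when they are homotopic through not necessarily pointed maps. *)

theory Defs
  imports "HOL-Analysis.Analysis"
begin

text \<open>
  A topological group is a type \<open>'g\<close> of the library class \<open>topological_group_add\<close>, which
  assumes neither commutativity nor a separation axiom. Its operation is written additively, so
  the product \<open>g h\<close>, the unit and the inverse of the literature are \<open>g + h\<close>, \<open>0\<close> and \<open>- g\<close>, and
  the topology of the group is \<open>euclidean :: 'g topology\<close> (the topology given by \<open>open\<close>).
\<close>

definition closed_disk :: "nat \<Rightarrow> (nat \<Rightarrow> real) topology" where
  "closed_disk n = subtopology (Euclidean_space n) {v. (\<Sum>k<n. (v k)\<^sup>2) \<le> 1}"

definition open_disk :: "nat \<Rightarrow> (nat \<Rightarrow> real) set" where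
  "open_disk n = {v \<in> topspace (Euclidean_space n). (\<Sum>k<n. (v k)\<^sup>2) < 1}"

definition disk_boundary :: "nat \<Rightarrow> (nat \<Rightarrow> real) set" where
  "disk_boundary n = {v \<in> topspace (Euclidean_space n). (\<Sum>k<n. (v k)\<^sup>2) = 1}"

text \<open>
  \<open>X\<close> is a CW-complex with cells indexed by \<open>I\<close>, where \<open>d i\<close> is the dimension and \<open>\<Phi> i\<close> the
  characteristic map of the cell \<open>i\<close>; the values of \<open>\<Phi> i\<close> outside the disk are irrelevant.
  The last two conditions are closure-finiteness and the weak topology.
\<close>

definition cw_complex ::
  "'x topology \<Rightarrow> 'i set \<Rightarrow> ('i \<Rightarrow> nat) \<Rightarrow> ('i \<Rightarrow> (nat \<Rightarrow> real) \<Rightarrow> 'x) \<Rightarrow> bool" where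
  "cw_complex X I d \<Phi> \<longleftrightarrow>
     Hausdorff_space X \<and>
     (\<forall>i\<in>I. continuous_map (closed_disk (d i)) X (\<Phi> i)) \<and>
     (\<forall>i\<in>I. homeomorphic_map (subtopology (closed_disk (d i)) (open_disk (d i)))
                             (subtopology X (\<Phi> i ` open_disk (d i))) (\<Phi> i)) \<and>
     disjoint_family_on (\<lambda>i. \<Phi> i ` open_disk (d i)) I \<and>
     (\<Union>i\<in>I. \<Phi> i ` open_disk (d i)) = topspace X \<and>
     (\<forall>i\<in>I. \<exists>J. finite J \<and> J \<subseteq> {j \<in> I. d j < d i} \<and>
                \<Phi> i ` disk_boundary (d i) \<subseteq> (\<Union>j\<in>J. \<Phi> j ` open_disk (d j))) \<and>
     (\<forall>A \<subseteq> topspace X.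
        (\<forall>i\<in>I. closedin X (A \<inter> X closure_of (\<Phi> i ` open_disk (d i)))) \<longrightarrow> closedin X A)"

definition cw_vertices ::
  "'i set \<Rightarrow> ('i \<Rightarrow> nat) \<Rightarrow> ('i \<Rightarrow> (nat \<Rightarrow> real) \<Rightarrow> 'x) \<Rightarrow> 'x set" where
  "cw_vertices I d \<Phi> = (\<Union>i\<in>{i \<in> I. d i = 0}. \<Phi> i ` open_disk (d i))"

text \<open>
  The total space is an abstract topology; only the values of the projection and of the action
  on \<open>topspace\<close> of it are meaningful.
\<close>

record ('p, 'x, 'g) gbundle =
  btotal :: "'p topology"
  bproj :: "'p \<Rightarrow> 'x"
  bact :: "'p \<Rightarrow> 'g \<Rightarrow> 'p"

definition equivariant_on ::
  "'p set \<Rightarrow> ('p \<Rightarrow> 'g \<Rightarrow> 'p) \<Rightarrow> ('q \<Rightarrow> 'g \<Rightarrow> 'q) \<Rightarrow> ('p \<Rightarrow> 'q) \<Rightarrow> bool" where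
  "equivariant_on S a b \<phi> \<longleftrightarrow> (\<forall>p\<in>S. \<forall>g. \<phi> (a p g) = b (\<phi> p) g)"

definition trivial_over ::
  "'x topology \<Rightarrow> ('p, 'x, 'g::topological_group_add) gbundle \<Rightarrow> 'x set \<Rightarrow> bool" where
  "trivial_over X P U \<longleftrightarrow>
     (\<exists>\<phi>. homeomorphic_map (subtopology (btotal P) (bproj P -` U))
            (prod_topology (subtopology X U) (euclidean :: 'g topology)) \<phi> \<and>
          equivariant_on (topspace (btotal P) \<inter> bproj P -` U)
            (bact P) (\<lambda>(x, h) g. (x, h + g)) \<phi> \<and>
          (\<forall>p \<in> topspace (btotal P) \<inter> bproj P -` U. fst (\<phi> p) = bproj P p))"

definition G_bundle ::
  "'x topology \<Rightarrow> ('p, 'x, 'g::topological_group_add) gbundle \<Rightarrow> bool" where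
  "G_bundle X P \<longleftrightarrow>
     continuous_map (prod_topology (btotal P) (euclidean :: 'g topology)) (btotal P)
       (\<lambda>(p, g). bact P p g) \<and>
     (\<forall>p \<in> topspace (btotal P). bact P p 0 = p) \<and>
     (\<forall>p \<in> topspace (btotal P). \<forall>g h. bact P (bact P p g) h = bact P p (g + h)) \<and>
     continuous_map (btotal P) X (bproj P) \<and>
     (\<forall>p \<in> topspace (btotal P). \<forall>g. bproj P (bact P p g) = bproj P p) \<and>
     (\<exists>\<U>. (\<forall>U\<in>\<U>. openin X U) \<and> \<Union>\<U> = topspace X \<and> (\<forall>U\<in>\<U>. trivial_over X P U))"

definition bundle_equivalent ::
  "('p, 'x, 'g) gbundle \<Rightarrow> ('q, 'x, 'g) gbundle \<Rightarrow> bool" where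
  "bundle_equivalent P Q \<longleftrightarrow>
     (\<exists>\<phi>. homeomorphic_map (btotal P) (btotal Q) \<phi> \<and>
          equivariant_on (topspace (btotal P)) (bact P) (bact Q) \<phi> \<and>
          (\<forall>p \<in> topspace (btotal P). bproj Q (\<phi> p) = bproj P p))"

text \<open>
  HOL has no set of all \<open>G\<close>-bundles over \<open>X\<close>: the total spaces of the elements of \<open>Bun X\<close> live in
  one fixed type \<open>'p\<close>. A type containing the points of all pullbacks of a bundle, such as
  \<open>'x \<times> 'q\<close> for a bundle over another space with total space in \<open>'q\<close>, represents the equivalence
  classes of these pullbacks.
\<close>

definition Bun :: "'x topology \<Rightarrow> ('p, 'x, 'g::topological_group_add) gbundle set" where
  "Bun X = {P. G_bundle X P}"

definition Bun_rel ::
  "'x topology \<Rightarrow> (('p, 'x, 'g::topological_group_add) gbundle \<times> ('p, 'x, 'g) gbundle) set" where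
  "Bun_rel X = {(P, Q). P \<in> Bun X \<and> Q \<in> Bun X \<and> bundle_equivalent P Q}"

definition pullback ::
  "'x topology \<Rightarrow> ('x \<Rightarrow> 'y) \<Rightarrow> ('q, 'y, 'g) gbundle \<Rightarrow> ('x \<times> 'q, 'x, 'g) gbundle" where
  "pullback X f Q =
     \<lparr>btotal = subtopology (prod_topology X (btotal Q)) {(x, q). f x = bproj Q q},
      bproj = fst,
      bact = (\<lambda>(x, q) g. (x, bact Q q g))\<rparr>"

text \<open>
  A formal sum is the family of its pairs \<open>(t\<^sub>i, g\<^sub>i)\<close>. As \<open>g\<^sub>i\<close> is disregarded when
  \<open>t\<^sub>i = 0\<close>, every formal sum is represented by its unique family with \<open>g\<^sub>i = 0\<close> whenever
  \<open>t\<^sub>i = 0\<close>; the action preserves this normal form.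
\<close>

type_synonym 'g formal_sum = "nat \<Rightarrow> real \<times> 'g"

definition milnor_points :: "'g::topological_group_add formal_sum set" where
  "milnor_points =
     {e. (\<forall>i. 0 \<le> fst (e i) \<and> fst (e i) \<le> 1) \<and>
         finite {i. fst (e i) \<noteq> 0} \<and>
         (\<Sum>i \<in> {i. fst (e i) \<noteq> 0}. fst (e i)) = 1 \<and>
         (\<forall>i. fst (e i) = 0 \<longrightarrow> snd (e i) = 0)}"

text \<open>
  The coarsest topology making the coordinates continuous is the one generated by these preimages
  (see \<open>milnor_E_coarsest\<close>).
\<close>

definition milnor_E :: "'g::topological_group_add formal_sum topology" where
  "milnor_E = topology_generated_by
     ({{e \<in> milnor_points. fst (e i) \<in> U} | i U. open U} \<union>
      {{e \<in> milnor_points. 0 < fst (e i) \<and> snd (e i) \<in> V} | i V. open V})"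

definition milnor_act ::
  "'g::topological_group_add formal_sum \<Rightarrow> 'g \<Rightarrow> 'g formal_sum" where
  "milnor_act e g = (\<lambda>i. if fst (e i) = 0 then (0, 0) else (fst (e i), snd (e i) + g))"

definition milnor_orbit :: "'g::topological_group_add formal_sum \<Rightarrow> 'g formal_sum set" where
  "milnor_orbit e = range (milnor_act e)"

definition quotient_topology :: "'a topology \<Rightarrow> ('a \<Rightarrow> 'b) \<Rightarrow> 'b topology" where
  "quotient_topology T q =
     topology (\<lambda>U. U \<subseteq> q ` topspace T \<and> openin T {a \<in> topspace T. q a \<in> U})"

definition milnor_B :: "'g::topological_group_add formal_sum set topology" where
  "milnor_B = quotient_topology milnor_E milnor_orbit"

definition milnor_base :: "'g::topological_group_add formal_sum set" where
  "milnor_base = milnor_orbit (\<lambda>i. if i = 0 then (1, 0) else (0, 0))"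

definition milnor_bundle ::
  "('g::topological_group_add formal_sum, 'g formal_sum set, 'g) gbundle" where
  "milnor_bundle = \<lparr>btotal = milnor_E, bproj = milnor_orbit, bact = milnor_act\<rparr>"

definition pointed_maps ::
  "'x topology \<Rightarrow> 'x \<Rightarrow> 'y topology \<Rightarrow> 'y \<Rightarrow> ('x \<Rightarrow> 'y) set" where
  "pointed_maps X x0 Y y0 = {f. continuous_map X Y f \<and> f x0 = y0}"

definition free_homotopy_rel ::
  "'x topology \<Rightarrow> 'x \<Rightarrow> 'y topology \<Rightarrow> 'y \<Rightarrow> (('x \<Rightarrow> 'y) \<times> ('x \<Rightarrow> 'y)) set" where
  "free_homotopy_rel X x0 Y y0 =
     {(f, f'). f \<in> pointed_maps X x0 Y y0 \<and> f' \<in> pointed_maps X x0 Y y0 \<and>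
               homotopic_with (\<lambda>_. True) X Y f f'}"

lemma openin_quotient_topology:
  "openin (quotient_topology T q) U \<longleftrightarrow>
     U \<subseteq> q ` topspace T \<and> openin T {a \<in> topspace T. q a \<in> U}"
proof -
  have "istopology (\<lambda>U. U \<subseteq> q ` topspace T \<and> openin T {a \<in> topspace T. q a \<in> U})"
    unfolding istopology_def
  proof (intro conjI allI impI)
    fix S S' assume S: "S \<subseteq> q ` topspace T \<and> openin T {a \<in> topspace T. q a \<in> S}"
      and S': "S' \<subseteq> q ` topspace T \<and> openin T {a \<in> topspace T. q a \<in> S'}"
    have "{a \<in> topspace T. q a \<in> S \<inter> S'}
            = {a \<in> topspace T. q a \<in> S} \<inter> {a \<in> topspace T. q a \<in> S'}" by auto
    then show "openin T {a \<in> topspace T. q a \<in> S \<inter> S'}" using S S' by auto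
    show "S \<inter> S' \<subseteq> q ` topspace T" using S by auto
  next
    fix \<K> assume K: "\<forall>K\<in>\<K>. K \<subseteq> q ` topspace T \<and> openin T {a \<in> topspace T. q a \<in> K}"
    have "{a \<in> topspace T. q a \<in> \<Union>\<K>} = (\<Union>K\<in>\<K>. {a \<in> topspace T. q a \<in> K})" by auto
    then show "openin T {a \<in> topspace T. q a \<in> \<Union>\<K>}" using K by auto
    show "\<Union>\<K> \<subseteq> q ` topspace T" using K by auto
  qed
  then show ?thesis unfolding quotient_topology_def by simp
qed

lemma topspace_quotient_topology: "topspace (quotient_topology T q) = q ` topspace T"
proof -
  have "{a \<in> topspace T. q a \<in> q ` topspace T} = topspace T" by auto
  then have "openin (quotient_topology T q) (q ` topspace T)"
    by (simp add: openin_quotient_topology)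
  then show ?thesis
    using openin_quotient_topology [of T q "topspace (quotient_topology T q)"]
    by (auto dest: openin_subset)
qed

lemma quotient_map_quotient_topology: "quotient_map T (quotient_topology T q) q"
  unfolding quotient_map_def by (auto simp: topspace_quotient_topology openin_quotient_topology)

lemma topspace_milnor_E: "topspace milnor_E = milnor_points"
  unfolding milnor_E_def topology_generated_by_topspace by (auto intro!: exI [of _ UNIV])

lemma continuous_map_milnor_E_fst:
  "continuous_map milnor_E (top_of_set {0..1}) (\<lambda>e. fst (e i))"
proof -
  have "openin milnor_E {e :: 'a formal_sum. e \<in> milnor_points \<and> fst (e i) \<in> U}"
    if "open U" for U
    unfolding milnor_E_def by (rule topology_generated_by_Basis) (use that in auto)
  then have "continuous_map milnor_E euclideanreal (\<lambda>e :: 'a formal_sum. fst (e i))"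
    by (simp add: continuous_map topspace_milnor_E)
  moreover have "fst (e i) \<in> {0..1}" if "e \<in> milnor_points" for e :: "'a formal_sum"
    using that by (simp add: milnor_points_def)
  ultimately show ?thesis
    by (auto simp: continuous_map_in_subtopology topspace_milnor_E)
qed

lemma continuous_map_milnor_E_snd:
  "continuous_map (subtopology milnor_E {e. 0 < fst (e i)}) euclidean (\<lambda>e. snd (e i))"
proof -
  have "openin milnor_E {e \<in> milnor_points. 0 < fst (e i) \<and> snd (e i) \<in> V}"
    if "open V" for V :: "'a set"
    unfolding milnor_E_def by (rule topology_generated_by_Basis) (use that in auto)
  moreover have "{e \<in> topspace (subtopology milnor_E {e. 0 < fst (e i)}). snd (e i) \<in> V}
      = {e. 0 < fst (e i)} \<inter> {e \<in> milnor_points. 0 < fst (e i) \<and> snd (e i) \<in> V}"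
    for V :: "'a set"
    by (auto simp: topspace_milnor_E)
  ultimately show ?thesis
    by (auto simp: continuous_map openin_subtopology_Int2)
qed

lemma milnor_E_coarsest:
  fixes T :: "'g::topological_group_add formal_sum topology"
  assumes top: "topspace T = milnor_points"
    and t: "\<And>i. continuous_map T (top_of_set {0..1}) (\<lambda>e. fst (e i))"
    and g: "\<And>i. continuous_map (subtopology T {e. 0 < fst (e i)}) euclidean (\<lambda>e. snd (e i))"
    and U: "openin milnor_E U"
  shows "openin T U"
proof -
  have t': "openin T {e \<in> milnor_points. fst (e i) \<in> W}" if "open W" for i W
  proof -
    have "continuous_map T euclideanreal (\<lambda>e. fst (e i))"
      using t [of i] by (simp add: continuous_map_in_subtopology)
    then show ?thesis using that top by (simp add: continuous_map)
  qed
  have g': "openin T {e \<in> milnor_points. 0 < fst (e i) \<and> snd (e i) \<in> V}" if "open V" for i V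
  proof -
    have "openin (subtopology T {e. 0 < fst (e i)})
            {e \<in> topspace (subtopology T {e. 0 < fst (e i)}). snd (e i) \<in> V}"
      using g [of i] that by (auto simp: continuous_map)
    then obtain S where "openin T S"
      and S: "{e \<in> topspace (subtopology T {e. 0 < fst (e i)}). snd (e i) \<in> V}
                = S \<inter> {e. 0 < fst (e i)}"
      by (auto simp: openin_subtopology)
    moreover have "openin T {e \<in> milnor_points. fst (e i) \<in> {0<..}}" by (rule t') simp
    ultimately have "openin T (S \<inter> {e \<in> milnor_points. fst (e i) \<in> {0<..}})" by blast
    moreover have "S \<inter> {e \<in> milnor_points. fst (e i) \<in> {0<..}}
        = {e \<in> milnor_points. 0 < fst (e i) \<and> snd (e i) \<in> V}"
      using S top openin_subset [OF \<open>openin T S\<close>] by auto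
    ultimately show ?thesis by simp
  qed
  have "generate_topology_on
     ({{e \<in> milnor_points. fst (e i) \<in> U} | i U. open U} \<union>
      {{e \<in> milnor_points. 0 < fst (e i) \<and> snd (e i) \<in> V} | i V. open V}) U"
    using U unfolding milnor_E_def openin_topology_generated_by_iff .
  then show ?thesis
    by (rule generate_topology_on_coarsest [OF istopology_openin, rotated]) (use t' g' in auto)
qed

lemma equiv_free_homotopy_rel: "equiv (pointed_maps X x0 Y y0) (free_homotopy_rel X x0 Y y0)"
  unfolding equiv_def refl_on_def sym_def trans_def free_homotopy_rel_def
  by (auto simp: pointed_maps_def homotopic_with_sym intro: homotopic_with_trans)

lemma bundle_equivalent_refl: "bundle_equivalent P P"
  unfolding bundle_equivalent_def equivariant_on_def
  by (rule exI [of _ id]) (auto simp: homeomorphic_map_id)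

lemma bundle_equivalent_trans:
  assumes "bundle_equivalent P Q" and "bundle_equivalent Q R"
  shows "bundle_equivalent P R"
proof -
  obtain \<phi> where \<phi>: "homeomorphic_map (btotal P) (btotal Q) \<phi>"
      "\<And>p g. p \<in> topspace (btotal P) \<Longrightarrow> \<phi> (bact P p g) = bact Q (\<phi> p) g"
      "\<And>p. p \<in> topspace (btotal P) \<Longrightarrow> bproj Q (\<phi> p) = bproj P p"
    using assms(1) unfolding bundle_equivalent_def equivariant_on_def by blast
  obtain \<psi> where \<psi>: "homeomorphic_map (btotal Q) (btotal R) \<psi>"
      "\<And>p g. p \<in> topspace (btotal Q) \<Longrightarrow> \<psi> (bact Q p g) = bact R (\<psi> p) g"
      "\<And>p. p \<in> topspace (btotal Q) \<Longrightarrow> bproj R (\<psi> p) = bproj Q p"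
    using assms(2) unfolding bundle_equivalent_def equivariant_on_def by blast
  have "\<phi> p \<in> topspace (btotal Q)" if "p \<in> topspace (btotal P)" for p
    using homeomorphic_imp_surjective_map [OF \<phi>(1)] that by blast
  then show ?thesis
    unfolding bundle_equivalent_def equivariant_on_def
    using \<phi> \<psi> by (intro exI [of _ "\<psi> \<circ> \<phi>"]) (auto intro: homeomorphic_map_compose)
qed

lemma bundle_equivalent_sym:
  assumes "bundle_equivalent P Q" and P: "G_bundle X P"
  shows "bundle_equivalent Q P"
proof -
  obtain \<phi> where \<phi>: "homeomorphic_map (btotal P) (btotal Q) \<phi>"
      "\<And>p g. p \<in> topspace (btotal P) \<Longrightarrow> \<phi> (bact P p g) = bact Q (\<phi> p) g"
      "\<And>p. p \<in> topspace (btotal P) \<Longrightarrow> bproj Q (\<phi> p) = bproj P p"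
    using assms(1) unfolding bundle_equivalent_def equivariant_on_def by blast
  obtain \<psi> where \<psi>: "homeomorphic_maps (btotal P) (btotal Q) \<phi> \<psi>"
    using \<phi>(1) by (auto simp: homeomorphic_map_maps)
  have inv: "\<psi> (\<phi> p) = p" if "p \<in> topspace (btotal P)" for p
    using \<psi> that by (simp add: homeomorphic_maps_def)
  have act: "bact P p g \<in> topspace (btotal P)" if "p \<in> topspace (btotal P)" for p g
  proof -
    have "(\<lambda>(p, g). bact P p g) \<in> topspace (btotal P) \<times> UNIV \<rightarrow> topspace (btotal P)"
      using P unfolding G_bundle_def continuous_map_def by simp
    then have "(\<lambda>(p, g). bact P p g) (p, g) \<in> topspace (btotal P)"
      by (rule funcset_mem) (use that in simp)
    then show ?thesis by simp
  qed
  have surj: "topspace (btotal Q) = \<phi> ` topspace (btotal P)"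
    using homeomorphic_imp_surjective_map [OF \<phi>(1)] by simp
  have "homeomorphic_map (btotal Q) (btotal P) \<psi>"
    using \<psi> homeomorphic_maps_map by blast
  moreover have "\<forall>q\<in>topspace (btotal Q). \<forall>g. \<psi> (bact Q q g) = bact P (\<psi> q) g"
  proof (intro ballI allI)
    fix q g assume "q \<in> topspace (btotal Q)"
    then obtain p where p: "p \<in> topspace (btotal P)" "q = \<phi> p" using surj by auto
    then have "\<psi> (bact Q q g) = \<psi> (\<phi> (bact P p g))" by (simp add: \<phi>(2))
    then show "\<psi> (bact Q q g) = bact P (\<psi> q) g" using p by (simp add: inv act)
  qed
  moreover have "\<forall>q\<in>topspace (btotal Q). bproj P (\<psi> q) = bproj Q q"
    using surj inv \<phi>(3) by auto
  ultimately show ?thesis unfolding bundle_equivalent_def equivariant_on_def by blast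
qed

lemma equiv_Bun_rel: "equiv (Bun X) (Bun_rel X)"
  unfolding equiv_def refl_on_def sym_def trans_def Bun_rel_def Bun_def
  by (auto intro: bundle_equivalent_refl bundle_equivalent_sym bundle_equivalent_trans)

end

theory Submission
  imports Defs
begin

text \<open>
  A map \<open>X \<rightarrow> B\<close> into the orbit space \<open>B\<close> of Milnor's join \<open>E\<close>, together with an isomorphism of \<open>P\<close>
  with the pulled back bundle, is the same as an equivariant map \<open>P \<rightarrow> E\<close>. Such a map exists since it can
  be extended over one cell of \<open>X\<close> after the other: a bundle over a disk has a section, and a map from
  the boundary sphere to \<open>E\<close> extends over the disk because \<open>E\<close> is contractible. Over the base vertex
  the values can be prescribed, so that the resulting map is pointed. Any two equivariant maps \<open>P \<rightarrow> E\<close>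
  are equivariantly homotopic, by moving one to the even and the other to the odd coordinates of the
  join; hence equivalent pullbacks come from homotopic maps. Conversely, a homotopy
  \<open>X \<times> [0, 1] \<rightarrow> B\<close> that starts at \<open>f\<close> is lifted, again cell by cell, to an equivariant homotopy from the
  pullback of \<open>E\<close> along \<open>f\<close> to \<open>E\<close>, whose end is a bundle map covering the other end of the homotopy.
\<close>

section \<open>Charts and the division map of a bundle\<close>

text \<open>Two obstacles shape the proof. No separation axiom is available for the group or the
  join, and continuity on a total space cannot be tested cell by cell. It is therefore tested along
  local sections, on subsets of X \<times> [0, 1]. This product does carry the weak topology because
  the interval is compact, which is why every extension step has an interval parameter from the
  start. Finding a classifying map and lifting a homotopy are then two instances of one extension
  problem that differ only in the relation \<open>R\<close>. Contractibility of the join is not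
  quoted. The explicit homotopy \<open>milnor_join\<close> between two arbitrary points is
  continuous in both of them and commutes with the action: with one end constant it contracts the
  join, and with an equivariant map at either end it is an equivariant homotopy. Its form is
  dictated by the topology of the join: a group coordinate is continuous only where its weight is
  positive, so it cannot be deformed but only copied to a vacant position, to which the weight is
  then shifted.\<close>

lemma continuous_map_compose':
  "continuous_map X Y f \<Longrightarrow> continuous_map Y Z g \<Longrightarrow> continuous_map X Z (\<lambda>x. g (f x))"
  using continuous_map_compose [of X Y f Z g] by (simp add: o_def)

lemma continuous_map_compose_subtopology:
  assumes "continuous_map Z X f" and "\<And>z. z \<in> topspace Z \<Longrightarrow> f z \<in> U"
    and "continuous_map (subtopology X U) Y g"
  shows "continuous_map Z Y (\<lambda>z. g (f z))"
  using assms by (intro continuous_map_compose' [of Z "subtopology X U" f Y g])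
    (auto simp: continuous_map_in_subtopology)

lemma continuous_map_in_topspace: "continuous_map X Y f \<Longrightarrow> x \<in> topspace X \<Longrightarrow> f x \<in> topspace Y"
  by (auto simp: continuous_map_def)

lemma continuous_map_openin_preimage:
  "continuous_map X Y f \<Longrightarrow> openin Y U \<Longrightarrow> openin X {x \<in> topspace X. f x \<in> U}"
  by (simp add: continuous_map)

lemma continuous_map_locally:
  assumes "\<And>x. x \<in> topspace X \<Longrightarrow>
    \<exists>U. openin X U \<and> x \<in> U \<and> continuous_map (subtopology X U) Y f"
  shows "continuous_map X Y f"
proof (rule pasting_lemma [where I = "{U. openin X U \<and> continuous_map (subtopology X U) Y f}"
      and T = id and f = "\<lambda>_. f"])
qed (use assms in auto)

lemma continuous_map_group_add:
  fixes f g :: "'a \<Rightarrow> 'g::topological_monoid_add"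
  assumes "continuous_map Z euclidean f" and "continuous_map Z euclidean g"
  shows "continuous_map Z euclidean (\<lambda>z. f z + g z)"
proof -
  have "continuous_on UNIV (\<lambda>x :: 'g \<times> 'g. fst x + snd x)"
    by (intro continuous_intros)
  then have "continuous_map (prod_topology euclidean euclidean) euclidean
      (\<lambda>x :: 'g \<times> 'g. fst x + snd x)"
    by simp
  from continuous_map_compose' [OF continuous_map_pairedI [OF assms] this] show ?thesis
    by simp
qed

lemma continuous_map_group_minus:
  fixes f :: "'a \<Rightarrow> 'g::topological_group_add"
  assumes "continuous_map Z euclidean f"
  shows "continuous_map Z euclidean (\<lambda>z. - f z)"
proof -
  have "continuous_on UNIV (\<lambda>x :: 'g. - x)"
    by (intro continuous_intros)
  then show ?thesis
    using continuous_map_compose' [OF assms, of euclidean uminus] by simp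
qed

text \<open>A trivialisation in another guise: \<open>\<sigma>\<close> is the section with group
  coordinate 0 and \<open>\<gamma>\<close> the second coordinate. Two plain maps compose more easily
  than a homeomorphism of subspaces, and equivariance of the coordinate follows from the last two
  clauses (\<open>chart_act\<close>).\<close>

definition chart ::
  "'x topology \<Rightarrow> ('p, 'x, 'g::topological_group_add) gbundle \<Rightarrow> 'x set \<Rightarrow> ('x \<Rightarrow> 'p) \<Rightarrow> ('p \<Rightarrow> 'g)
    \<Rightarrow> bool" where
  "chart X P U \<sigma> \<gamma> \<longleftrightarrow>
     openin X U \<and>
     continuous_map (subtopology X U) (btotal P) \<sigma> \<and>
     (\<forall>x\<in>U. bproj P (\<sigma> x) = x) \<and>
     continuous_map (subtopology (btotal P) (bproj P -` U)) euclidean \<gamma> \<and>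
     (\<forall>p\<in>topspace (btotal P). bproj P p \<in> U \<longrightarrow> bact P (\<sigma> (bproj P p)) (\<gamma> p) = p) \<and>
     (\<forall>x\<in>U. \<forall>h. \<gamma> (bact P (\<sigma> x) h) = h)"

lemma chart_continuous:
  assumes "chart X P U \<sigma> \<gamma>"
  shows "continuous_map (subtopology X U) (btotal P) \<sigma>"
    and "continuous_map (subtopology (btotal P) (bproj P -` U)) euclidean \<gamma>"
  using assms by (simp_all add: chart_def)

lemma chart_coordinate: "chart X P U \<sigma> \<gamma> \<Longrightarrow> x \<in> U \<Longrightarrow> \<gamma> (bact P (\<sigma> x) h) = h"
  unfolding chart_def by blast

text \<open>All of \<open>G_bundle\<close> except local triviality, so that the rules for action and
  projection can be used while the charts of a concrete bundle are still being constructed.\<close>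

definition pre_bundle :: "'x topology \<Rightarrow> ('p, 'x, 'g::topological_group_add) gbundle \<Rightarrow> bool" where
  "pre_bundle X P \<longleftrightarrow>
     continuous_map (prod_topology (btotal P) (euclidean :: 'g topology)) (btotal P)
       (\<lambda>(p, g). bact P p g) \<and>
     (\<forall>p \<in> topspace (btotal P). bact P p 0 = p) \<and>
     (\<forall>p \<in> topspace (btotal P). \<forall>g h. bact P (bact P p g) h = bact P p (g + h)) \<and>
     continuous_map (btotal P) X (bproj P) \<and>
     (\<forall>p \<in> topspace (btotal P). \<forall>g. bproj P (bact P p g) = bproj P p)"

locale pre_principal_bundle =
  fixes X :: "'x topology" and P :: "('p, 'x, 'g::topological_group_add) gbundle"
  assumes pre: "pre_bundle X P"
begin

lemma continuous_act:
  assumes "continuous_map Z (btotal P) f" and "continuous_map Z euclidean g"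
  shows "continuous_map Z (btotal P) (\<lambda>z. bact P (f z) (g z))"
proof -
  have "continuous_map (prod_topology (btotal P) euclidean) (btotal P) (\<lambda>(p, g). bact P p g)"
    using pre by (simp add: pre_bundle_def)
  from continuous_map_compose' [OF continuous_map_pairedI [OF assms] this] show ?thesis by simp
qed

lemma act_in: "p \<in> topspace (btotal P) \<Longrightarrow> bact P p g \<in> topspace (btotal P)"
  using continuous_map_in_topspace [OF continuous_act, of "btotal P" id "\<lambda>_. g" p] by simp

lemma act_0: "p \<in> topspace (btotal P) \<Longrightarrow> bact P p 0 = p"
  and act_act: "p \<in> topspace (btotal P) \<Longrightarrow> bact P (bact P p g) h = bact P p (g + h)"
  and continuous_proj: "continuous_map (btotal P) X (bproj P)"
  and proj_act: "p \<in> topspace (btotal P) \<Longrightarrow> bproj P (bact P p g) = bproj P p"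
  using pre by (auto simp: pre_bundle_def)

lemma proj_in: "p \<in> topspace (btotal P) \<Longrightarrow> bproj P p \<in> topspace X"
  using continuous_map_in_topspace [OF continuous_proj] .

lemma chart_section_in:
  assumes "chart X P U \<sigma> \<gamma>" and "x \<in> U"
  shows "\<sigma> x \<in> topspace (btotal P)" "x \<in> topspace X" "bproj P (\<sigma> x) = x"
proof -
  show x: "x \<in> topspace X" using assms openin_subset unfolding chart_def by blast
  show "\<sigma> x \<in> topspace (btotal P)" "bproj P (\<sigma> x) = x"
    using assms x continuous_map_in_topspace [of "subtopology X U" "btotal P" \<sigma> x]
    by (auto simp: chart_def)
qed

lemma chart_decompose:
  assumes "chart X P U \<sigma> \<gamma>" and "p \<in> topspace (btotal P)" and "bproj P p \<in> U"
  shows "bact P (\<sigma> (bproj P p)) (\<gamma> p) = p"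
  using assms by (auto simp: chart_def)

lemma chart_act:
  assumes c: "chart X P U \<sigma> \<gamma>" and p: "p \<in> topspace (btotal P)" "bproj P p \<in> U"
  shows "\<gamma> (bact P p g) = \<gamma> p + g"
proof -
  have "bact P p g = bact P (bact P (\<sigma> (bproj P p)) (\<gamma> p)) g"
    by (simp add: chart_decompose [OF c p])
  also have "\<dots> = bact P (\<sigma> (bproj P p)) (\<gamma> p + g)"
    by (rule act_act) (rule chart_section_in [OF c p(2)])
  finally show ?thesis using c p by (simp add: chart_def)
qed

lemma trivial_overI:
  assumes c: "chart X P U \<sigma> \<gamma>"
  shows "trivial_over X P U"
proof -
  let ?T = "btotal P" and ?pi = "bproj P"
  let ?E = "subtopology ?T (?pi -` U)"
  let ?\<phi> = "\<lambda>p. (?pi p, \<gamma> p)" and ?\<psi> = "\<lambda>(x, h). bact P (\<sigma> x) h"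
  have "continuous_map ?E (subtopology X U) ?pi"
    by (auto simp: continuous_map_in_subtopology intro: continuous_map_from_subtopology continuous_proj)
  then have 1: "continuous_map ?E (prod_topology (subtopology X U) euclidean) ?\<phi>"
    using c by (auto simp: chart_def continuous_map_paired)
  have s: "continuous_map (prod_topology (subtopology X U) (euclidean :: 'g topology)) ?T (\<lambda>z. \<sigma> (fst z))"
    using c by (intro continuous_map_compose' [OF continuous_map_fst]) (auto simp: chart_def)
  have "continuous_map (prod_topology (subtopology X U) (euclidean :: 'g topology)) ?T ?\<psi>"
    unfolding case_prod_unfold by (intro continuous_act s continuous_map_snd)
  then have 2: "continuous_map (prod_topology (subtopology X U) (euclidean :: 'g topology)) ?E ?\<psi>"
    by (auto simp: continuous_map_in_subtopology proj_act chart_section_in [OF c])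
  have "homeomorphic_maps ?E (prod_topology (subtopology X U) euclidean) ?\<phi> ?\<psi>"
    unfolding homeomorphic_maps_def using 1 2 c
    by (auto simp: chart_decompose [OF c] proj_act chart_section_in [OF c]) (auto simp: chart_def)
  then have "homeomorphic_map ?E (prod_topology (subtopology X U) euclidean) ?\<phi>"
    by (rule homeomorphic_maps_imp_map)
  then show ?thesis unfolding trivial_over_def
    by (intro exI [of _ ?\<phi>]) (auto simp: equivariant_on_def proj_act chart_act [OF c])
qed

lemma G_bundleI:
  assumes "\<And>x. x \<in> topspace X \<Longrightarrow> \<exists>U \<sigma> \<gamma>. x \<in> U \<and> chart X P U \<sigma> \<gamma>"
  shows "G_bundle X P"
proof -
  let ?\<U> = "{U. \<exists>\<sigma> \<gamma>. chart X P U \<sigma> \<gamma>}"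
  have "(\<forall>U\<in>?\<U>. openin X U) \<and> \<Union>?\<U> = topspace X \<and> (\<forall>U\<in>?\<U>. trivial_over X P U)"
  proof (intro conjI ballI)
    show "openin X U" if "U \<in> ?\<U>" for U using that by (auto simp: chart_def)
    show "\<Union>?\<U> = topspace X" using assms chart_section_in(2) by blast
  qed (auto intro: trivial_overI)
  with pre show ?thesis unfolding G_bundle_def pre_bundle_def
    by (elim conjE, intro conjI exI [of _ ?\<U>])
qed

end

text \<open>The translation function of a principal bundle. It is meaningful only for two points of
  one fibre, on which the action is free and transitive.\<close>

definition bdiv :: "('p, 'x, 'g::topological_group_add) gbundle \<Rightarrow> 'p \<Rightarrow> 'p \<Rightarrow> 'g" where
  "bdiv P p q = (THE g. bact P p g = q)"

locale principal_bundle =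
  fixes X :: "'x topology" and P :: "('p, 'x, 'g::topological_group_add) gbundle"
  assumes is_bundle: "G_bundle X P"
begin

sublocale pre_principal_bundle X P
  using is_bundle by unfold_locales (simp add: G_bundle_def pre_bundle_def)

lemma chart_exists:
  assumes "x \<in> topspace X"
  obtains U \<sigma> \<gamma> where "x \<in> U" "chart X P U \<sigma> \<gamma>"
proof -
  let ?T = "btotal P" and ?pi = "bproj P"
  obtain U where U: "openin X U" "x \<in> U" "trivial_over X P U"
    using is_bundle assms unfolding G_bundle_def by (metis Union_iff)
  let ?E = "subtopology ?T (?pi -` U)"
  have UX: "U \<subseteq> topspace X" using U openin_subset by blast
  obtain \<phi> where "homeomorphic_map ?E (prod_topology (subtopology X U) (euclidean :: 'g topology)) \<phi>"
    and e: "equivariant_on (topspace ?T \<inter> ?pi -` U) (bact P) (\<lambda>(x, h) g. (x, h + g)) \<phi>"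
    and f: "\<forall>p\<in>topspace ?T \<inter> ?pi -` U. fst (\<phi> p) = ?pi p"
    using U(3) unfolding trivial_over_def by blast
  then obtain \<psi> where h: "homeomorphic_maps ?E (prod_topology (subtopology X U) euclidean) \<phi> \<psi>"
    by (auto simp: homeomorphic_map_maps)
  have c1: "continuous_map ?E (prod_topology (subtopology X U) euclidean) \<phi>"
    and c2: "continuous_map (prod_topology (subtopology X U) euclidean) ?E \<psi>"
    and i1: "\<And>p. p \<in> topspace ?T \<Longrightarrow> ?pi p \<in> U \<Longrightarrow> \<psi> (\<phi> p) = p"
    and i2: "\<And>x g. x \<in> U \<Longrightarrow> \<phi> (\<psi> (x, g)) = (x, g)"
    using h UX by (auto simp: homeomorphic_maps_def)
  have in\<psi>: "\<psi> (x, g) \<in> topspace ?T \<and> ?pi (\<psi> (x, g)) \<in> U" if "x \<in> U" for x g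
    using continuous_map_in_topspace [OF c2, of "(x, g)"] that UX by auto
  have pi\<psi>: "?pi (\<psi> (x, g)) = x" if "x \<in> U" for x g
  proof -
    have "fst (\<phi> (\<psi> (x, g))) = ?pi (\<psi> (x, g))" using f in\<psi> [OF that, of g] by blast
    then show ?thesis by (simp add: i2 [OF that])
  qed
  \<comment> \<open>Equivariance is given for \<open>\<phi>\<close> only. It passes to the inverse
    because both sides have the same image under \<open>\<phi>\<close>.\<close>
  have act\<psi>: "bact P (\<psi> (x, 0)) h = \<psi> (x, h)" if "x \<in> U" for x h
  proof -
    have "\<phi> (bact P (\<psi> (x, 0)) h) = (x, h)"
      using e in\<psi> [OF that, of 0] i2 [OF that, of 0] by (auto simp: equivariant_on_def)
    then show ?thesis
      using i1 [of "bact P (\<psi> (x, 0)) h"] in\<psi> [OF that, of 0] by (simp add: act_in proj_act)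
  qed
  have "chart X P U (\<lambda>x. \<psi> (x, 0)) (\<lambda>p. snd (\<phi> p))"
    unfolding chart_def
  proof (intro conjI ballI allI impI)
    have "continuous_map (subtopology X U) (prod_topology (subtopology X U) euclidean) (\<lambda>x. (x, 0 :: 'g))"
      by (intro continuous_intros) auto
    from continuous_map_compose' [OF this c2] show "continuous_map (subtopology X U) ?T (\<lambda>x. \<psi> (x, 0))"
      by (simp add: continuous_map_in_subtopology)
    show "continuous_map ?E euclidean (\<lambda>p. snd (\<phi> p))"
      using continuous_map_compose' [OF c1 continuous_map_snd] .
    fix p assume p: "p \<in> topspace ?T" "?pi p \<in> U"
    have "\<phi> p = (?pi p, snd (\<phi> p))" using f p by (metis IntI prod.collapse vimageI)
    then show "bact P (\<psi> (?pi p, 0)) (snd (\<phi> p)) = p"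
      using i1 [OF p] by (simp add: act\<psi> p)
  qed (auto simp: U pi\<psi> act\<psi> i2)
  then show thesis using U that by blast
qed

text \<open>In the chart p and q are the translates of one point \<open>\<sigma> x\<close> by
  \<open>\<gamma> p\<close> and \<open>\<gamma> q\<close>. The group is not commutative, so the
  order of the two terms matters.\<close>

lemma bdiv_chart:
  assumes c: "chart X P U \<sigma> \<gamma>" and p: "p \<in> topspace (btotal P)" and q: "q \<in> topspace (btotal P)"
    and eq: "bproj P p = bproj P q" and U: "bproj P p \<in> U"
  shows "bdiv P p q = - \<gamma> p + \<gamma> q" "bact P p (- \<gamma> p + \<gamma> q) = q"
    "bact P p g = q \<Longrightarrow> g = bdiv P p q"
proof -
  have uniq: "g = - \<gamma> p + \<gamma> q" if "bact P p g = q" for g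
    using chart_act [OF c p U, of g] that by (simp add: algebra_simps)
  have "bact P p (- \<gamma> p + \<gamma> q) = bact P (bact P (\<sigma> (bproj P p)) (\<gamma> p)) (- \<gamma> p + \<gamma> q)"
    by (simp add: chart_decompose [OF c p U])
  also have "\<dots> = bact P (\<sigma> (bproj P p)) (\<gamma> q)"
    using chart_section_in [OF c U] by (subst act_act) (auto simp: algebra_simps)
  also have "\<dots> = q" using chart_decompose [OF c q] U eq by simp
  finally show a: "bact P p (- \<gamma> p + \<gamma> q) = q" .
  show b: "bdiv P p q = - \<gamma> p + \<gamma> q"
    unfolding bdiv_def using a uniq by (rule the_equality)
  show "bact P p g = q \<Longrightarrow> g = bdiv P p q" using uniq b by simp
qed

lemma act_bdiv:
  assumes "p \<in> topspace (btotal P)" and "q \<in> topspace (btotal P)" and "bproj P p = bproj P q"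
  shows "bact P p (bdiv P p q) = q"
  using chart_exists [OF proj_in [OF assms(1)]] bdiv_chart(1,2) [OF _ assms] by metis

lemma bdiv_unique:
  assumes "p \<in> topspace (btotal P)" and "bact P p g = q"
  shows "bdiv P p q = g"
  using assms chart_exists [OF proj_in [OF assms(1)]] bdiv_chart(3) [OF _ assms(1) _ _ _ assms(2)]
  by (metis act_in proj_act)

lemma bdiv_act_right:
  assumes "p \<in> topspace (btotal P)" and "q \<in> topspace (btotal P)" and "bproj P p = bproj P q"
  shows "bdiv P p (bact P q g) = bdiv P p q + g"
  by (rule bdiv_unique) (use assms in \<open>simp_all add: act_act [symmetric] act_bdiv\<close>)

lemma bdiv_self: "p \<in> topspace (btotal P) \<Longrightarrow> bdiv P p p = 0"
  by (rule bdiv_unique) (simp_all add: act_0)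

text \<open>Continuity is local, and in a chart the division map has the explicit formula of
  \<open>bdiv_chart\<close>. All corrections of lifts and all inverses of bundle maps below get
  their continuity from here.\<close>

lemma continuous_bdiv:
  assumes f: "continuous_map Z (btotal P) f" and g: "continuous_map Z (btotal P) g"
    and eq: "\<And>z. z \<in> topspace Z \<Longrightarrow> bproj P (f z) = bproj P (g z)"
  shows "continuous_map Z euclidean (\<lambda>z. bdiv P (f z) (g z))"
proof (rule continuous_map_locally)
  fix z assume z: "z \<in> topspace Z"
  note fz = continuous_map_in_topspace [OF f] and gz = continuous_map_in_topspace [OF g]
  obtain U \<sigma> \<gamma> where U: "bproj P (f z) \<in> U" and c: "chart X P U \<sigma> \<gamma>"
    using chart_exists [OF proj_in [OF fz [OF z]]] .
  define V where "V = {z \<in> topspace Z. bproj P (f z) \<in> U}"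
  have V: "openin Z V" unfolding V_def
    using continuous_map_openin_preimage [OF continuous_map_compose' [OF f continuous_proj]] c
    by (simp add: chart_def)
  have \<gamma>: "continuous_map (subtopology (btotal P) (bproj P -` U)) euclidean \<gamma>"
    using c by (simp add: chart_def)
  have "continuous_map (subtopology Z V) euclidean (\<lambda>z. - \<gamma> (f z) + \<gamma> (g z))"
    by (intro continuous_map_group_add continuous_map_group_minus
        continuous_map_compose_subtopology [OF _ _ \<gamma>] continuous_map_from_subtopology f g)
      (auto simp: V_def eq [symmetric])
  then have "continuous_map (subtopology Z V) euclidean (\<lambda>z. bdiv P (f z) (g z))"
    by (rule continuous_map_eq) (auto simp: V_def bdiv_chart [OF c] fz gz eq)
  then show "\<exists>V. openin Z V \<and> z \<in> V \<and> continuous_map (subtopology Z V) euclidean (\<lambda>z. bdiv P (f z) (g z))"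
    using V z U by (intro exI [of _ V]) (auto simp: V_def)
qed

lemma pullback_bundle:
  assumes f: "continuous_map W X f"
  shows "G_bundle W (pullback W f P)"
proof -
  let ?Q = "pullback W f P"
  let ?S = "{(w, q). f w = bproj P q}"
  have T: "btotal ?Q = subtopology (prod_topology W (btotal P)) ?S" "bproj ?Q = fst"
    "\<And>z g. bact ?Q z g = (fst z, bact P (snd z) g)"
    by (auto simp: pullback_def case_prod_unfold)
  have fstc: "continuous_map (btotal ?Q) W fst" and sndc: "continuous_map (btotal ?Q) (btotal P) snd"
    unfolding T by (auto intro: continuous_map_from_subtopology continuous_intros)
  have pre: "pre_bundle W ?Q"
    unfolding pre_bundle_def
  proof (intro conjI ballI allI)
    let ?Z = "prod_topology (btotal ?Q) (euclidean :: 'g topology)"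
    have "continuous_map ?Z (prod_topology W (btotal P)) (\<lambda>z. (fst (fst z), bact P (snd (fst z)) (snd z)))"
      by (intro continuous_map_pairedI continuous_act continuous_map_snd
          continuous_map_compose' [OF continuous_map_fst fstc]
          continuous_map_compose' [OF continuous_map_fst sndc])
    moreover have "(fst (fst z), bact P (snd (fst z)) (snd z)) \<in> ?S" if "z \<in> topspace ?Z" for z
      using that by (auto simp: T proj_act)
    ultimately show "continuous_map ?Z (btotal ?Q) (\<lambda>(p, g). bact ?Q p g)"
      by (auto simp: T(1) T(3) case_prod_unfold continuous_map_in_subtopology)
    show "continuous_map (btotal ?Q) W (bproj ?Q)" using fstc by (simp add: T(2))
  qed (auto simp: T act_0 act_act proj_act)
  interpret Q: pre_principal_bundle W ?Q by unfold_locales (rule pre)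
  show ?thesis
  proof (rule Q.G_bundleI)
    fix w assume w: "w \<in> topspace W"
    obtain U \<sigma> \<gamma> where U: "f w \<in> U" and c: "chart X P U \<sigma> \<gamma>"
      using chart_exists [OF continuous_map_in_topspace [OF f w]] .
    let ?V = "{w \<in> topspace W. f w \<in> U}"
    have "chart W ?Q ?V (\<lambda>w. (w, \<sigma> (f w))) (\<lambda>z. \<gamma> (snd z))"
      unfolding chart_def
    proof (intro conjI)
      show "openin W ?V" using c f by (simp add: chart_def continuous_map_openin_preimage)
      have "continuous_map (subtopology W ?V) (btotal P) (\<lambda>w. \<sigma> (f w))"
        by (rule continuous_map_compose_subtopology [OF continuous_map_from_subtopology [OF f]
              _ chart_continuous(1) [OF c]]) simp
      then have "continuous_map (subtopology W ?V) (prod_topology W (btotal P)) (\<lambda>w. (w, \<sigma> (f w)))"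
        by (auto intro: continuous_map_pairedI continuous_map_from_subtopology)
      then show "continuous_map (subtopology W ?V) (btotal ?Q) (\<lambda>w. (w, \<sigma> (f w)))"
        by (auto simp: T(1) continuous_map_in_subtopology chart_section_in [OF c])
      show "continuous_map (subtopology (btotal ?Q) (bproj ?Q -` ?V)) euclidean (\<lambda>z. \<gamma> (snd z))"
        by (rule continuous_map_compose_subtopology [OF continuous_map_from_subtopology [OF sndc]
              _ chart_continuous(2) [OF c]]) (auto simp: T)
      show "\<forall>z\<in>topspace (btotal ?Q). bproj ?Q z \<in> ?V \<longrightarrow>
          bact ?Q (bproj ?Q z, \<sigma> (f (bproj ?Q z))) (\<gamma> (snd z)) = z"
        by (auto simp: T chart_decompose [OF c])
      show "\<forall>x\<in>?V. \<forall>h. \<gamma> (snd (bact ?Q (x, \<sigma> (f x)) h)) = h"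
        by (simp add: T chart_coordinate [OF c])
    qed (auto simp: T)
    moreover have "w \<in> ?V" using w U by simp
    ultimately show "\<exists>V \<sigma> \<gamma>. w \<in> V \<and> chart W ?Q V \<sigma> \<gamma>" by (intro exI conjI)
  qed
qed

end

text \<open>A bundle map is bijective on fibres because both actions are free and transitive. The
  inverse is continuous since over a chart of \<open>P\<close> it sends (x, q) to the translate of
  \<open>\<sigma> x\<close> by the quotient of q by \<open>\<phi> (\<sigma> x)\<close>. This turns
  equivariant maps into equivalences with pullbacks.\<close>

lemma bundle_equivalent_pullbackI:
  fixes P :: "('p, 'x, 'g::topological_group_add) gbundle" and Q :: "('q, 'y, 'g) gbundle"
  assumes P: "G_bundle X P" and Q: "G_bundle Y Q" and f: "continuous_map X Y f"
    and \<phi>: "continuous_map (btotal P) (btotal Q) \<phi>"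
    and eqv: "\<And>p g. p \<in> topspace (btotal P) \<Longrightarrow> \<phi> (bact P p g) = bact Q (\<phi> p) g"
    and cov: "\<And>p. p \<in> topspace (btotal P) \<Longrightarrow> bproj Q (\<phi> p) = f (bproj P p)"
  shows "bundle_equivalent P (pullback X f Q)"
proof -
  interpret P: principal_bundle X P by unfold_locales (rule P)
  interpret Q: principal_bundle Y Q by unfold_locales (rule Q)
  let ?R = "pullback X f Q"
  let ?S = "{(w, q). f w = bproj Q q}"
  have T: "btotal ?R = subtopology (prod_topology X (btotal Q)) ?S" "bproj ?R = fst"
    "\<And>z g. bact ?R z g = (fst z, bact Q (snd z) g)"
    by (auto simp: pullback_def case_prod_unfold)
  let ?k = "\<lambda>p. (bproj P p, \<phi> p)"
  note \<phi>in = continuous_map_in_topspace [OF \<phi>]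
  have k: "continuous_map (btotal P) (btotal ?R) ?k"
    using cov by (auto simp: T(1) continuous_map_in_subtopology intro!: continuous_map_pairedI P.continuous_proj \<phi>)
  have inj: "inj_on ?k (topspace (btotal P))"
  proof (rule inj_onI)
    fix p q assume pq: "p \<in> topspace (btotal P)" "q \<in> topspace (btotal P)" "?k p = ?k q"
    have "bact Q (\<phi> p) (bdiv P p q) = \<phi> q" using pq eqv [of p "bdiv P p q"] by (simp add: P.act_bdiv)
    then have "bdiv Q (\<phi> p) (\<phi> q) = bdiv P p q" by (rule Q.bdiv_unique [OF \<phi>in [OF pq(1)]])
    moreover have "bdiv Q (\<phi> p) (\<phi> q) = 0" using pq Q.bdiv_self \<phi>in by auto
    ultimately show "p = q" using P.act_bdiv [of p q] P.act_0 [of p] pq by auto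
  qed
  \<comment> \<open>The explicit preimage of a point of the pullback; it yields surjectivity and,
    with \<open>p\<close> running through a local section, the continuity of the inverse.\<close>
  have kl: "?k (bact P p (bdiv Q (\<phi> p) q)) = (bproj P p, q)"
    if "p \<in> topspace (btotal P)" "q \<in> topspace (btotal Q)" "f (bproj P p) = bproj Q q" for p q
    using that by (simp add: P.proj_act eqv Q.act_bdiv \<phi>in cov)
  have surj: "?k ` topspace (btotal P) = topspace (btotal ?R)"
  proof
    show "?k ` topspace (btotal P) \<subseteq> topspace (btotal ?R)"
      using continuous_map_in_topspace [OF k] by auto
    show "topspace (btotal ?R) \<subseteq> ?k ` topspace (btotal P)"
    proof
      fix z assume "z \<in> topspace (btotal ?R)"
      then obtain x q where z: "z = (x, q)" "x \<in> topspace X" "q \<in> topspace (btotal Q)" "f x = bproj Q q"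
        by (auto simp: T)
      obtain U \<sigma> \<gamma> where "x \<in> U" "chart X P U \<sigma> \<gamma>" using P.chart_exists [OF z(2)] .
      then have "\<sigma> x \<in> topspace (btotal P)" "bproj P (\<sigma> x) = x" using P.chart_section_in by auto
      then have "z = ?k (bact P (\<sigma> x) (bdiv Q (\<phi> (\<sigma> x)) q))" using kl z by auto
      then show "z \<in> ?k ` topspace (btotal P)"
        using P.act_in [OF \<open>\<sigma> x \<in> topspace (btotal P)\<close>] by (rule image_eqI)
    qed
  qed
  let ?l = "inv_into (topspace (btotal P)) ?k"
  have l: "continuous_map (btotal ?R) (btotal P) ?l"
  proof (rule continuous_map_locally)
    fix z assume "z \<in> topspace (btotal ?R)"
    then have z: "fst z \<in> topspace X" by (auto simp: T)
    obtain U \<sigma> \<gamma> where U: "fst z \<in> U" and c: "chart X P U \<sigma> \<gamma>" using P.chart_exists [OF z] .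
    have fstc: "continuous_map (btotal ?R) X fst" and sndc: "continuous_map (btotal ?R) (btotal Q) snd"
      unfolding T by (auto intro: continuous_map_from_subtopology continuous_intros)
    let ?V = "{z \<in> topspace (btotal ?R). fst z \<in> U}"
    have V: "openin (btotal ?R) ?V"
      using c by (intro continuous_map_openin_preimage [OF fstc]) (simp add: chart_def)
    have \<sigma>: "continuous_map (subtopology (btotal ?R) ?V) (btotal P) (\<lambda>z. \<sigma> (fst z))"
      by (rule continuous_map_compose_subtopology [OF continuous_map_from_subtopology [OF fstc]
            _ chart_continuous(1) [OF c]]) simp
    have "continuous_map (subtopology (btotal ?R) ?V) (btotal P)
        (\<lambda>z. bact P (\<sigma> (fst z)) (bdiv Q (\<phi> (\<sigma> (fst z))) (snd z)))"
      by (rule P.continuous_act [OF \<sigma> Q.continuous_bdiv [OF continuous_map_compose' [OF \<sigma> \<phi>]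
              continuous_map_from_subtopology [OF sndc]]])
        (auto simp: T cov P.chart_section_in [OF c])
    then have "continuous_map (subtopology (btotal ?R) ?V) (btotal P) ?l"
    proof (rule continuous_map_eq)
      fix w assume w: "w \<in> topspace (subtopology (btotal ?R) ?V)"
      let ?p = "\<sigma> (fst w)"
      have p: "?p \<in> topspace (btotal P)" "bproj P ?p = fst w"
        using w P.chart_section_in [OF c] by auto
      then have "?k (bact P ?p (bdiv Q (\<phi> ?p) (snd w))) = w"
        using w by (subst kl) (auto simp: T)
      then show "bact P ?p (bdiv Q (\<phi> ?p) (snd w)) = ?l w"
        using inv_into_f_f [OF inj P.act_in [OF p(1)], of "bdiv Q (\<phi> ?p) (snd w)"] by simp
    qed
    then show "\<exists>V. openin (btotal ?R) V \<and> z \<in> V \<and> continuous_map (subtopology (btotal ?R) V) (btotal P) ?l"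
      using V U \<open>z \<in> topspace (btotal ?R)\<close> by (intro exI [of _ ?V]) auto
  qed
  have "homeomorphic_maps (btotal P) (btotal ?R) ?k ?l"
    unfolding homeomorphic_maps_def
  proof (intro conjI ballI)
    show "?l (?k p) = p" if "p \<in> topspace (btotal P)" for p
      using inv_into_f_f [OF inj that] .
    show "?k (?l z) = z" if "z \<in> topspace (btotal ?R)" for z
      using f_inv_into_f [of z ?k "topspace (btotal P)"] that surj by blast
  qed (fact k l)+
  then have "homeomorphic_map (btotal P) (btotal ?R) ?k" by (rule homeomorphic_maps_imp_map)
  then show ?thesis unfolding bundle_equivalent_def equivariant_on_def
    by (intro exI [of _ ?k]) (auto simp: T P.proj_act eqv)
qed

section \<open>The universal bundle\<close>

lemma subtopology_Collect: "subtopology Z {z. Q z} = subtopology Z {z \<in> topspace Z. Q z}"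
  by (metis Collect_conj_eq Collect_mem_eq subtopology_restrict)

lemma milnor_points_normal: "e \<in> milnor_points \<Longrightarrow> fst (e i) = 0 \<Longrightarrow> snd (e i) = 0"
  and milnor_points_nonneg: "e \<in> milnor_points \<Longrightarrow> 0 \<le> fst (e i)"
  by (auto simp: milnor_points_def)

lemma milnor_pointsI:
  assumes nonneg: "\<And>i. 0 \<le> fst (e i)" and N: "\<And>i. N \<le> i \<Longrightarrow> fst (e i) = 0"
    and sum: "(\<Sum>i<N. fst (e i)) = 1" and normal: "\<And>i. fst (e i) = 0 \<Longrightarrow> snd (e i) = 0"
  shows "e \<in> milnor_points"
proof -
  have sub: "{i. fst (e i) \<noteq> 0} \<subseteq> {..<N}" 
  proof
    fix i assume "i \<in> {i. fst (e i) \<noteq> 0}"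
    then show "i \<in> {..<N}" using N [of i] by (cases "N \<le> i") auto
  qed
  have "(\<Sum>i\<in>{i. fst (e i) \<noteq> 0}. fst (e i)) = (\<Sum>i<N. fst (e i))"
    by (rule sum.mono_neutral_left [OF _ sub]) auto
  moreover have "fst (e i) \<le> 1" for i
  proof (cases "i < N")
    case True
    then have "fst (e i) \<le> (\<Sum>i<N. fst (e i))" using nonneg by (intro member_le_sum) auto
    then show ?thesis using sum by simp
  next
    case False
    then show ?thesis using N [of i] by simp
  qed
  ultimately show ?thesis using finite_subset [OF sub] assms by (simp add: milnor_points_def)
qed

text \<open>The support is replaced by a bound that may be enlarged at will, so that two points can
  share one.\<close>

lemma milnor_points_bound:
  assumes "e \<in> milnor_points"
  obtains N where "\<And>i. N \<le> i \<Longrightarrow> fst (e i) = 0" "\<And>M. N \<le> M \<Longrightarrow> (\<Sum>i<M. fst (e i)) = 1"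
proof -
  have fin: "finite {i. fst (e i) \<noteq> 0}" and sum: "(\<Sum>i\<in>{i. fst (e i) \<noteq> 0}. fst (e i)) = 1"
    using assms by (auto simp: milnor_points_def)
  obtain N where "\<forall>i\<in>{i. fst (e i) \<noteq> 0}. i < N"
    using fin unfolding finite_nat_set_iff_bounded ..
  then have N: "i < N" if "i \<in> {i. fst (e i) \<noteq> 0}" for i using that by blast
  have "fst (e i) = 0" if "N \<le> i" for i using N [of i] that by auto
  moreover have "(\<Sum>i<M. fst (e i)) = 1" if "N \<le> M" for M
  proof -
    have "(\<Sum>i\<in>{i. fst (e i) \<noteq> 0}. fst (e i)) = (\<Sum>i<M. fst (e i))"
    proof (rule sum.mono_neutral_left)
      show "{i. fst (e i) \<noteq> 0} \<subseteq> {..<M}"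
      proof
        fix i assume "i \<in> {i. fst (e i) \<noteq> 0}"
        then show "i \<in> {..<M}" using N [of i] \<open>N \<le> M\<close> by simp
      qed
    qed auto
    then show ?thesis using sum by simp
  qed
  ultimately show thesis by (rule that)
qed

text \<open>The weights of \<open>u z\<close> need not add up to 1, so that parts of a formal sum can be treated separately.\<close>

definition coordinatewise_continuous ::
  "'z topology \<Rightarrow> ('z \<Rightarrow> 'g::topological_group_add formal_sum) \<Rightarrow> bool" where
  "coordinatewise_continuous Z u \<longleftrightarrow>
     (\<forall>i. continuous_map Z euclideanreal (\<lambda>z. fst (u z i)) \<and>
          continuous_map (subtopology Z {z. 0 < fst (u z i)}) euclidean (\<lambda>z. snd (u z i)) \<and>
          (\<forall>z\<in>topspace Z. 0 \<le> fst (u z i)))"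

text \<open>The universal property of the coarsest topology. A preimage of a generator of the second
  kind is open in the set where the weight is positive, and this set is itself open.\<close>

lemma continuous_map_milnor_E_iff:
  fixes u :: "'z \<Rightarrow> 'g::topological_group_add formal_sum"
  shows "continuous_map Z milnor_E u \<longleftrightarrow>
     coordinatewise_continuous Z u \<and> u \<in> topspace Z \<rightarrow> milnor_points"
proof
  assume u: "continuous_map Z milnor_E u"
  note mem = continuous_map_in_topspace [OF u, unfolded topspace_milnor_E]
  have "continuous_map Z euclideanreal (\<lambda>z. fst (u z i))" for i
    using continuous_map_compose' [OF u continuous_map_milnor_E_fst [of i]]
    by (simp add: continuous_map_in_subtopology)
  moreover have "continuous_map (subtopology Z {z. 0 < fst (u z i)}) euclidean (\<lambda>z. snd (u z i))" for i
    by (rule continuous_map_compose_subtopology [OF continuous_map_from_subtopology [OF u]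
          _ continuous_map_milnor_E_snd [of i]]) simp
  ultimately show "coordinatewise_continuous Z u \<and> u \<in> topspace Z \<rightarrow> milnor_points"
    using mem by (auto simp: coordinatewise_continuous_def milnor_points_nonneg)
next
  assume u: "coordinatewise_continuous Z u \<and> u \<in> topspace Z \<rightarrow> milnor_points"
  then have mem: "z \<in> topspace Z \<Longrightarrow> u z \<in> milnor_points" for z by auto
  have pos: "openin Z {z \<in> topspace Z. 0 < fst (u z i)}" for i
    using continuous_map_openin_preimage [of Z euclideanreal "\<lambda>z. fst (u z i)" "{0<..}"] u
    by (simp add: coordinatewise_continuous_def)
  show "continuous_map Z milnor_E u"
    unfolding milnor_E_def
  proof (rule continuous_on_generated_topo)
    fix W :: "'g formal_sum set" assume "W \<in> {{e \<in> milnor_points. fst (e i) \<in> U} | i U. open U} \<union>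
      {{e \<in> milnor_points. 0 < fst (e i) \<and> snd (e i) \<in> V} | i V. open V}"
    then consider i U where "open U" "W = {e \<in> milnor_points. fst (e i) \<in> U}"
      | i V where "open V" "W = {e \<in> milnor_points. 0 < fst (e i) \<and> snd (e i) \<in> V}"
      by blast
    then show "openin Z (u -` W \<inter> topspace Z)"
    proof cases
      case 1
      have "openin Z {z \<in> topspace Z. fst (u z i) \<in> U}"
        using continuous_map_openin_preimage [of Z euclideanreal "\<lambda>z. fst (u z i)" U] u 1
        by (simp add: coordinatewise_continuous_def)
      moreover have "u -` W \<inter> topspace Z = {z \<in> topspace Z. fst (u z i) \<in> U}"
        using 1 mem by auto
      ultimately show ?thesis by simp
    next
      case 2
      let ?A = "{z \<in> topspace Z. 0 < fst (u z i)}"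
      have "continuous_map (subtopology Z {z. 0 < fst (u z i)}) euclidean (\<lambda>z. snd (u z i))"
        using u by (simp add: coordinatewise_continuous_def)
      then have "continuous_map (subtopology Z ?A) euclidean (\<lambda>z. snd (u z i))"
        by (rule continuous_map_from_subtopology_mono) auto
      then have "openin (subtopology Z ?A) {z \<in> topspace (subtopology Z ?A). snd (u z i) \<in> V}"
        by (rule continuous_map_openin_preimage) (use 2 in simp)
      then have "openin Z {z \<in> topspace (subtopology Z ?A). snd (u z i) \<in> V}"
        using pos openin_open_subtopology by blast
      moreover have "u -` W \<inter> topspace Z = {z \<in> topspace (subtopology Z ?A). snd (u z i) \<in> V}"
        using 2 mem by auto
      ultimately show ?thesis by simp
    qed
  next
    have "milnor_points \<subseteq> topspace (milnor_E :: 'g formal_sum topology)" by (simp add: topspace_milnor_E)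
    then show "u ` topspace Z \<subseteq> \<Union> ({{e \<in> milnor_points. fst (e i) \<in> U} | i U. open U} \<union>
      {{e \<in> milnor_points. 0 < fst (e i) \<and> snd (e i) \<in> V} | i V. open V})"
      unfolding milnor_E_def topology_generated_by_topspace using mem by blast
  qed
qed

section \<open>The action on the join, its orbit space and local triviality\<close>

lemma fst_milnor_act [simp]: "fst (milnor_act e g i) = fst (e i)"
  by (simp add: milnor_act_def)

lemma milnor_act_in: "e \<in> milnor_points \<Longrightarrow> milnor_act e g \<in> milnor_points"
  by (simp add: milnor_points_def) (simp add: milnor_act_def)

lemma milnor_act_0: "e \<in> milnor_points \<Longrightarrow> milnor_act e 0 = e"
  by (auto simp: milnor_act_def fun_eq_iff prod_eq_iff milnor_points_normal)

lemma milnor_act_act: "milnor_act (milnor_act e g) h = milnor_act e (g + h)"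
  by (auto simp: milnor_act_def fun_eq_iff add.assoc)

lemma milnor_orbit_eq_iff:
  assumes "e \<in> milnor_points"
  shows "milnor_orbit e = milnor_orbit e' \<longleftrightarrow> (\<exists>g. e = milnor_act e' g)"
proof
  assume "milnor_orbit e = milnor_orbit e'"
  then show "\<exists>g. e = milnor_act e' g"
    using milnor_act_0 [OF assms] unfolding milnor_orbit_def by (metis rangeE rangeI)
next
  assume "\<exists>g. e = milnor_act e' g"
  then obtain g where g: "e = milnor_act e' g" by blast
  have 1: "milnor_act e' h = milnor_act e (- g + h)" for h
    by (simp add: g milnor_act_act flip: add.assoc)
  have 2: "milnor_act e h = milnor_act e' (g + h)" for h by (simp add: g milnor_act_act)
  show "milnor_orbit e = milnor_orbit e'"
    unfolding milnor_orbit_def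
  proof
    show "range (milnor_act e) \<subseteq> range (milnor_act e')" by (rule image_subsetI) (simp only: 2 rangeI)
    show "range (milnor_act e') \<subseteq> range (milnor_act e)" by (rule image_subsetI) (simp only: 1 rangeI)
  qed
qed

lemma milnor_orbit_act: "e \<in> milnor_points \<Longrightarrow> milnor_orbit (milnor_act e g) = milnor_orbit e"
  by (subst milnor_orbit_eq_iff) (auto simp: milnor_act_in)

lemma continuous_milnor_act:
  fixes g :: "'z \<Rightarrow> 'g::topological_group_add"
  assumes u: "continuous_map Z milnor_E u" and g: "continuous_map Z euclidean g"
  shows "continuous_map Z milnor_E (\<lambda>z. milnor_act (u z) (g z))"
proof -
  have "continuous_map (subtopology Z {z. 0 < fst (u z i)}) euclidean (\<lambda>z. snd (milnor_act (u z) (g z) i))"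
    for i
  proof (rule continuous_map_eq)
    show "continuous_map (subtopology Z {z. 0 < fst (u z i)}) euclidean (\<lambda>z. snd (u z i) + g z)"
      using u unfolding continuous_map_milnor_E_iff coordinatewise_continuous_def
      by (intro continuous_map_group_add continuous_map_from_subtopology [OF g]) simp
  qed (auto simp: milnor_act_def)
  then show ?thesis
    using u by (auto simp: continuous_map_milnor_E_iff coordinatewise_continuous_def Pi_iff milnor_act_in)
qed

lemma topspace_milnor_B: "topspace milnor_B = milnor_orbit ` milnor_points"
  by (simp add: milnor_B_def topspace_quotient_topology topspace_milnor_E)

lemma quotient_map_milnor_orbit: "quotient_map milnor_E milnor_B milnor_orbit"
  unfolding milnor_B_def by (rule quotient_map_quotient_topology)

lemma continuous_milnor_orbit: "continuous_map milnor_E milnor_B milnor_orbit"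
  by (rule quotient_imp_continuous_map [OF quotient_map_milnor_orbit])

lemma milnor_bundle_simps [simp]:
  "btotal milnor_bundle = milnor_E" "bproj milnor_bundle = milnor_orbit"
  "bact milnor_bundle = milnor_act"
  by (simp_all add: milnor_bundle_def)

text \<open>Over the orbits with positive i-th weight the section picks the representative whose
  i-th group element is the unit, and the coordinate of a point is its i-th group element. The
  normalised point does not depend on the representative: translating by g turns the i-th element h
  into h + g, and g + - (h + g) = - h. Continuity of the section is checked upstairs, as the orbit
  map restricted to a saturated open set is still a quotient map.\<close>

theorem G_bundle_milnor:
  "G_bundle milnor_B (milnor_bundle :: ('g::topological_group_add formal_sum, _, 'g) gbundle)"
proof -
  let ?M = "milnor_bundle :: ('g formal_sum, _, 'g) gbundle"
  have "pre_bundle milnor_B ?M"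
    unfolding pre_bundle_def
  proof (intro conjI ballI allI)
    show "continuous_map (prod_topology (btotal ?M) euclidean) (btotal ?M) (\<lambda>(p, g). bact ?M p g)"
      unfolding case_prod_unfold
      by (simp add: continuous_milnor_act continuous_map_fst continuous_map_snd)
  qed (auto simp: topspace_milnor_E milnor_act_0 milnor_act_act milnor_orbit_act continuous_milnor_orbit)
  then interpret pre_principal_bundle milnor_B ?M by unfold_locales
  show ?thesis
  proof (rule G_bundleI)
    fix b :: "'g formal_sum set" assume "b \<in> topspace milnor_B"
    then obtain e where e: "e \<in> milnor_points" "b = milnor_orbit e" by (auto simp: topspace_milnor_B)
    have "\<exists>i. fst (e i) \<noteq> 0"
    proof (rule ccontr)
      assume "\<nexists>i. fst (e i) \<noteq> 0"
      then show False using e by (simp add: milnor_points_def)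
    qed
    then obtain i where i: "0 < fst (e i)"
      using milnor_points_nonneg [OF e(1)] by (metis less_eq_real_def)
    \<comment> \<open>The conjunct with \<open>UNIV\<close> gives \<open>A\<close> the form of a
      generator of \<open>milnor_E\<close>, which makes it open.\<close>
    define A where "A = {e \<in> milnor_points. 0 < fst (e i) \<and> snd (e i :: real \<times> 'g) \<in> UNIV}"
    define U where "U = milnor_orbit ` A"
    define \<sigma> where "\<sigma> b = (let e = SOME e. e \<in> A \<and> milnor_orbit e = b in milnor_act e (- snd (e i)))"
      for b :: "'g formal_sum set"
    have A: "openin milnor_E A" unfolding milnor_E_def A_def
      by (rule topology_generated_by_Basis) blast
    have actA: "milnor_act e g \<in> A" if "e \<in> A" for e g using that by (auto simp: A_def milnor_act_in)
    have preU: "{e \<in> topspace milnor_E. milnor_orbit e \<in> U} = A"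
    proof -
      have "e \<in> A" if "e \<in> milnor_points" "milnor_orbit e = milnor_orbit e'" "e' \<in> A" for e e'
        using that actA by (auto simp: milnor_orbit_eq_iff)
      then show ?thesis by (auto simp: U_def topspace_milnor_E) (auto simp: A_def)
    qed
    have U: "openin milnor_B U" unfolding milnor_B_def openin_quotient_topology preU
      using A by (auto simp: U_def A_def topspace_milnor_E)
    have \<sigma>: "\<sigma> (milnor_orbit e) = milnor_act e (- snd (e i))" if "e \<in> A" for e
    proof -
      define e' where "e' = (SOME e'. e' \<in> A \<and> milnor_orbit e' = milnor_orbit e)"
      have e': "e' \<in> A \<and> milnor_orbit e' = milnor_orbit e"
        unfolding e'_def by (rule someI [of _ e]) (use that in simp)
      then obtain g where "e' = milnor_act e g" using milnor_orbit_eq_iff [of e' e] by (auto simp: A_def)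
      moreover have "milnor_act e' (- snd (e' i)) = milnor_act e (- snd (e i))"
        if "e' = milnor_act e g" for g
      proof -
        have "snd (e' i) = snd (e i) + g" using \<open>e \<in> A\<close> that by (simp add: A_def milnor_act_def)
        moreover have "g + - (snd (e i) + g) = - snd (e i)" by (metis add_minus_cancel minus_add)
        ultimately show ?thesis by (simp only: that milnor_act_act)
      qed
      ultimately show ?thesis unfolding \<sigma>_def Let_def e'_def [symmetric] by blast
    qed
    have cg: "continuous_map (subtopology milnor_E A) euclidean (\<lambda>e. snd (e i))"
      by (rule continuous_map_from_subtopology_mono [OF continuous_map_milnor_E_snd [of i]])
        (auto simp: A_def)
    have "chart milnor_B ?M U \<sigma> (\<lambda>e. snd (e i))"
      unfolding chart_def
    proof (intro conjI ballI allI impI)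
      show "openin milnor_B U" by (rule U)
      have q: "quotient_map (subtopology milnor_E A) (subtopology milnor_B U) milnor_orbit"
        by (rule quotient_map_restriction [OF quotient_map_milnor_orbit preU]) (use U in simp)
      have "continuous_map (subtopology milnor_E A) milnor_E (\<lambda>e. milnor_act e (- snd (e i)))"
        by (intro continuous_milnor_act continuous_map_group_minus cg continuous_map_from_subtopology)
          simp
      then have "continuous_map (subtopology milnor_E A) milnor_E (\<sigma> \<circ> milnor_orbit)"
        by (rule continuous_map_eq) (simp add: \<sigma>)
      then show "continuous_map (subtopology milnor_B U) (btotal ?M) \<sigma>"
        using continuous_compose_quotient_map [OF q] by simp
      show "bproj ?M (\<sigma> x) = x" if "x \<in> U" for x
        using that by (auto simp: U_def \<sigma> milnor_orbit_act A_def)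
      show "continuous_map (subtopology (btotal ?M) (bproj ?M -` U)) euclidean (\<lambda>e. snd (e i))"
      proof -
        have "subtopology milnor_E (milnor_orbit -` U) = subtopology milnor_E A"
          using subtopology_Collect [of milnor_E "\<lambda>e. milnor_orbit e \<in> U"] by (simp add: preU vimage_def)
        then show ?thesis using cg by simp
      qed
      show "bact ?M (\<sigma> (bproj ?M p)) (snd (p i)) = p" if "p \<in> topspace (btotal ?M)" "bproj ?M p \<in> U" for p
      proof -
        have "p \<in> A" using that preU by auto
        then show ?thesis by (simp add: \<sigma> milnor_act_act milnor_act_0 A_def)
      qed
      show "snd (bact ?M (\<sigma> x) h i) = h" if "x \<in> U" for x h
        using that by (auto simp: U_def \<sigma>) (auto simp: milnor_act_def A_def)
    qed
    moreover have "b \<in> U" using e i by (auto simp: U_def A_def)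
    ultimately show "\<exists>U \<sigma> \<gamma>. b \<in> U \<and> chart milnor_B ?M U \<sigma> \<gamma>" by blast
  qed
qed

section \<open>A natural homotopy between two points of the infinite join\<close>

definition scale_coord :: "real \<Rightarrow> real \<times> 'g::topological_group_add \<Rightarrow> real \<times> 'g" where
  "scale_coord c p = (c * fst p, if c * fst p = 0 then 0 else snd p)"

text \<open>Meant for families with disjoint supports, where it is their formal sum and does not
  depend on the order of the arguments.\<close>

definition merge_coord :: "(nat \<Rightarrow> real \<times> 'g) \<Rightarrow> (nat \<Rightarrow> real \<times> 'g) \<Rightarrow> nat \<Rightarrow> real \<times> 'g" where
  "merge_coord u v i = (if fst (u i) = 0 then v i else u i)"

lemma fst_scale_coord [simp]: "fst (scale_coord c p) = c * fst p"
  by (simp add: scale_coord_def)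

lemma fst_merge_coord: "fst (u i) = 0 \<or> fst (v i) = 0 \<Longrightarrow> fst (merge_coord u v i) = fst (u i) + fst (v i)"
  by (auto simp: merge_coord_def)

text \<open>A product of nonnegative weights is positive only where both factors are, and there the
  group coordinate is continuous. The index map \<open>s\<close> is arbitrary, which permits
  spreading a formal sum over the even or the odd positions.\<close>

lemma coordinatewise_continuous_scale:
  assumes u: "continuous_map Z milnor_E u"
    and c: "\<And>i. continuous_map Z euclideanreal (c i)" "\<And>i z. z \<in> topspace Z \<Longrightarrow> 0 \<le> c i z"
  shows "coordinatewise_continuous Z (\<lambda>z i. scale_coord (c i z) (u z (s i)))"
  unfolding coordinatewise_continuous_def
proof (intro allI conjI ballI)
  fix i
  have u': "coordinatewise_continuous Z u" using u by (simp add: continuous_map_milnor_E_iff)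
  then show "continuous_map Z euclideanreal (\<lambda>z. fst (scale_coord (c i z) (u z (s i))))"
    by (simp add: coordinatewise_continuous_def continuous_map_real_mult c)
  show "0 \<le> fst (scale_coord (c i z) (u z (s i)))" if "z \<in> topspace Z" for z
    using that u' c by (simp add: coordinatewise_continuous_def)
  have "continuous_map (subtopology Z {z. 0 < fst (u z (s i))}) euclidean (\<lambda>z. snd (u z (s i)))"
    using u' by (simp add: coordinatewise_continuous_def)
  then have "continuous_map (subtopology Z {z \<in> topspace Z. 0 < c i z * fst (u z (s i))}) euclidean
      (\<lambda>z. snd (u z (s i)))"
    by (rule continuous_map_from_subtopology_mono)
      (use c(2) in \<open>auto simp: zero_less_mult_iff dest: leD\<close>)
  then have "continuous_map (subtopology Z {z. 0 < c i z * fst (u z (s i))}) euclidean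
      (\<lambda>z. snd (u z (s i)))"
    unfolding subtopology_Collect [of Z "\<lambda>z. 0 < c i z * fst (u z (s i))"] .
  then show "continuous_map (subtopology Z {z. 0 < fst (scale_coord (c i z) (u z (s i)))}) euclidean
      (\<lambda>z. snd (scale_coord (c i z) (u z (s i))))"
    unfolding fst_scale_coord by (rule continuous_map_eq) (auto simp: scale_coord_def)
qed

text \<open>Where the merged weight is positive, exactly one of the two weights is. The two
  alternatives hold on disjoint open sets, and on each of them the merged group coordinate is that
  of one argument.\<close>

lemma coordinatewise_continuous_merge:
  assumes u: "coordinatewise_continuous Z u" and v: "coordinatewise_continuous Z v"
    and disj: "\<And>z i. z \<in> topspace Z \<Longrightarrow> fst (u z i) = 0 \<or> fst (v z i) = 0"
  shows "coordinatewise_continuous Z (\<lambda>z. merge_coord (u z) (v z))"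
  unfolding coordinatewise_continuous_def
proof (intro allI conjI ballI)
  fix i
  note uD = u [unfolded coordinatewise_continuous_def, rule_format, of i]
    and vD = v [unfolded coordinatewise_continuous_def, rule_format, of i]
  have "continuous_map Z euclideanreal (\<lambda>z. fst (u z i) + fst (v z i))"
    using uD vD by (intro continuous_map_add) auto
  then show "continuous_map Z euclideanreal (\<lambda>z. fst (merge_coord (u z) (v z) i))"
    by (rule continuous_map_eq) (simp add: fst_merge_coord disj)
  show "0 \<le> fst (merge_coord (u z) (v z) i)" if "z \<in> topspace Z" for z
    using that uD vD by (simp add: merge_coord_def)
  let ?S = "subtopology Z {z. 0 < fst (merge_coord (u z) (v z) i)}"
  show "continuous_map ?S euclidean (\<lambda>z. snd (merge_coord (u z) (v z) i))"
  proof (rule continuous_map_locally)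
    fix z assume z: "z \<in> topspace ?S"
    have *: "\<exists>U. openin ?S U \<and> z \<in> U \<and>
        continuous_map (subtopology ?S U) euclidean (\<lambda>z. snd (merge_coord (u z) (v z) i))"
      if w: "coordinatewise_continuous Z w" and zw: "0 < fst (w z i)"
        and eq: "\<And>y. y \<in> topspace Z \<Longrightarrow> 0 < fst (w y i) \<Longrightarrow> merge_coord (u y) (v y) i = w y i" for w
    proof -
      note wD = w [unfolded coordinatewise_continuous_def, rule_format, of i]
      let ?U = "{y \<in> topspace Z. fst (w y i) \<in> {0<..}}"
      have "openin Z ?U" using wD by (intro continuous_map_openin_preimage) auto
      then have "openin ?S ({y. 0 < fst (merge_coord (u y) (v y) i)} \<inter> ?U)"
        by (rule openin_subtopology_Int2)
      moreover have "{y. 0 < fst (merge_coord (u y) (v y) i)} \<inter> ?U = ?U" using eq by auto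
      moreover have "continuous_map (subtopology ?S ?U) euclidean (\<lambda>z. snd (merge_coord (u z) (v z) i))"
      proof (rule continuous_map_eq)
        show "continuous_map (subtopology ?S ?U) euclidean (\<lambda>z. snd (w z i))"
          unfolding subtopology_subtopology
          by (rule continuous_map_from_subtopology_mono [of Z "{z. 0 < fst (w z i)}"]) (use wD in auto)
      qed (use eq in auto)
      ultimately show ?thesis using z zw by (intro exI [of _ ?U]) auto
    qed
    consider "0 < fst (u z i)" | "0 < fst (v z i)"
      using z disj [of z i] by (auto simp: merge_coord_def split: if_splits)
    then show "\<exists>U. openin ?S U \<and> z \<in> U \<and>
        continuous_map (subtopology ?S U) euclidean (\<lambda>z. snd (merge_coord (u z) (v z) i))"
    proof cases
      case 1
      then show ?thesis by (intro * [OF u]) (auto simp: merge_coord_def)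
    next
      case 2
      have "merge_coord (u y) (v y) i = v y i" if "y \<in> topspace Z" "0 < fst (v y i)" for y
        using disj [OF that(1), of i] that(2) by (auto simp: merge_coord_def)
      then show ?thesis using 2 by (intro * [OF v])
    qed
  qed
qed

text \<open>The weight with which the coordinate \<open>i\<close> has moved at time \<open>s\<close>; later coordinates move first,
  so that their target positions are always vacant.\<close>

definition ramp :: "nat \<Rightarrow> real \<Rightarrow> real" where
  "ramp i s = max 0 (min 1 (s * ((real i + 1) * (real i + 2)) - (real i + 1)))"

lemma ramp_bounds: "0 \<le> ramp i s" "ramp i s \<le> 1"
  by (auto simp: ramp_def)

lemma ramp_0: "s \<le> 0 \<Longrightarrow> ramp i s = 0"
proof -
  assume "s \<le> 0"
  then have "s * ((real i + 1) * (real i + 2)) \<le> 0" by (intro mult_nonpos_nonneg) auto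
  then show ?thesis by (simp add: ramp_def)
qed

lemma ramp_1: "1 / (real i + 1) \<le> s \<Longrightarrow> ramp i s = 1"
proof -
  assume "1 / (real i + 1) \<le> s"
  then have "1 \<le> s * (real i + 1)" by (simp add: field_simps)
  then have "1 * (real i + 2) \<le> s * (real i + 1) * (real i + 2)" by (intro mult_right_mono) auto
  then have "1 \<le> s * ((real i + 1) * (real i + 2)) - (real i + 1)" by (simp add: algebra_simps)
  then show ?thesis by (simp add: ramp_def)
qed

lemma ramp_1': "1 \<le> s \<Longrightarrow> ramp i s = 1"
  by (rule ramp_1) (auto intro: order_trans [of _ 1])

text \<open>Coordinate \<open>i\<close> moves while \<open>s\<close> runs from 1/(i + 2) to 1/(i +
  1). These intervals are stacked towards 0, so all later coordinates have arrived before
  \<open>i\<close> starts.\<close>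

lemma ramp_separation:
  assumes "0 < ramp i s" and "i < j"
  shows "ramp j s = 1"
proof (rule ramp_1)
  have "(real i + 1) * 1 < (real i + 1) * (s * (real i + 2))"
    using assms(1) by (simp add: ramp_def algebra_simps split: if_splits)
  then have "1 < s * (real i + 2)" by (subst (asm) mult_less_cancel_left_pos) auto
  then have "1 / (real i + 2) \<le> s" by (simp add: field_simps)
  moreover have "1 / (real j + 1) \<le> 1 / (real i + 2)" using assms(2) by (intro divide_left_mono) auto
  ultimately show "1 / (real j + 1) \<le> s" by linarith
qed

lemma continuous_map_ramp:
  "continuous_map Z euclideanreal f \<Longrightarrow> continuous_map Z euclideanreal (\<lambda>z. ramp i (f z))"
  unfolding ramp_def
  by (intro continuous_map_real_max continuous_map_real_min continuous_map_diff continuous_map_real_mult)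
    auto

text \<open>Time is cut into thirds, whence the factors 3: in the first third \<open>a\<close> is
  spread out, in the second the weight passes from \<open>a\<close> to \<open>b\<close>, and in the
  third \<open>b\<close> is collected by the spreading motion run backwards, with 1 - s for
  s.\<close>

definition mix :: "real \<Rightarrow> real" where "mix s = max 0 (min 1 (3 * s - 1))"

definition stay_weight :: "real \<Rightarrow> nat \<Rightarrow> real" where
  "stay_weight s i = 1 - ramp i (3 * s)"

text \<open>Coordinate j goes to 2 j + 2 rather than 2 j, so that the target lies strictly beyond
  the source even for j = 0; by \<open>ramp_separation\<close> it has been vacated when j starts to
  move. The bound 2 excludes position 0, where the truncated subtraction would produce another copy
  of coordinate 0.\<close>

definition even_weight :: "real \<Rightarrow> nat \<Rightarrow> real" where
  "even_weight s i = (if even i \<and> 2 \<le> i then ramp (i div 2 - 1) (3 * s) * (1 - mix s) else 0)"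

definition odd_weight :: "real \<Rightarrow> nat \<Rightarrow> real" where
  "odd_weight s i = (if odd i then ramp (i div 2) (3 * (1 - s)) * mix s else 0)"

text \<open>
  A homotopy from \<open>a\<close> to \<open>b\<close>: first \<open>a\<close> is moved from the positions \<open>i\<close> to \<open>2 * i + 2\<close>, then its
  weight is transferred linearly to the copy of \<open>b\<close> at the positions \<open>2 * i + 1\<close>, which is finally
  moved to the positions \<open>i\<close>.
\<close>

definition milnor_join ::
  "'g::topological_group_add formal_sum \<Rightarrow> 'g formal_sum \<Rightarrow> real \<Rightarrow> 'g formal_sum" where
  "milnor_join a b s =
     merge_coord (\<lambda>i. scale_coord (stay_weight s i) (a i))
      (merge_coord (\<lambda>i. scale_coord (even_weight s i) (a (i div 2 - 1)))
        (merge_coord (\<lambda>i. scale_coord (odd_weight s i) (b (i div 2)))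
          (\<lambda>i. scale_coord (stay_weight (1 - s) i) (b i))))"

lemma mix_bounds: "0 \<le> mix s" "mix s \<le> 1"
  by (auto simp: mix_def)

text \<open>The three phases: \<open>b\<close> is fully spread and has no weight, \<open>a\<close>
  is fully spread and has no weight, or both are fully spread.\<close>

lemma mix_cases:
  obtains "mix s = 0" "\<And>i. ramp i (3 * (1 - s)) = 1"
  | "mix s = 1" "\<And>i. ramp i (3 * s) = 1"
  | "\<And>i. ramp i (3 * s) = 1" "\<And>i. ramp i (3 * (1 - s)) = 1"
proof -
  consider "3 * s < 1" | "3 * (1 - s) < 1" | "1 \<le> 3 * s" "1 \<le> 3 * (1 - s)" by linarith
  then show thesis
  proof cases
    case 1 then show thesis by (intro that(1) ramp_1') (auto simp: mix_def)
  next
    case 2 then show thesis by (intro that(2) ramp_1') (auto simp: mix_def)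
  next
    case 3 then show thesis by (intro that(3) ramp_1')
  qed
qed

lemma ramp_zero_or_one: "i < j \<Longrightarrow> ramp i r = 0 \<or> ramp j r = 1"
  using ramp_separation [of i r j] ramp_bounds(1) [of i r] by linarith

text \<open>At any time a position carries at most one of the four copies, so two group elements
  never have to be combined. A formal sum and its own spread copy avoid each other by
  \<open>ramp_separation\<close>, the two spread copies by parity, and all other pairs by the phases
  of \<open>mix_cases\<close>.\<close>

lemma join_weights_disjoint:
  "stay_weight s i = 0 \<or> even_weight s i = 0"
  "stay_weight s i = 0 \<or> odd_weight s i = 0"
  "stay_weight s i = 0 \<or> stay_weight (1 - s) i = 0"
  "even_weight s i = 0 \<or> odd_weight s i = 0"
  "even_weight s i = 0 \<or> stay_weight (1 - s) i = 0"
  "odd_weight s i = 0 \<or> stay_weight (1 - s) i = 0"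
proof -
  show "stay_weight s i = 0 \<or> even_weight s i = 0"
    using ramp_zero_or_one [of "i div 2 - 1" i "3 * s"] by (auto simp: stay_weight_def even_weight_def)
  show "odd_weight s i = 0 \<or> stay_weight (1 - s) i = 0"
  proof (cases "odd i")
    case True
    then have "i div 2 < i" by (intro div_less_dividend) (auto intro: odd_pos)
    from ramp_zero_or_one [OF this, of "3 * (1 - s)"] show ?thesis
      by (auto simp: stay_weight_def odd_weight_def)
  qed (simp add: odd_weight_def)
  show "stay_weight s i = 0 \<or> odd_weight s i = 0"
    by (rule mix_cases [of s]) (simp_all add: stay_weight_def odd_weight_def)
  show "stay_weight s i = 0 \<or> stay_weight (1 - s) i = 0"
    by (rule mix_cases [of s]) (simp_all add: stay_weight_def)
  show "even_weight s i = 0 \<or> odd_weight s i = 0"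
    by (simp add: even_weight_def odd_weight_def)
  show "even_weight s i = 0 \<or> stay_weight (1 - s) i = 0"
    by (rule mix_cases [of s]) (simp_all add: stay_weight_def even_weight_def)
qed

lemma join_weights_nonneg: "0 \<le> stay_weight s i" "0 \<le> even_weight s i" "0 \<le> odd_weight s i"
  using ramp_bounds mix_bounds by (simp_all add: stay_weight_def even_weight_def odd_weight_def)

lemma fst_milnor_join:
  "fst (milnor_join a b s i) = stay_weight s i * fst (a i) + even_weight s i * fst (a (i div 2 - 1)) +
     odd_weight s i * fst (b (i div 2)) + stay_weight (1 - s) i * fst (b i)"
  using join_weights_disjoint [of s i] unfolding milnor_join_def
  by (auto simp: merge_coord_def)

lemma sum_even_positions:
  fixes f :: "nat \<Rightarrow> real"
  shows "(\<Sum>i<2 * M + 2. if even i \<and> 2 \<le> i then f (i div 2 - 1) else 0) = (\<Sum>j<M. f j)"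
proof (induction M)
  case (Suc M)
  have e: "2 * Suc M + 2 = Suc (Suc (2 * M + 2))" by simp
  show ?case unfolding e sum.lessThan_Suc Suc.IH by simp
qed (simp add: numeral_2_eq_2)

lemma sum_odd_positions:
  fixes f :: "nat \<Rightarrow> real"
  shows "(\<Sum>i<2 * M. if odd i then f (i div 2) else 0) = (\<Sum>j<M. f j)"
  by (induction M) simp_all

lemma milnor_join_in:
  assumes a: "a \<in> milnor_points" and b: "b \<in> milnor_points"
  shows "milnor_join a b s \<in> milnor_points"
proof -
  obtain Na where Na: "\<And>i. Na \<le> i \<Longrightarrow> fst (a i) = 0" "\<And>M. Na \<le> M \<Longrightarrow> (\<Sum>i<M. fst (a i)) = 1"
    using milnor_points_bound [OF a] by blast
  obtain Nb where Nb: "\<And>i. Nb \<le> i \<Longrightarrow> fst (b i) = 0" "\<And>M. Nb \<le> M \<Longrightarrow> (\<Sum>i<M. fst (b i)) = 1"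
    using milnor_points_bound [OF b] by blast
  define M where "M = Na + Nb"
  let ?N = "2 * M + 2"
  have cut: "(\<Sum>i<?N. f i * fst (a i)) = (\<Sum>i<M. f i * fst (a i))"
    "(\<Sum>i<?N. f i * fst (b i)) = (\<Sum>i<M. f i * fst (b i))"
 for f :: "nat \<Rightarrow> real"
    by (rule sum.mono_neutral_right; auto simp: M_def intro!: Na Nb)+
  show ?thesis
  proof (rule milnor_pointsI [of _ ?N])
    show "0 \<le> fst (milnor_join a b s i)" for i
      using a b by (simp add: fst_milnor_join join_weights_nonneg milnor_points_nonneg)
    show "fst (milnor_join a b s i) = 0" if "?N \<le> i" for i
    proof -
      have "Na \<le> i" "Na \<le> i div 2 - 1" "Nb \<le> i div 2" "Nb \<le> i" using that by (auto simp: M_def)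
      then show ?thesis by (simp add: fst_milnor_join Na Nb)
    qed
    show "snd (milnor_join a b s i) = 0" if "fst (milnor_join a b s i) = 0" for i
      using that by (auto simp: milnor_join_def merge_coord_def scale_coord_def split: if_splits)
    have 1: "(\<Sum>i<?N. even_weight s i * fst (a (i div 2 - 1)))
        = (\<Sum>i<M. ramp i (3 * s) * (1 - mix s) * fst (a i))"
      by (rule trans [OF sum.cong sum_even_positions]) (auto simp: even_weight_def)
    have "(\<Sum>i<?N. odd_weight s i * fst (b (i div 2)))
        = (\<Sum>i<2 * (M + 1). if odd i then ramp (i div 2) (3 * (1 - s)) * mix s * fst (b (i div 2)) else 0)"
      by (rule sum.cong) (auto simp: odd_weight_def)
    \<comment> \<open>The odd positions below 2 M + 2 hold M + 1 coordinates of \<open>b\<close>.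
      The last one has weight 0 by the choice of \<open>M\<close>.\<close>
    also have "\<dots> = (\<Sum>i<M. ramp i (3 * (1 - s)) * mix s * fst (b i))"
      using sum_odd_positions [of "\<lambda>i. ramp i (3 * (1 - s)) * mix s * fst (b i)" "M + 1"] Nb(1) [of M]
      by (simp add: M_def)
    finally have 2: "(\<Sum>i<?N. odd_weight s i * fst (b (i div 2)))
        = (\<Sum>i<M. ramp i (3 * (1 - s)) * mix s * fst (b i))" .
    \<comment> \<open>The old and the new position of a coordinate of \<open>a\<close> together
      always hold the share 1 - \<open>mix s\<close> of its weight; for \<open>b\<close> the share
      is \<open>mix s\<close>. The total thus stays 1.\<close>
    have A: "stay_weight s i + ramp i (3 * s) * (1 - mix s) = 1 - mix s" for i
      by (rule mix_cases [of s]) (simp_all add: stay_weight_def)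
    have B: "ramp i (3 * (1 - s)) * mix s + stay_weight (1 - s) i = mix s" for i
      by (rule mix_cases [of s]) (simp_all add: stay_weight_def)
    have "(\<Sum>i<?N. fst (milnor_join a b s i))
        = (\<Sum>i<M. (stay_weight s i + ramp i (3 * s) * (1 - mix s)) * fst (a i)) +
          (\<Sum>i<M. (ramp i (3 * (1 - s)) * mix s + stay_weight (1 - s) i) * fst (b i))"
      unfolding fst_milnor_join sum.distrib 1 2 cut distrib_right by simp
    also have "\<dots> = (1 - mix s) * (\<Sum>i<M. fst (a i)) + mix s * (\<Sum>i<M. fst (b i))"
      unfolding A B by (simp add: sum_distrib_left)
    finally show "(\<Sum>i<?N. fst (milnor_join a b s i)) = 1"
      by (simp add: M_def Na Nb)
  qed
qed

lemma milnor_join_0: "a \<in> milnor_points \<Longrightarrow> milnor_join a b 0 = a"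
  and milnor_join_1: "b \<in> milnor_points \<Longrightarrow> milnor_join a b 1 = b"
  by (auto simp: fun_eq_iff prod_eq_iff milnor_join_def merge_coord_def scale_coord_def stay_weight_def
      even_weight_def odd_weight_def ramp_0 ramp_1' mix_def milnor_points_normal)

lemma scale_coord_act:
  "(\<lambda>i. scale_coord (c i) (milnor_act e g (k i))) = milnor_act (\<lambda>i. scale_coord (c i) (e (k i))) g"
  by (auto simp: fun_eq_iff scale_coord_def milnor_act_def)

lemma merge_coord_act:
  "merge_coord (milnor_act u g) (milnor_act v g) = milnor_act (merge_coord u v) g"
  by (auto simp: fun_eq_iff merge_coord_def milnor_act_def)

text \<open>The coefficients depend on time and position only and merging merely selects a
  coordinate, so every ingredient commutes with the action. Hence the join of two equivariant maps
  is equivariant and descends to orbits.\<close>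

lemma milnor_join_act:
  "milnor_join (milnor_act a g) (milnor_act b g) s = milnor_act (milnor_join a b s) g"
  by (simp only: milnor_join_def scale_coord_act merge_coord_act)

text \<open>Infinitely many moves accumulate at the times 0 and 1. This is harmless because the
  topology tests one coordinate at a time, and the weight of each single position is continuous in
  time.\<close>

lemma continuous_milnor_join:
  assumes a: "continuous_map Z milnor_E a" and b: "continuous_map Z milnor_E b"
    and s: "continuous_map Z euclideanreal s"
  shows "continuous_map Z milnor_E (\<lambda>z. milnor_join (a z) (b z) (s z))"
proof -
  have r: "continuous_map Z euclideanreal (\<lambda>z. ramp i (3 * s z))"
    "continuous_map Z euclideanreal (\<lambda>z. ramp i (3 * (1 - s z)))" for i
    by (intro continuous_map_ramp continuous_map_real_mult continuous_map_diff s; simp)+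
  have m: "continuous_map Z euclideanreal (\<lambda>z. mix (s z))" unfolding mix_def
    by (intro continuous_map_real_max continuous_map_real_min continuous_map_diff
        continuous_map_real_mult s) auto
  have w: "continuous_map Z euclideanreal (\<lambda>z. stay_weight (s z) i)"
    "continuous_map Z euclideanreal (\<lambda>z. stay_weight (1 - s z) i)"
    "continuous_map Z euclideanreal (\<lambda>z. even_weight (s z) i)"
    "continuous_map Z euclideanreal (\<lambda>z. odd_weight (s z) i)" for i
    using r m by (auto simp: stay_weight_def even_weight_def odd_weight_def
        intro!: continuous_map_diff continuous_map_real_mult)
  let ?A = "\<lambda>z i. scale_coord (stay_weight (s z) i) (a z i)"
    and ?B = "\<lambda>z i. scale_coord (even_weight (s z) i) (a z (i div 2 - 1))"
    and ?C = "\<lambda>z i. scale_coord (odd_weight (s z) i) (b z (i div 2))"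
    and ?D = "\<lambda>z i. scale_coord (stay_weight (1 - s z) i) (b z i)"
  have D: "fst (?C z i) = 0 \<or> fst (?D z i) = 0"
    "fst (?B z i) = 0 \<or> fst (merge_coord (?C z) (?D z) i) = 0"
    "fst (?A z i) = 0 \<or> fst (merge_coord (?B z) (merge_coord (?C z) (?D z)) i) = 0" for z i
    using join_weights_disjoint [of "s z" i] by (auto simp: merge_coord_def)
  have "coordinatewise_continuous Z (\<lambda>z. milnor_join (a z) (b z) (s z))"
    unfolding milnor_join_def
    by (intro coordinatewise_continuous_merge coordinatewise_continuous_scale a b w join_weights_nonneg D)
  moreover have "(\<lambda>z. milnor_join (a z) (b z) (s z)) \<in> topspace Z \<rightarrow> milnor_points"
    using continuous_map_in_topspace [OF a] continuous_map_in_topspace [OF b]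
    by (auto simp: topspace_milnor_E intro: milnor_join_in)
  ultimately show ?thesis by (simp add: continuous_map_milnor_E_iff)
qed

section \<open>Homotopy lifting over compact metric spaces\<close>

lemma continuous_map_Un_closed:
  assumes "closedin Z A" and "closedin Z B" and "topspace Z \<subseteq> A \<union> B"
    and "continuous_map (subtopology Z A) Y f" and "continuous_map (subtopology Z B) Y f"
  shows "continuous_map Z Y f"
proof (rule pasting_lemma_closed [where I = "{A, B}" and T = id and f = "\<lambda>_. f"])
qed (use assms in auto)

lemma closedin_real_le:
  fixes f g :: "'a::topological_space \<Rightarrow> real"
  assumes "continuous_on S f" and "continuous_on S g"
  shows "closedin (top_of_set S) {x \<in> S. f x \<le> g x}"
proof -
  have "closedin (top_of_set S) (S \<inter> (\<lambda>x. g x - f x) -` {0..})"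
    using assms by (intro continuous_closedin_preimage continuous_intros) auto
  moreover have "S \<inter> (\<lambda>x. g x - f x) -` {0..} = {x \<in> S. f x \<le> g x}" by auto
  ultimately show ?thesis by simp
qed

context principal_bundle
begin

lemma lift_extension:
  assumes h: "continuous_map Z X h"
    and A: "closedin Z A" and B: "closedin Z B" and AB: "topspace Z \<subseteq> A \<union> B"
    and L: "continuous_map (subtopology Z A) (btotal P) L" "\<And>z. z \<in> A \<Longrightarrow> bproj P (L z) = h z"
    and c: "chart X P U \<sigma> \<gamma>" and U: "\<And>z. z \<in> B \<Longrightarrow> h z \<in> U"
    and r: "continuous_map (subtopology Z B) (subtopology Z (A \<inter> B)) r" "\<And>z. z \<in> A \<inter> B \<Longrightarrow> r z = z"
  obtains L' where "continuous_map Z (btotal P) L'"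
    "\<And>z. z \<in> topspace Z \<Longrightarrow> bproj P (L' z) = h z" "\<And>z. z \<in> A \<Longrightarrow> L' z = L z"
proof -
  define L' where "L' z = (if z \<in> A then L z else bact P (\<sigma> (h z)) (\<gamma> (L (r z))))" for z
  have AZ: "A \<subseteq> topspace Z" and BZ: "B \<subseteq> topspace Z" using A B closedin_subset by auto
  have Lin: "L z \<in> topspace (btotal P)" if "z \<in> A" for z
    using continuous_map_in_topspace [OF L(1), of z] that AZ by auto
  have rin: "r z \<in> A \<inter> B" if "z \<in> B" for z
    using continuous_map_in_topspace [OF r(1), of z] that BZ by auto
  have B': "L' z = bact P (\<sigma> (h z)) (\<gamma> (L (r z)))" if "z \<in> B" for z
  proof (cases "z \<in> A")
    case True
    then have "bact P (\<sigma> (bproj P (L z))) (\<gamma> (L z)) = L z"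
      using that U by (intro chart_decompose [OF c] Lin) (simp_all add: L)
    then show ?thesis using True that r(2) [of z] L(2) by (simp add: L'_def)
  qed (simp add: L'_def)
  have "continuous_map Z (btotal P) L'"
  proof (rule continuous_map_Un_closed [OF A B AB])
    show "continuous_map (subtopology Z A) (btotal P) L'"
      by (rule continuous_map_eq [OF L(1)]) (auto simp: L'_def)
    have s: "continuous_map (subtopology Z B) (btotal P) (\<lambda>z. \<sigma> (h z))"
      by (rule continuous_map_compose_subtopology [OF continuous_map_from_subtopology [OF h]
            _ chart_continuous(1) [OF c]]) (simp add: U)
    have r': "continuous_map (subtopology Z B) (subtopology Z A) r"
      using r(1) by (auto simp: continuous_map_in_subtopology)
    have "continuous_map (subtopology Z B) euclidean (\<lambda>z. \<gamma> (L (r z)))"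
      by (rule continuous_map_compose_subtopology [OF continuous_map_compose' [OF r' L(1)]
            _ chart_continuous(2) [OF c]]) (use rin L U in auto)
    then have "continuous_map (subtopology Z B) (btotal P) (\<lambda>z. bact P (\<sigma> (h z)) (\<gamma> (L (r z))))"
      by (intro continuous_act s)
    then show "continuous_map (subtopology Z B) (btotal P) L'"
      by (rule continuous_map_eq) (simp add: B')
  qed
  moreover have "bproj P (L' z) = h z" if "z \<in> topspace Z" for z
  proof (cases "z \<in> A")
    case False
    then have "z \<in> B" using AB that by auto
    then show ?thesis using chart_section_in [OF c U, of z] by (simp add: B' proj_act)
  qed (simp add: L'_def L)
  ultimately show thesis using that by (simp add: L'_def)
qed

text \<open>The lift is extended over the regions below the graphs of an increasing finite sequence of
  functions, such that between any two consecutive graphs \<open>h\<close> stays in a chart.\<close>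

definition lifts_below ::
  "('a::metric_space \<times> real \<Rightarrow> 'x) \<Rightarrow> ('a \<Rightarrow> 'p) \<Rightarrow> 'a set \<Rightarrow> ('a \<Rightarrow> real) \<Rightarrow> bool" where
  "lifts_below h L0 S f \<longleftrightarrow>
     (\<exists>L. continuous_map (top_of_set {z. fst z \<in> S \<and> 0 \<le> snd z \<and> snd z \<le> f (fst z)}) (btotal P) L \<and>
          (\<forall>x\<in>S. \<forall>s. 0 \<le> s \<and> s \<le> f x \<longrightarrow> bproj P (L (x, s)) = h (x, s)) \<and>
          (\<forall>x\<in>S. L (x, 0) = L0 x))"

lemma lifts_below_cong: "(\<And>x. x \<in> S \<Longrightarrow> f x = f' x) \<Longrightarrow> lifts_below h L0 S f = lifts_below h L0 S f'"
proof -
  assume "\<And>x. x \<in> S \<Longrightarrow> f x = f' x"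
  then have "{z. fst z \<in> S \<and> 0 \<le> snd z \<and> snd z \<le> f (fst z)}
      = {z. fst z \<in> S \<and> 0 \<le> snd z \<and> snd z \<le> f' (fst z)}" "\<And>x. x \<in> S \<Longrightarrow> f x = f' x"
    by auto
  then show ?thesis unfolding lifts_below_def by simp
qed

text \<open>What is gained between the two graphs lies over \<open>C\<close>, where a single chart
  suffices, and the vertical projection onto the lower graph is the retraction for
  \<open>lift_extension\<close>. A closed \<open>C\<close> makes the new piece closed, as pasting
  requires; the set where the two functions differ need not be closed.\<close>

lemma lifts_below_step:
  assumes h: "continuous_map (top_of_set (S \<times> {0..1})) X h"
    and f: "continuous_on S f" "\<And>x. x \<in> S \<Longrightarrow> 0 \<le> f x"
    and f': "continuous_on S f'" "\<And>x. x \<in> S \<Longrightarrow> f x \<le> f' x" "\<And>x. x \<in> S \<Longrightarrow> f' x \<le> 1"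
    and C: "closed C" "\<And>x. x \<in> S \<Longrightarrow> f x \<noteq> f' x \<Longrightarrow> x \<in> C"
    and c: "chart X P U \<sigma> \<gamma>"
    and U: "\<And>x s. x \<in> S \<inter> C \<Longrightarrow> f x \<le> s \<Longrightarrow> s \<le> f' x \<Longrightarrow> h (x, s) \<in> U"
    and L: "lifts_below h L0 S f"
  shows "lifts_below h L0 S f'"
proof -
  define R where "R f = {z. fst z \<in> S \<and> 0 \<le> snd z \<and> snd z \<le> f (fst z)}" for f :: "'a \<Rightarrow> real"
  obtain L where L: "continuous_map (top_of_set (R f)) (btotal P) L"
      "\<And>x s. x \<in> S \<Longrightarrow> 0 \<le> s \<Longrightarrow> s \<le> f x \<Longrightarrow> bproj P (L (x, s)) = h (x, s)"
      "\<And>x. x \<in> S \<Longrightarrow> L (x, 0) = L0 x"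
    using L unfolding lifts_below_def R_def by blast
  let ?Z = "top_of_set (R f')"
  let ?B = "{z \<in> R f'. fst z \<in> C \<and> f (fst z) \<le> snd z}"
  have RR: "R f \<subseteq> R f'" using f' by (force simp: R_def)
  have fc: "continuous_on (R f') (\<lambda>z. f (fst z))"
    by (rule continuous_on_compose2 [OF f(1) continuous_on_fst [OF continuous_on_id]]) (auto simp: R_def)
  have "closedin ?Z {z \<in> R f'. snd z \<le> f (fst z)}"
    by (rule closedin_real_le) (auto intro!: fc continuous_intros)
  moreover have "{z \<in> R f'. snd z \<le> f (fst z)} = R f" using RR by (auto simp: R_def)
  ultimately have A: "closedin ?Z (R f)" by simp
  have "closedin ?Z {z \<in> R f'. f (fst z) \<le> snd z}"
    by (rule closedin_real_le) (auto intro!: fc continuous_intros)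
  moreover have "closedin ?Z (R f' \<inter> (C \<times> UNIV))"
    by (rule closedin_closed_Int) (intro closed_Times C closed_UNIV)
  ultimately have "closedin ?Z ({z \<in> R f'. f (fst z) \<le> snd z} \<inter> (R f' \<inter> (C \<times> UNIV)))"
    by (rule closedin_Int)
  moreover have "{z \<in> R f'. f (fst z) \<le> snd z} \<inter> (R f' \<inter> (C \<times> UNIV)) = ?B" by auto
  ultimately have B: "closedin ?Z ?B" by simp
  let ?r = "\<lambda>z. (fst z, f (fst z))"
  show ?thesis
  proof (rule lift_extension [of ?Z h "R f" ?B L U \<sigma> \<gamma> ?r])
    show "continuous_map ?Z X h"
      by (rule continuous_map_from_subtopology_mono [OF h]) (use f'(3) in \<open>force simp: R_def\<close>)
    show "topspace ?Z \<subseteq> R f \<union> ?B"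
    proof
      fix z assume z: "z \<in> topspace ?Z"
      show "z \<in> R f \<union> ?B"
      proof (cases "snd z \<le> f (fst z)")
        case False
        then have "f (fst z) \<noteq> f' (fst z)" using z by (auto simp: R_def)
        then show ?thesis using z False C(2) by (auto simp: R_def)
      qed (use z in \<open>auto simp: R_def\<close>)
    qed
    have sub: "subtopology ?Z (R f) = top_of_set (R f)"
      using RR by (simp add: subtopology_subtopology Int_absorb1)
    show "continuous_map (subtopology ?Z (R f)) (btotal P) L" unfolding sub by (rule L)
    show "bproj P (L z) = h z" if "z \<in> R f" for z
      using L(2) [of "fst z" "snd z"] that by (auto simp: R_def)
    show "h z \<in> U" if "z \<in> ?B" for z
      using U [of "fst z" "snd z"] that by (auto simp: R_def)
    have "continuous_on ?B ?r"
      by (intro continuous_intros continuous_on_subset [OF fc]) auto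
    then have "continuous_map (subtopology ?Z ?B) euclidean ?r"
      by (simp add: subtopology_subtopology Int_absorb1)
    moreover have "?r z \<in> R f \<inter> ?B" if "z \<in> ?B" for z
      using that f f' by (auto simp: R_def)
    ultimately show "continuous_map (subtopology ?Z ?B) (subtopology ?Z (R f \<inter> ?B)) ?r"
      by (auto simp: continuous_map_in_subtopology)
    fix L' assume L': "continuous_map ?Z (btotal P) L'" "\<And>z. z \<in> topspace ?Z \<Longrightarrow> bproj P (L' z) = h z"
      "\<And>z. z \<in> R f \<Longrightarrow> L' z = L z"
    then show ?thesis
      unfolding lifts_below_def R_def [symmetric]
      by (intro exI [of _ L']) (auto simp: R_def L f)
  qed (use A B c in \<open>auto simp: R_def prod_eq_iff\<close>)
qed

text \<open>In place of a subdivision of the base into small cubes, S \<times> [0, 1] is climbed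
  along graphs: each time step is raised near one point of a finite net after the other, every time
  inside one chart.\<close>

lemma homotopy_lifting:
  fixes S :: "'a::metric_space set" and h :: "'a \<times> real \<Rightarrow> 'x"
  assumes S: "compact S" and h: "continuous_map (top_of_set (S \<times> {0..1})) X h"
    and L0: "continuous_map (top_of_set S) (btotal P) L0" "\<And>x. x \<in> S \<Longrightarrow> bproj P (L0 x) = h (x, 0)"
  obtains L where "continuous_map (top_of_set (S \<times> {0..1})) (btotal P) L"
    "\<And>z. z \<in> S \<times> {0..1} \<Longrightarrow> bproj P (L z) = h z" "\<And>x. x \<in> S \<Longrightarrow> L (x, 0) = L0 x"
proof -
  let ?Z = "S \<times> {0..1::real}"
  define \<G> where "\<G> = {G. open G \<and> (\<exists>U \<sigma> \<gamma>. chart X P U \<sigma> \<gamma> \<and> (\<forall>z\<in>G \<inter> ?Z. h z \<in> U))}"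
  have cover: "?Z \<subseteq> \<Union>\<G>"
  proof
    fix z assume z: "z \<in> ?Z"
    then have "h z \<in> topspace X" using continuous_map_in_topspace [OF h] by auto
    then obtain U \<sigma> \<gamma> where U: "h z \<in> U" "chart X P U \<sigma> \<gamma>" by (rule chart_exists)
    have "openin (top_of_set ?Z) {z \<in> topspace (top_of_set ?Z). h z \<in> U}"
      by (rule continuous_map_openin_preimage [OF h]) (use U in \<open>simp add: chart_def\<close>)
    then obtain G where G: "open G" "{z \<in> topspace (top_of_set ?Z). h z \<in> U} = ?Z \<inter> G"
      unfolding openin_open by blast
    have G2: "?Z \<inter> G = {z \<in> ?Z. h z \<in> U}" using G(2) by simp
    have "\<forall>z\<in>G \<inter> ?Z. h z \<in> U"
    proof
      fix z assume "z \<in> G \<inter> ?Z"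
      then have "z \<in> ?Z \<inter> G" by blast
      then show "h z \<in> U" unfolding G2 by blast
    qed
    then have "G \<in> \<G>" unfolding \<G>_def using G(1) U(2) by blast
    moreover have "z \<in> ?Z \<inter> G" unfolding G2 using U(1) z by blast
    ultimately show "z \<in> \<Union>\<G>" by (intro UnionI) auto
  qed
  have compact: "compact ?Z" using S by (intro compact_Times) auto
  have opn: "\<And>G. G \<in> \<G> \<Longrightarrow> open G" by (simp add: \<G>_def)
  obtain \<epsilon> where \<epsilon>: "0 < \<epsilon>" "\<And>z. z \<in> ?Z \<Longrightarrow> \<exists>G\<in>\<G>. ball z \<epsilon> \<subseteq> G"
    using Heine_Borel_lemma [OF compact cover opn] by blast
  \<comment> \<open>Here \<open>\<epsilon>\<close> is a Lebesgue number. A bump of radius 2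
    \<open>r\<close> = \<open>\<epsilon>\<close> / 2 and a time step below \<open>\<epsilon>\<close>
    / 2 together stay within distance \<open>\<epsilon>\<close> of their centre, hence in one
    chart.\<close>
  obtain n :: nat where n: "n \<noteq> 0" "1 / real n < \<epsilon> / 2"
    using real_arch_inverse [of "\<epsilon> / 2"] \<epsilon>(1) by (auto simp: inverse_eq_divide)
  define r where "r = \<epsilon> / 4"
  have r: "0 < r" using \<epsilon> by (simp add: r_def)
  obtain F where F: "finite F" "F \<subseteq> S" "S \<subseteq> (\<Union>p\<in>F. ball p r)"
    using seq_compact_imp_totally_bounded [OF compact_imp_seq_compact [OF S]] r by metis
  obtain ps where ps: "set ps = F" using finite_list [OF F(1)] by blast
  \<comment> \<open>Equal to 1 within distance \<open>r\<close> of \<open>p\<close> and to 0 beyond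
    2 \<open>r\<close>. The \<open>r\<close>-balls around the net cover \<open>S\<close>, so the
    maximum of all bumps is 1.\<close>
  define bump where "bump p x = max 0 (min 1 (2 - dist x p / r))" for p x :: 'a
  define top where "top qs x = foldr (\<lambda>p m. max (bump p x) m) qs 0" for qs x
  have top_simps: "top [] x = 0" "top (p # qs) x = max (bump p x) (top qs x)" for p qs x
    by (simp_all add: top_def)
  have bump_bounds: "0 \<le> bump p x" "bump p x \<le> 1" for p x by (auto simp: bump_def)
  have top_bounds: "0 \<le> top qs x \<and> top qs x \<le> 1" for qs x
    by (induction qs) (auto simp: top_simps bump_bounds le_max_iff_disj)
  have top_cont: "continuous_on S (top qs)" for qs
  proof (induction qs)
    case (Cons p qs)
    have "continuous_on S (bump p)" unfolding bump_def using r by (intro continuous_intros) auto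
    then have "continuous_on S (\<lambda>x. max (bump p x) (top qs x))" by (intro continuous_on_max Cons)
    then show ?case by (simp add: top_simps)
  qed (simp add: top_simps)
  have top_1: "top ps x = 1" if x: "x \<in> S" for x
  proof -
    obtain p where "p \<in> set ps" "dist p x < r" using F x ps by auto
    then have "bump p x = 1" using r by (simp add: bump_def dist_commute)
    have "bump p x \<le> top qs x" if "p \<in> set qs" for qs
      using that by (induction qs) (auto simp: top_simps)
    then have "1 \<le> top ps x" using \<open>p \<in> set ps\<close> \<open>bump p x = 1\<close> by force
    then show ?thesis using top_bounds [of ps x] by linarith
  qed
  \<comment> \<open>The graph climbs from height k / n for the empty list to (k + 1) / n for the
    whole net. Adding one point \<open>p\<close> changes it only within distance 2 \<open>r\<close>
    of \<open>p\<close>.\<close>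
  define f where "f k qs x = real k / real n + top qs x / real n" for k qs x
  have round: "lifts_below h L0 S (f k qs)"
    if k: "k < n" and start: "lifts_below h L0 S (f k [])" and qs: "set qs \<subseteq> S" for k qs
    using qs
  proof (induction qs)
    case (Cons p qs)
    let ?w = "(p, real k / real n)"
    have "?w \<in> ?Z" using Cons.prems k by (auto simp: field_simps)
    then obtain G where "G \<in> \<G>" and ball: "ball ?w \<epsilon> \<subseteq> G" using \<epsilon>(2) by blast
    then obtain U \<sigma> \<gamma> where c: "chart X P U \<sigma> \<gamma>" and U: "\<And>z. z \<in> G \<Longrightarrow> z \<in> ?Z \<Longrightarrow> h z \<in> U"
      unfolding \<G>_def by blast
    have fb: "real k / real n \<le> f k qs x" "f k qs x \<le> real k / real n + 1 / real n"
      "f k qs x \<le> 1" for qs x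
    proof -
      show "real k / real n \<le> f k qs x" "f k qs x \<le> real k / real n + 1 / real n"
        using top_bounds [of qs x] n by (simp_all add: f_def divide_right_mono)
      moreover have "real k / real n + 1 / real n \<le> 1" using k by (simp add: field_simps)
      ultimately show "f k qs x \<le> 1" by linarith
    qed
    show ?case
    proof (rule lifts_below_step [OF h, where f = "f k qs" and C = "cball p (2 * r)"])
      show "continuous_on S (f k qs)" "continuous_on S (f k (p # qs))"
        unfolding f_def using n by (intro continuous_intros top_cont; simp)+
      show "0 \<le> f k qs x" for x using fb(1) [of qs x] by (meson divide_nonneg_nonneg of_nat_0_le_iff order_trans)
      show "f k qs x \<le> f k (p # qs) x" for x
        unfolding f_def top_simps by (intro add_left_mono divide_right_mono) auto
      show "x \<in> cball p (2 * r)" if "f k qs x \<noteq> f k (p # qs) x" for x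
      proof (rule ccontr)
        assume "x \<notin> cball p (2 * r)"
        then have "2 \<le> dist x p / r" using r by (simp add: field_simps dist_commute)
        then have "bump p x = 0" by (simp add: bump_def)
        then show False using that top_bounds [of qs x] by (simp add: f_def top_simps max_def split: if_splits)
      qed
      show "h (x, s) \<in> U" if x: "x \<in> S \<inter> cball p (2 * r)" and s: "f k qs x \<le> s" "s \<le> f k (p # qs) x" for x s
      proof (rule U)
        have s': "real k / real n \<le> s" "s \<le> real k / real n + 1 / real n" "s \<le> 1"
          using s fb [of qs x] fb [of "p # qs" x] by linarith+
        have "dist ?w (x, s) \<le> dist p x + dist (real k / real n) s"
          unfolding dist_prod_def by (simp add: sqrt_sum_squares_le_sum)
        also have "\<dots> < \<epsilon>" using x s' n(2) by (simp add: dist_real_def r_def)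
        finally show "(x, s) \<in> G" using ball by auto
        have "0 \<le> real k / real n" by simp
        then have "0 \<le> s" using s'(1) by linarith
        then show "(x, s) \<in> ?Z" using x s' by simp
      qed
    qed (use Cons c fb in auto)
  qed (rule start)
  have "lifts_below h L0 S (\<lambda>_. real k / real n)" if "k \<le> n" for k
    using that
  proof (induction k)
    case 0
    have "continuous_map (top_of_set {z. fst z \<in> S \<and> 0 \<le> snd z \<and> snd z \<le> (0::real)}) (top_of_set S) fst"
      by (auto intro: continuous_intros)
    from continuous_map_compose' [OF this L0(1)]
    have "continuous_map (top_of_set {z. fst z \<in> S \<and> 0 \<le> snd z \<and> snd z \<le> (0::real)}) (btotal P) (\<lambda>z. L0 (fst z))" .
    moreover have "bproj P (L0 x) = h (x, s)" if "x \<in> S" "0 \<le> s \<and> s \<le> 0" for x s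
    proof -
      have "s = 0" using that(2) by linarith
      then show ?thesis using L0(2) [OF that(1)] by simp
    qed
    ultimately show ?case unfolding lifts_below_def
      by (intro exI [of _ "\<lambda>z. L0 (fst z)"]) simp
  next
    case (Suc k)
    moreover have "f k [] = (\<lambda>_. real k / real n)" by (simp add: fun_eq_iff f_def top_simps)
    ultimately have "lifts_below h L0 S (f k [])" by simp
    then have "lifts_below h L0 S (f k ps)" using round [of k ps] Suc F ps by simp
    then show ?case
      by (rule lifts_below_cong [THEN iffD1, rotated]) (simp add: f_def top_1 add_divide_distrib)
  qed
  from this [of n] have "lifts_below h L0 S (\<lambda>_. 1)" using n by simp
  moreover have "{z. fst z \<in> S \<and> 0 \<le> snd z \<and> snd z \<le> 1} = ?Z" by auto
  ultimately show thesis unfolding lifts_below_def using that by auto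
qed

text \<open>Composing \<open>h\<close> with the contraction gives a homotopy from a constant map to
  \<open>h\<close>. A constant map is lifted by any point of the fibre, and the end of the lifted
  homotopy lifts \<open>h\<close>.\<close>

lemma lift_of_contraction:
  fixes S :: "'a::metric_space set"
  assumes S: "compact S" "S \<noteq> {}" and h: "continuous_map (top_of_set S) X h"
    and c: "continuous_on (S \<times> {0..1}) c" "c ` (S \<times> {0..1}) \<subseteq> S"
      "\<And>x. x \<in> S \<Longrightarrow> c (x, 0) = a" "\<And>x. x \<in> S \<Longrightarrow> c (x, 1::real) = x"
  obtains L where "continuous_map (top_of_set S) (btotal P) L" "\<And>x. x \<in> S \<Longrightarrow> bproj P (L x) = h x"
proof -
  have c': "continuous_map (top_of_set (S \<times> {0..1})) (top_of_set S) c"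
    using c by (auto simp: continuous_map_in_subtopology)
  obtain x where "x \<in> S" using S by blast
  then have "a \<in> S" using c(2) c(3) [of x] by force
  then have "h a \<in> topspace X" using continuous_map_in_topspace [OF h] by simp
  then obtain U \<sigma> \<gamma> where "h a \<in> U" "chart X P U \<sigma> \<gamma>" by (rule chart_exists)
  then have p: "\<sigma> (h a) \<in> topspace (btotal P)" "bproj P (\<sigma> (h a)) = h a"
    using chart_section_in by blast+
  obtain L where L: "continuous_map (top_of_set (S \<times> {0..1})) (btotal P) L"
      "\<And>z. z \<in> S \<times> {0..1} \<Longrightarrow> bproj P (L z) = h (c z)"
    using homotopy_lifting [OF S(1) continuous_map_compose' [OF c' h], of "\<lambda>_. \<sigma> (h a)"] p c(3)
    by (metis continuous_map_const)
  have "continuous_map (top_of_set S) (top_of_set (S \<times> {0..1::real})) (\<lambda>x. (x, 1))"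
    by (auto simp: continuous_map_in_subtopology intro!: continuous_intros)
  from continuous_map_compose' [OF this L(1)] show thesis
    using L(2) c(4) by (intro that [of "\<lambda>x. L (x, 1)"]) auto
qed

end

section \<open>Disks\<close>

definition disk_norm :: "nat \<Rightarrow> (nat \<Rightarrow> real) \<Rightarrow> real" where
  "disk_norm n v = sqrt (\<Sum>k<n. (v k)\<^sup>2)"

text \<open>The closed disk as a set in a type of class \<open>metric_space\<close>, to which
  \<open>homotopy_lifting\<close> applies.\<close>

definition disk :: "nat \<Rightarrow> (nat \<Rightarrow> real) set" where
  "disk n = {v. (\<forall>i\<ge>n. v i = 0) \<and> disk_norm n v \<le> 1}"

lemma closed_disk_eq: "closed_disk n = top_of_set (disk n)"
  by (simp add: closed_disk_def Euclidean_space_def subtopology_subtopology disk_def disk_norm_def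
      Collect_conj_eq euclidean_product_topology)

lemma disk_boundary_eq: "disk_boundary n = {v \<in> disk n. disk_norm n v = 1}"
  by (auto simp: disk_boundary_def disk_def disk_norm_def topspace_Euclidean_space)

lemma open_disk_eq: "open_disk n = {v \<in> disk n. disk_norm n v < 1}"
  by (auto simp: open_disk_def disk_def disk_norm_def topspace_Euclidean_space)

lemma disk_cases: "v \<in> disk n \<Longrightarrow> v \<in> open_disk n \<or> v \<in> disk_boundary n"
  by (auto simp: disk_boundary_eq open_disk_eq disk_def)

lemma open_disk_subset: "open_disk n \<subseteq> disk n"
  and disk_boundary_subset: "disk_boundary n \<subseteq> disk n"
  by (auto simp: disk_boundary_eq open_disk_eq)

lemma continuous_on_disk_norm [continuous_intros]:
  "continuous_on S f \<Longrightarrow> continuous_on S (\<lambda>x. disk_norm n (f x))"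
  using continuous_on_product_then_coordinatewise [of S f]
  unfolding disk_norm_def by (intro continuous_on_real_sqrt continuous_on_sum continuous_on_power)

lemma disk_norm_nonneg: "0 \<le> disk_norm n v"
  by (simp add: disk_norm_def sum_nonneg)

lemma disk_norm_scale: "0 \<le> c \<Longrightarrow> disk_norm n (\<lambda>i. c * v i) = c * disk_norm n v"
  by (simp add: disk_norm_def power_mult_distrib real_sqrt_mult flip: sum_distrib_left)

lemma scale_in_disk: "v \<in> disk n \<Longrightarrow> 0 \<le> c \<Longrightarrow> c \<le> 1 \<Longrightarrow> (\<lambda>i. c * v i) \<in> disk n"
  using mult_mono [of c 1 "disk_norm n v" 1] by (simp add: disk_def disk_norm_scale disk_norm_nonneg)

lemma zero_in_disk: "(\<lambda>i. 0) \<in> disk n"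
  by (simp add: disk_def disk_norm_def)

text \<open>All coordinates have absolute value at most 1, so the disk is a closed subset of an
  infinite product of intervals, which is compact by Tychonoff.\<close>

lemma compact_disk: "compact (disk n)"
proof -
  have "compactin (product_topology (\<lambda>i. euclideanreal) UNIV) (PiE UNIV (\<lambda>i :: nat. {-1..1}))"
    by (simp add: compactin_PiE)
  then have K: "compact (PiE UNIV (\<lambda>i :: nat. {-1..1 :: real}))"
    by (simp add: euclidean_product_topology)
  have "closed {v. \<forall>i. n \<le> i \<longrightarrow> v i = (0 :: real)}"
    by (intro closed_Collect_all closed_Collect_imp closed_Collect_eq continuous_on_product_coordinates)
      auto
  moreover have "closed {v. disk_norm n v \<le> 1}"
    by (intro closed_Collect_le continuous_on_disk_norm continuous_on_id continuous_on_const)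
  ultimately have "closed (disk n)"
    unfolding disk_def Collect_conj_eq by (rule closed_Int)
  moreover have "\<bar>v i\<bar> \<le> 1" if "v \<in> disk n" for v i
  proof (cases "i < n")
    case True
    have "(v i)\<^sup>2 \<le> (\<Sum>k<n. (v k)\<^sup>2)" using True by (intro member_le_sum) auto
    also have "\<dots> \<le> 1" using that by (simp add: disk_def disk_norm_def)
    finally show ?thesis by (simp add: abs_square_le_1)
  qed (use that in \<open>simp add: disk_def\<close>)
  then have "disk n \<subseteq> PiE UNIV (\<lambda>i. {-1..1})" by (auto simp: abs_le_iff minus_le_iff)
  ultimately show ?thesis using compact_Int_closed [OF K] by (metis inf.absorb2)
qed

section \<open>Extending maps and lifts from the boundary sphere to the disk\<close>

definition radial :: "nat \<Rightarrow> (nat \<Rightarrow> real) \<Rightarrow> nat \<Rightarrow> real" where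
  "radial n v i = v i / disk_norm n v"

lemma radial_in: "v \<in> disk n \<Longrightarrow> 0 < disk_norm n v \<Longrightarrow> radial n v \<in> disk_boundary n"
  using disk_norm_scale [of "1 / disk_norm n v" n v]
  by (simp add: disk_boundary_eq disk_def radial_def [abs_def])

lemma radial_boundary: "v \<in> disk_boundary n \<Longrightarrow> radial n v = v"
  by (simp add: disk_boundary_eq radial_def fun_eq_iff)

lemma continuous_on_radial [continuous_intros]:
  "continuous_on S f \<Longrightarrow> (\<And>x. x \<in> S \<Longrightarrow> disk_norm n (f x) \<noteq> 0) \<Longrightarrow>
    continuous_on S (\<lambda>x. radial n (f x))"
  unfolding radial_def [abs_def]
  by (rule continuous_on_coordinatewise_then_product, rule continuous_on_divide)
    (auto intro: continuous_on_disk_norm continuous_on_product_then_coordinatewise [of S f])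

text \<open>The shell \<open>1/2 \<le> \<parallel>v\<parallel>\<close> avoids the discontinuity of the radial projection at the centre.\<close>

lemma continuous_map_disk_shell:
  fixes Y :: "'y topology"
  assumes c: "continuous_map (top_of_set (disk n \<times> {0..1::real})) Y (\<lambda>z. c)"
    and f: "continuous_map (top_of_set {z \<in> disk n \<times> {0..1::real}. 1/2 \<le> disk_norm n (fst z)}) Y f"
    and eq: "\<And>z. z \<in> disk n \<times> {0..1} \<Longrightarrow> disk_norm n (fst z) = 1/2 \<Longrightarrow> f z = c"
  shows "continuous_map (top_of_set (disk n \<times> {0..1::real})) Y
           (\<lambda>z. if disk_norm n (fst z) \<le> 1/2 then c else f z)"
proof (rule continuous_map_cases_le)
  let ?Z = "disk n \<times> {0..1::real}"
  show "continuous_map (top_of_set ?Z) euclideanreal (\<lambda>z. disk_norm n (fst z))"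
    by (simp add: continuous_intros)
  show "continuous_map (subtopology (top_of_set ?Z) {x \<in> topspace (top_of_set ?Z). disk_norm n (fst x) \<le> 1/2}) Y (\<lambda>z. c)"
    by (rule continuous_map_from_subtopology [OF c])
  have "?Z \<inter> {z \<in> ?Z. 1/2 \<le> disk_norm n (fst z)} = {z \<in> ?Z. 1/2 \<le> disk_norm n (fst z)}"
    by blast
  with f show "continuous_map (subtopology (top_of_set ?Z) {x \<in> topspace (top_of_set ?Z). 1/2 \<le> disk_norm n (fst x)}) Y f"
    by (simp add: subtopology_subtopology)
qed (use eq in auto)

text \<open>On the shell the boundary value at the radial projection is joined to \<open>b\<close>;
  the time 2 - 2 r is 0 on the sphere of radius r = 1 and 1 at r = 1/2, and inside the map is
  constantly \<open>b\<close>. The last clause, for dimension 0, allows the value at a vertex to be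
  prescribed.\<close>

lemma milnor_disk_extension:
  assumes \<psi>: "continuous_map (top_of_set (disk_boundary n \<times> {0..1})) milnor_E \<psi>"
    and b: "b \<in> milnor_points"
  obtains \<psi>' where "continuous_map (top_of_set (disk n \<times> {0..1::real})) milnor_E \<psi>'"
    "\<And>v s. v \<in> disk_boundary n \<Longrightarrow> s \<in> {0..1} \<Longrightarrow> \<psi>' (v, s) = \<psi> (v, s)"
    "disk_boundary n = {} \<Longrightarrow> \<psi>' = (\<lambda>_. b)"
proof (cases "disk_boundary n = {}")
  case True
  with b show thesis by (intro that [of "\<lambda>_. b"]) (auto simp: topspace_milnor_E)
next
  case False
  let ?f = "\<lambda>z. milnor_join (\<psi> (radial n (fst z), snd z)) b (2 - 2 * disk_norm n (fst z))"
  let ?\<psi> = "\<lambda>z. if disk_norm n (fst z) \<le> 1/2 then b else ?f z"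
  let ?S = "{z \<in> disk n \<times> {0..1::real}. 1/2 \<le> disk_norm n (fst z)}"
  have r: "continuous_map (top_of_set ?S) (top_of_set (disk_boundary n \<times> {0..1}))
      (\<lambda>z. (radial n (fst z), snd z))"
    by (auto simp: continuous_map_in_subtopology
        intro!: continuous_on_Pair continuous_on_radial continuous_on_fst continuous_on_snd
          continuous_on_id radial_in)
  have "continuous_map (top_of_set ?S) milnor_E ?f"
    by (intro continuous_milnor_join continuous_map_compose' [OF r \<psi>])
      (auto simp: b topspace_milnor_E intro!: continuous_on_diff continuous_on_mult
        continuous_on_disk_norm continuous_on_fst continuous_on_id)
  then have "continuous_map (top_of_set (disk n \<times> {0..1})) milnor_E ?\<psi>"
  proof (rule continuous_map_disk_shell [rotated])
    show "?f z = b" if "disk_norm n (fst z) = 1/2" for z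
      unfolding that using milnor_join_1 [OF b] by simp
  qed (use b in \<open>simp add: topspace_milnor_E\<close>)
  moreover have "?\<psi> (v, s) = \<psi> (v, s)" if "v \<in> disk_boundary n" "s \<in> {0..1}" for v s
  proof -
    have "\<psi> (v, s) \<in> milnor_points"
      using continuous_map_in_topspace [OF \<psi>, of "(v, s)"] that by (simp add: topspace_milnor_E)
    then show ?thesis
      using that radial_boundary [OF that(1)] by (simp add: disk_boundary_eq milnor_join_0)
  qed
  ultimately show thesis using that [of ?\<psi>] False by simp
qed

context principal_bundle
begin

lemma disk_lift:
  assumes h: "continuous_map (closed_disk n) X h"
  obtains L where "continuous_map (closed_disk n) (btotal P) L" "\<And>v. v \<in> disk n \<Longrightarrow> bproj P (L v) = h v"
proof (rule lift_of_contraction [OF compact_disk _ h [unfolded closed_disk_eq]])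
  let ?c = "\<lambda>(v :: nat \<Rightarrow> real, s) i. s * v i"
  show "disk n \<noteq> {}" using zero_in_disk by blast
  show "continuous_on (disk n \<times> {0..1}) ?c"
    unfolding case_prod_unfold
    by (rule continuous_on_coordinatewise_then_product)
      (intro continuous_on_mult continuous_on_snd continuous_on_id
        continuous_on_product_then_coordinatewise [of _ fst] continuous_on_fst)
  show "?c ` (disk n \<times> {0..1}) \<subseteq> disk n" by (auto intro: scale_in_disk)
qed (auto simp: closed_disk_eq intro: that)

text \<open>This takes the place of the usual homeomorphism that moves the bottom and the side of
  the cylinder to the bottom. A lift \<open>M\<close> with the right start is corrected by a
  group-valued function that extends its deviation from \<open>K\<close> on the side.\<close>

lemma disk_relative_lift:
  assumes h: "continuous_map (top_of_set (disk n \<times> {0..1::real})) X h"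
    and L0: "continuous_map (closed_disk n) (btotal P) L0" "\<And>v. v \<in> disk n \<Longrightarrow> bproj P (L0 v) = h (v, 0)"
    and K: "continuous_map (top_of_set (disk_boundary n \<times> {0..1})) (btotal P) K"
      "\<And>v s. v \<in> disk_boundary n \<Longrightarrow> s \<in> {0..1} \<Longrightarrow> bproj P (K (v, s)) = h (v, s)"
      "\<And>v. v \<in> disk_boundary n \<Longrightarrow> K (v, 0) = L0 v"
  obtains L where "continuous_map (top_of_set (disk n \<times> {0..1})) (btotal P) L"
    "\<And>v s. v \<in> disk n \<Longrightarrow> s \<in> {0..1} \<Longrightarrow> bproj P (L (v, s)) = h (v, s)"
    "\<And>v s. v \<in> disk_boundary n \<Longrightarrow> s \<in> {0..1} \<Longrightarrow> L (v, s) = K (v, s)"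
    "\<And>v. v \<in> disk n \<Longrightarrow> L (v, 0) = L0 v"
proof -
  obtain M where M: "continuous_map (top_of_set (disk n \<times> {0..1})) (btotal P) M"
      "\<And>z. z \<in> disk n \<times> {0..1} \<Longrightarrow> bproj P (M z) = h z" "\<And>v. v \<in> disk n \<Longrightarrow> M (v, 0) = L0 v"
    using homotopy_lifting [OF compact_disk h L0(1) [unfolded closed_disk_eq] L0(2)] by blast
  note Min = continuous_map_in_topspace [OF M(1)] and Kin = continuous_map_in_topspace [OF K(1)]
  let ?B = "disk_boundary n \<times> {0..1::real}"
  define g where "g z = bdiv P (M z) (K z)" for z
  have BD: "z \<in> disk n \<times> {0..1}" if "z \<in> ?B" for z using that disk_boundary_subset by auto
  have "continuous_map (top_of_set ?B) euclidean g"
    unfolding g_def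
    by (rule continuous_bdiv [OF continuous_map_from_subtopology_mono [OF M(1)] K(1)])
      (use BD in \<open>auto simp: M(2) K(2)\<close>)
  then have g: "continuous_on ?B g" by simp
  have g0: "g (v, 0) = 0" if "v \<in> disk_boundary n" for v
  proof -
    have "v \<in> disk n" using that disk_boundary_subset by blast
    then show ?thesis using that Min [of "(v, 0)"] by (simp add: g_def K(3) M(3) bdiv_self)
  qed
  \<comment> \<open>Towards the centre the deviation is delayed: it starts at time 2 (1 - r) at
    radius r. So it is \<open>g\<close> itself on the boundary and 0 both at time 0 and at radius
    1/2, where it meets the constant 0 inside.\<close>
  let ?f = "\<lambda>z. g (radial n (fst z), max 0 (snd z - 2 * (1 - disk_norm n (fst z))))"
  let ?g = "\<lambda>z. if disk_norm n (fst z) \<le> 1/2 then 0 else ?f z"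
  let ?S = "{z \<in> disk n \<times> {0..1::real}. 1/2 \<le> disk_norm n (fst z)}"
  have f: "continuous_on ?S ?f"
  proof (rule continuous_on_compose2 [OF g])
    show "continuous_on ?S (\<lambda>z. (radial n (fst z), max 0 (snd z - 2 * (1 - disk_norm n (fst z)))))"
      by (intro continuous_on_Pair continuous_on_radial continuous_on_max continuous_on_diff
          continuous_on_mult continuous_on_disk_norm continuous_on_fst continuous_on_snd
          continuous_on_id continuous_on_const) auto
    show "(\<lambda>z. (radial n (fst z), max 0 (snd z - 2 * (1 - disk_norm n (fst z))))) ` ?S \<subseteq> ?B"
      by (auto intro!: radial_in) (auto simp: disk_def)
  qed
  have g': "continuous_map (top_of_set (disk n \<times> {0..1})) euclidean ?g"
  proof (rule continuous_map_disk_shell)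
    show "?f z = 0" if "z \<in> disk n \<times> {0..1}" "disk_norm n (fst z) = 1/2" for z
    proof -
      have "max 0 (snd z - 2 * (1 - disk_norm n (fst z))) = 0" using that by auto
      then show ?thesis using that g0 [OF radial_in [of "fst z"]] by auto
    qed
  qed (use f in auto)
  define L where "L z = bact P (M z) (?g z)" for z
  show thesis
  proof
    show "continuous_map (top_of_set (disk n \<times> {0..1})) (btotal P) L"
      unfolding L_def by (rule continuous_act [OF M(1) g'])
    show "bproj P (L (v, s)) = h (v, s)" if "v \<in> disk n" "s \<in> {0..1}" for v s
      using that Min [of "(v, s)"] by (simp add: L_def proj_act M(2))
    show "L (v, s) = K (v, s)" if v: "v \<in> disk_boundary n" "s \<in> {0..1}" for v s
    proof -
      have "?g (v, s) = g (v, s)" using v radial_boundary [OF v(1)] by (simp add: disk_boundary_eq)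
      then show ?thesis
        using Min [of "(v, s)"] Kin [of "(v, s)"] BD [of "(v, s)"] v
        by (simp add: L_def g_def act_bdiv M(2) K(2))
    qed
    show "L (v, 0) = L0 v" if v: "v \<in> disk n" for v
    proof -
      have "disk_norm n v \<le> 1" using v by (simp add: disk_def)
      then have "?g (v, 0) = 0" using g0 [OF radial_in [OF v]] by simp
      then show ?thesis using Min [of "(v, 0)"] v by (simp add: L_def act_0 M(3))
    qed
  qed
qed

end

section \<open>The weak topology of a CW-complex\<close>

abbreviation unit_interval :: "real topology" where
  "unit_interval \<equiv> top_of_set {0..1}"

lemma prod_unit_interval_subtopology:
  assumes "A \<subseteq> B"
  shows "prod_topology (subtopology T A) unit_interval
    = subtopology (prod_topology (subtopology T B) unit_interval) (A \<times> {0..1})"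
  using assms by (simp only: subtopology_Times subtopology_subtopology inf.absorb2 Int_absorb)

lemma prod_unit_interval_subtopology':
  "prod_topology (subtopology T A) unit_interval
    = subtopology (prod_topology T unit_interval) (A \<times> {0..1})"
  using prod_unit_interval_subtopology [of A UNIV T] by simp

locale cw =
  fixes X :: "'x topology" and I :: "'i set" and d :: "'i \<Rightarrow> nat" and \<Phi> :: "'i \<Rightarrow> (nat \<Rightarrow> real) \<Rightarrow> 'x"
  assumes cw: "cw_complex X I d \<Phi>"
begin

definition open_cell :: "'i \<Rightarrow> 'x set" where "open_cell i = \<Phi> i ` open_disk (d i)"

definition cell :: "'i \<Rightarrow> 'x set" where "cell i = \<Phi> i ` disk (d i)"

section \<open>Open and closed cells and their boundaries\<close>

lemma Hausdorff: "Hausdorff_space X"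
  and characteristic_map: "i \<in> I \<Longrightarrow> continuous_map (closed_disk (d i)) X (\<Phi> i)"
  and open_cells_cover: "(\<Union>i\<in>I. open_cell i) = topspace X"
  using cw by (auto simp: cw_complex_def open_cell_def)

lemma inj_on_open_disk: "i \<in> I \<Longrightarrow> inj_on (\<Phi> i) (open_disk (d i))"
proof -
  assume "i \<in> I"
  then have "homeomorphic_map (subtopology (closed_disk (d i)) (open_disk (d i)))
      (subtopology X (\<Phi> i ` open_disk (d i))) (\<Phi> i)"
    using cw by (simp add: cw_complex_def)
  from homeomorphic_imp_injective_map [OF this] show ?thesis
    using open_disk_subset [of "d i"] by (simp add: closed_disk_eq inf.absorb2)
qed

lemma open_cell_unique: "i \<in> I \<Longrightarrow> j \<in> I \<Longrightarrow> x \<in> open_cell i \<Longrightarrow> x \<in> open_cell j \<Longrightarrow> i = j"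
  using cw unfolding cw_complex_def disjoint_family_on_def open_cell_def by blast

lemma cell_boundary:
  assumes "i \<in> I"
  obtains J where "finite J" "J \<subseteq> {j \<in> I. d j < d i}"
    "\<Phi> i ` disk_boundary (d i) \<subseteq> (\<Union>j\<in>J. open_cell j)"
  using cw assms unfolding cw_complex_def open_cell_def by meson

lemma open_cell_subset: "open_cell i \<subseteq> cell i"
  unfolding open_cell_def cell_def using open_disk_subset by (rule image_mono)

lemma cell_cases:
  assumes "i \<in> I" and "x \<in> cell i"
  obtains "x \<in> open_cell i" | j where "j \<in> I" "d j < d i" "x \<in> open_cell j"
proof -
  obtain v where v: "x = \<Phi> i v" "v \<in> disk (d i)" using assms by (auto simp: cell_def)
  show thesis
  proof (cases "v \<in> open_disk (d i)")
    case True
    then show thesis using v that(1) by (simp add: open_cell_def)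
  next
    case False
    then have "x \<in> \<Phi> i ` disk_boundary (d i)" using v disk_cases by blast
    moreover obtain J where "J \<subseteq> {j \<in> I. d j < d i}"
        "\<Phi> i ` disk_boundary (d i) \<subseteq> (\<Union>j\<in>J. open_cell j)"
      using cell_boundary [OF assms(1)] .
    ultimately obtain j where "j \<in> I" "d j < d i" "x \<in> open_cell j" by blast
    then show thesis by (rule that(2))
  qed
qed

lemma boundary_disjoint:
  assumes "i \<in> I" and "v \<in> disk_boundary (d i)"
  shows "\<Phi> i v \<notin> open_cell i"
proof
  assume i: "\<Phi> i v \<in> open_cell i"
  obtain J where "J \<subseteq> {j \<in> I. d j < d i}"
      "\<Phi> i ` disk_boundary (d i) \<subseteq> (\<Union>j\<in>J. open_cell j)"
    using cell_boundary [OF assms(1)] .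
  then obtain j where "j \<in> I" "d j < d i" "\<Phi> i v \<in> open_cell j"
    using assms(2) by blast
  then show False using open_cell_unique [OF assms(1) _ i] by blast
qed

lemma compactin_cell: "i \<in> I \<Longrightarrow> compactin X (cell i)"
  unfolding cell_def using compact_disk [of "d i"]
  by (intro image_compactin [OF _ characteristic_map]) (simp_all add: closed_disk_eq compactin_subtopology)

lemma closedin_cell: "i \<in> I \<Longrightarrow> closedin X (cell i)"
  by (rule compactin_imp_closedin [OF Hausdorff compactin_cell])

lemma cell_subset: "i \<in> I \<Longrightarrow> cell i \<subseteq> topspace X"
  using closedin_cell closedin_subset by blast

text \<open>The definition tests with the closure of an open cell. The image of the disk is compact,
  hence closed in the Hausdorff space X, and therefore contains this closure.\<close>

lemma weak_topology:
  assumes A: "A \<subseteq> topspace X" and cells: "\<And>i. i \<in> I \<Longrightarrow> closedin X (A \<inter> cell i)"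
  shows "closedin X A"
proof -
  have "closedin X (A \<inter> X closure_of (\<Phi> i ` open_disk (d i)))" if i: "i \<in> I" for i
  proof -
    have "X closure_of (open_cell i) \<subseteq> cell i"
      by (rule closure_of_minimal [OF open_cell_subset closedin_cell [OF i]])
    then have "A \<inter> X closure_of (open_cell i) = (A \<inter> cell i) \<inter> X closure_of (open_cell i)" by blast
    then show ?thesis using cells [OF i] by (simp add: closedin_Int flip: open_cell_def)
  qed
  then show ?thesis using cw A unfolding cw_complex_def by blast
qed

text \<open>A case of Whitehead's theorem on products with a locally compact space. Around a point
  of \<open>W\<close> a tube V \<times> J is found with J a compact interval, and openness of
  \<open>V\<close> is tested in X itself.\<close>

lemma weak_topology_interval:
  assumes W: "W \<subseteq> topspace X \<times> {0..1}"
    and cells: "\<And>i. i \<in> I \<Longrightarrow>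
      openin (prod_topology (subtopology X (cell i)) unit_interval) (W \<inter> cell i \<times> {0..1})"
  shows "openin (prod_topology X unit_interval) W"
  unfolding openin_prod_topology_alt
proof (intro allI impI)
  fix x s assume xs: "(x, s) \<in> W"
  then have x: "x \<in> topspace X" and s: "s \<in> {0..1}" using W by auto
  obtain i where i: "i \<in> I" "x \<in> cell i" using x open_cells_cover open_cell_subset by blast
  have slice: "continuous_map unit_interval (prod_topology (subtopology X (cell i)) unit_interval) (\<lambda>t. (x, t))"
    using x i by (intro continuous_map_pairedI) auto
  have "openin unit_interval {t \<in> topspace unit_interval. (x, t) \<in> W \<inter> cell i \<times> {0..1}}"
    by (rule continuous_map_openin_preimage [OF slice cells [OF i(1)]])
  moreover have "{t \<in> topspace unit_interval. (x, t) \<in> W \<inter> cell i \<times> {0..1}} = {t \<in> {0..1}. (x, t) \<in> W}"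
    using i(2) by auto
  ultimately have "openin unit_interval {t \<in> {0..1}. (x, t) \<in> W}" by simp
  then obtain e where e: "0 < e" "\<And>t. t \<in> {0..1} \<Longrightarrow> dist t s < e \<Longrightarrow> (x, t) \<in> W"
    using xs s unfolding openin_euclidean_subtopology_iff by blast
  \<comment> \<open>Half the radius turns the e-ball, whose slice lies in \<open>W\<close>, into a
    compact neighbourhood.\<close>
  define J where "J = cball s (e / 2) \<inter> {0..1}"
  define V where "V = {y \<in> topspace X. \<forall>t\<in>J. (y, t) \<in> W}"
  have "closedin X (topspace X - V)"
  proof (rule weak_topology)
    fix i assume i: "i \<in> I"
    let ?K = "cell i \<times> {0..1::real}"
    have K: "compactin (prod_topology X unit_interval) ?K"
      using compactin_cell [OF i] by (simp add: compactin_Times compactin_subtopology)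
    have KT: "topspace (prod_topology (subtopology X (cell i)) unit_interval) = ?K"
      using cell_subset [OF i] by auto
    have "closedin (prod_topology (subtopology X (cell i)) unit_interval) (?K - W \<inter> ?K)"
      using closedin_diff [OF closedin_topspace cells [OF i]] unfolding KT .
    then have "closedin (subtopology (prod_topology X unit_interval) ?K) (?K - W \<inter> ?K)"
      unfolding prod_unit_interval_subtopology' .
    moreover have "closedin (prod_topology X unit_interval) ?K"
      using closedin_cell [OF i] by (simp add: closedin_prod_Times_iff)
    ultimately have "closedin (prod_topology X unit_interval) (?K - W \<inter> ?K)"
      using closedin_closed_subtopology by blast
    moreover have "closedin (prod_topology X unit_interval) (topspace X \<times> J)"
      by (simp add: closedin_prod_Times_iff J_def closedin_closed_Int inf_commute)
    ultimately have "closedin (prod_topology X unit_interval) ((?K - W \<inter> ?K) \<inter> (topspace X \<times> J))"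
      by (rule closedin_Int)
    then have "compactin (prod_topology X unit_interval) ((?K - W \<inter> ?K) \<inter> (topspace X \<times> J))"
      by (rule closed_compactin [OF K, rotated]) auto
    then have "compactin X (fst ` ((?K - W \<inter> ?K) \<inter> (topspace X \<times> J)))"
      by (rule image_compactin [OF _ continuous_map_fst])
    \<comment> \<open>Within a cell the complement of \<open>V\<close> is the projection of a
      compact set, hence compact and so closed.\<close>
    moreover have "fst ` ((?K - W \<inter> ?K) \<inter> (topspace X \<times> J)) = (topspace X - V) \<inter> cell i"
    proof (intro subset_antisym subsetI)
      fix y assume "y \<in> fst ` ((?K - W \<inter> ?K) \<inter> (topspace X \<times> J))"
      then obtain z where "y = fst z" "z \<in> (?K - W \<inter> ?K) \<inter> (topspace X \<times> J)" by (rule imageE)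
      then have "(y, snd z) \<in> (?K - W \<inter> ?K) \<inter> (topspace X \<times> J)" by (simp only: prod.collapse)
      then have "(y, snd z) \<notin> W" "y \<in> cell i" "y \<in> topspace X" "snd z \<in> J" by blast+
      then show "y \<in> (topspace X - V) \<inter> cell i" by (auto simp: V_def)
    next
      fix y assume "y \<in> (topspace X - V) \<inter> cell i"
      then obtain t where "(y, t) \<notin> W" "y \<in> cell i" "y \<in> topspace X" "t \<in> J"
        unfolding V_def by blast
      then have "(y, t) \<in> (?K - W \<inter> ?K) \<inter> (topspace X \<times> J)" by (auto simp: J_def)
      then show "y \<in> fst ` ((?K - W \<inter> ?K) \<inter> (topspace X \<times> J))" by (rule image_eqI [rotated]) simp
    qed
    ultimately show "closedin X ((topspace X - V) \<inter> cell i)"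
      using compactin_imp_closedin [OF Hausdorff] by simp
  qed auto
  moreover have "V \<subseteq> topspace X" by (auto simp: V_def)
  ultimately have "openin X V" by (simp add: openin_closedin)
  moreover have "openin unit_interval ({0..1} \<inter> ball s (e / 2))" by (simp add: openin_open_Int)
  moreover have "x \<in> V" using x e unfolding V_def J_def by (auto simp: dist_commute)
  moreover have "s \<in> {0..1} \<inter> ball s (e / 2)" using s e by simp
  moreover have "V \<times> ({0..1} \<inter> ball s (e / 2)) \<subseteq> W" by (auto simp: V_def J_def)
  ultimately show "\<exists>V T. openin X V \<and> openin unit_interval T \<and> x \<in> V \<and> s \<in> T \<and> V \<times> T \<subseteq> W"
    by (intro exI conjI)
qed

text \<open>As \<open>U\<close> is open, preimages are open in U \<times> [0, 1] as soon as they are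
  open in X \<times> [0, 1], where \<open>weak_topology_interval\<close> applies.\<close>

lemma continuous_map_cellwise:
  assumes U: "openin X U"
    and f: "\<And>i. i \<in> I \<Longrightarrow> continuous_map (prod_topology (subtopology X (U \<inter> cell i)) unit_interval) Y f"
  shows "continuous_map (prod_topology (subtopology X U) unit_interval) Y f"
  unfolding continuous_map
proof (intro conjI allI impI)
  have UX: "U \<subseteq> topspace X" using openin_subset [OF U] .
  have top: "topspace (prod_topology (subtopology X U) unit_interval) = U \<times> {0..1}"
    "topspace (prod_topology (subtopology X (U \<inter> cell i)) unit_interval) = (U \<inter> cell i) \<times> {0..1}" for i
    using UX by auto
  show "f ` topspace (prod_topology (subtopology X U) unit_interval) \<subseteq> topspace Y"
    unfolding top
  proof clarify
    fix x and s :: real assume x: "x \<in> U" "s \<in> {0..1}"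
    then obtain i where i: "i \<in> I" "x \<in> cell i" using UX open_cells_cover open_cell_subset by blast
    show "f (x, s) \<in> topspace Y"
      using continuous_map_in_topspace [OF f [OF i(1)], of "(x, s)"] x i unfolding top by auto
  qed
  fix V assume V: "openin Y V"
  let ?W = "{z \<in> U \<times> {0..1}. f z \<in> V}"
  have "openin (prod_topology X unit_interval) ?W"
  proof (rule weak_topology_interval)
    show "?W \<subseteq> topspace X \<times> {0..1}" using UX by auto
    fix i assume i: "i \<in> I"
    let ?C = "prod_topology (subtopology X (cell i)) unit_interval"
    have "openin (prod_topology (subtopology X (U \<inter> cell i)) unit_interval) {z \<in> (U \<inter> cell i) \<times> {0..1}. f z \<in> V}"
      using continuous_map_openin_preimage [OF f [OF i] V] unfolding top .
    moreover have "prod_topology (subtopology X (U \<inter> cell i)) unit_interval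
        = subtopology ?C ((U \<inter> cell i) \<times> {0..1})"
      by (rule prod_unit_interval_subtopology) blast
    ultimately have 1: "openin (subtopology ?C ((U \<inter> cell i) \<times> {0..1})) {z \<in> (U \<inter> cell i) \<times> {0..1}. f z \<in> V}"
      by (simp only:)
    have 2: "openin ?C ((U \<inter> cell i) \<times> {0..1})"
      using openin_subtopology_Int [OF U, of "cell i"] by (simp add: openin_prod_Times_iff)
    have "openin ?C {z \<in> (U \<inter> cell i) \<times> {0..1}. f z \<in> V}"
      using 1 unfolding openin_open_subtopology [OF 2] ..
    moreover have "{z \<in> (U \<inter> cell i) \<times> {0..1}. f z \<in> V} = ?W \<inter> cell i \<times> {0..1}" by auto
    ultimately show "openin ?C (?W \<inter> cell i \<times> {0..1})" by simp
  qed
  then have "openin (subtopology (prod_topology X unit_interval) (U \<times> {0..1})) (U \<times> {0..1} \<inter> ?W)"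
    by (rule openin_subtopology_Int2)
  moreover have "U \<times> {0..1} \<inter> ?W = ?W" by auto
  ultimately show "openin (prod_topology (subtopology X U) unit_interval)
      {z \<in> topspace (prod_topology (subtopology X U) unit_interval). f z \<in> V}"
    unfolding top unfolding prod_unit_interval_subtopology' by (simp only:)
qed

text \<open>The characteristic map times the identity goes from a compact space onto a Hausdorff
  space, hence is a quotient map, and it remains one over the open part given by
  \<open>U\<close>.\<close>

lemma continuous_map_on_cell:
  assumes i: "i \<in> I" and U: "openin X U"
    and f: "continuous_map (top_of_set {z \<in> disk (d i) \<times> {0..1}. \<Phi> i (fst z) \<in> U}) Y (\<lambda>z. f (\<Phi> i (fst z), snd z))"
  shows "continuous_map (prod_topology (subtopology X (U \<inter> cell i)) unit_interval) Y f"
proof -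
  let ?D = "top_of_set (disk (d i) \<times> {0..1::real})" and ?C = "prod_topology (subtopology X (cell i)) unit_interval"
  let ?q = "\<lambda>z. (\<Phi> i (fst z), snd z)"
  have D: "?D = prod_topology (closed_disk (d i)) unit_interval" by (simp add: closed_disk_eq)
  have "continuous_map ?D ?C ?q" unfolding D
  proof (intro continuous_map_pairedI continuous_map_snd)
    have "continuous_map (closed_disk (d i)) (subtopology X (cell i)) (\<Phi> i)"
      using characteristic_map [OF i] by (auto simp: continuous_map_in_subtopology cell_def closed_disk_eq)
    then show "continuous_map (prod_topology (closed_disk (d i)) unit_interval) (subtopology X (cell i)) (\<lambda>z. \<Phi> i (fst z))"
      by (rule continuous_map_compose' [OF continuous_map_fst])
  qed
  moreover have "compact_space ?D"
    by (simp add: compact_space_subtopology compact_Times compact_disk)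
  moreover have "Hausdorff_space ?C"
    by (simp add: Hausdorff_space_prod_topology Hausdorff_space_subtopology Hausdorff)
  moreover have "?q ` topspace ?D = topspace ?C"
    using cell_subset [OF i] by (force simp: cell_def)
  ultimately have "quotient_map ?D ?C ?q" by (rule continuous_imp_quotient_map)
  then have q: "quotient_map (subtopology ?D {z \<in> topspace ?D. ?q z \<in> (U \<inter> cell i) \<times> {0..1}})
      (subtopology ?C ((U \<inter> cell i) \<times> {0..1})) ?q"
    by (rule quotient_map_restriction)
      (auto simp: openin_prod_Times_iff intro: openin_subtopology_Int U)
  have "prod_topology (subtopology X (U \<inter> cell i)) unit_interval = subtopology ?C ((U \<inter> cell i) \<times> {0..1})"
    by (rule prod_unit_interval_subtopology) blast
  moreover have "subtopology ?D {z \<in> topspace ?D. ?q z \<in> (U \<inter> cell i) \<times> {0..1}}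
      = top_of_set {z \<in> disk (d i) \<times> {0..1}. \<Phi> i (fst z) \<in> U}"
    unfolding subtopology_subtopology by (rule arg_cong [where f = top_of_set]) (auto simp: cell_def)
  ultimately show ?thesis
    using continuous_compose_quotient_map [OF q, of Y f] f by (simp add: o_def)
qed

end

section \<open>Equivariant maps cell by cell\<close>

text \<open>
  An equivariant map \<open>P \<times> [0, 1] \<rightarrow> E\<close> is built over one cell after the other. Its continuity is tested
  on local sections of \<open>P\<close>, that is on subsets of \<open>X \<times> [0, 1]\<close>: the total space itself need not carry
  the weak topology of its restrictions to the cells. The invariant relation \<open>R\<close> is a pointwise
  constraint on the values.
\<close>

locale cw_extension = cw X I d \<Phi> + principal_bundle X P
  for X :: "'x topology" and I :: "'i set" and d :: "'i \<Rightarrow> nat" and \<Phi> :: "'i \<Rightarrow> (nat \<Rightarrow> real) \<Rightarrow> 'x"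
    and P :: "('p, 'x, 'g::topological_group_add) gbundle" +
  fixes R :: "'p \<Rightarrow> real \<Rightarrow> 'g formal_sum \<Rightarrow> bool"
  assumes R_act: "\<And>p s e g. p \<in> topspace (btotal P) \<Longrightarrow> s \<in> {0..1} \<Longrightarrow> e \<in> milnor_points \<Longrightarrow>
      R p s e \<Longrightarrow> R (bact P p g) s (milnor_act e g)"
    and disk_extension: "\<And>i \<rho> \<psi>. i \<in> I \<Longrightarrow> continuous_map (closed_disk (d i)) (btotal P) \<rho> \<Longrightarrow>
      (\<And>v. v \<in> disk (d i) \<Longrightarrow> bproj P (\<rho> v) = \<Phi> i v) \<Longrightarrow>
      continuous_map (top_of_set (disk_boundary (d i) \<times> {0..1::real})) milnor_E \<psi> \<Longrightarrow>
      (\<And>v s. v \<in> disk_boundary (d i) \<Longrightarrow> s \<in> {0..1} \<Longrightarrow> R (\<rho> v) s (\<psi> (v, s))) \<Longrightarrow>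
      \<exists>\<psi>'. continuous_map (top_of_set (disk (d i) \<times> {0..1::real})) milnor_E \<psi>' \<and>
        (\<forall>v\<in>disk_boundary (d i). \<forall>s\<in>{0..1}. \<psi>' (v, s) = \<psi> (v, s)) \<and>
        (\<forall>v\<in>disk (d i). \<forall>s\<in>{0..1}. R (\<rho> v) s (\<psi>' (v, s)))"
begin

definition local_section :: "'x set \<Rightarrow> ('x \<Rightarrow> 'p) \<Rightarrow> bool" where
  "local_section U \<sigma> \<longleftrightarrow> openin X U \<and> continuous_map (subtopology X U) (btotal P) \<sigma> \<and>
     (\<forall>x\<in>U. bproj P (\<sigma> x) = x)"

lemma local_section_in:
  assumes "local_section U \<sigma>" and "x \<in> U"
  shows "\<sigma> x \<in> topspace (btotal P)" "bproj P (\<sigma> x) = x" "x \<in> topspace X"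
proof -
  show x: "x \<in> topspace X" using assms openin_subset unfolding local_section_def by blast
  show "\<sigma> x \<in> topspace (btotal P)"
    by (rule continuous_map_in_topspace [of "subtopology X U"])
      (use assms x in \<open>auto simp: local_section_def\<close>)
  show "bproj P (\<sigma> x) = x" using assms by (simp add: local_section_def)
qed

lemma chart_local_section: "chart X P U \<sigma> \<gamma> \<Longrightarrow> local_section U \<sigma>"
  by (simp add: chart_def local_section_def)

text \<open>Only the values over \<open>B\<close>, a closed cell or a finite union of such, matter;
  one function on the whole total space can thus become good on more and more cells. Sections live
  on open sets of X and are merely restricted to \<open>B\<close>.\<close>

definition good :: "'x set \<Rightarrow> ('p \<Rightarrow> real \<Rightarrow> 'g formal_sum) \<Rightarrow> bool" where
  "good B \<phi> \<longleftrightarrow>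
     (\<forall>p\<in>topspace (btotal P). \<forall>s\<in>{0..1}. bproj P p \<in> B \<longrightarrow>
        \<phi> p s \<in> milnor_points \<and> R p s (\<phi> p s) \<and> (\<forall>g. \<phi> (bact P p g) s = milnor_act (\<phi> p s) g)) \<and>
     (\<forall>U \<sigma>. local_section U \<sigma> \<longrightarrow>
        continuous_map (prod_topology (subtopology X (U \<inter> B)) unit_interval) milnor_E
          (\<lambda>z. \<phi> (\<sigma> (fst z)) (snd z)))"

lemma goodD:
  assumes "good B \<phi>" and "p \<in> topspace (btotal P)" and "s \<in> {0..1}" and "bproj P p \<in> B"
  shows "\<phi> p s \<in> milnor_points" "R p s (\<phi> p s)" "\<phi> (bact P p g) s = milnor_act (\<phi> p s) g"
  using assms unfolding good_def by blast+

lemma good_continuous: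
  "good B \<phi> \<Longrightarrow> local_section U \<sigma> \<Longrightarrow>
    continuous_map (prod_topology (subtopology X (U \<inter> B)) unit_interval) milnor_E
      (\<lambda>z. \<phi> (\<sigma> (fst z)) (snd z))"
  unfolding good_def by blast

lemma good_cong:
  assumes "good B \<phi>"
    and eq: "\<And>p. p \<in> topspace (btotal P) \<Longrightarrow> bproj P p \<in> B \<Longrightarrow> \<phi>' p = \<phi> p"
  shows "good B \<phi>'"
  unfolding good_def
proof (intro conjI ballI allI impI)
  fix p s g assume p: "p \<in> topspace (btotal P)" "s \<in> {0..1::real}" "bproj P p \<in> B"
  then show "\<phi>' p s \<in> milnor_points" "R p s (\<phi>' p s)" "\<phi>' (bact P p g) s = milnor_act (\<phi>' p s) g"
    using goodD [OF assms(1) p] by (simp_all add: eq proj_act act_in)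
next
  fix U \<sigma> assume U: "local_section U \<sigma>"
  show "continuous_map (prod_topology (subtopology X (U \<inter> B)) unit_interval) milnor_E
      (\<lambda>z. \<phi>' (\<sigma> (fst z)) (snd z))"
    by (rule continuous_map_eq [OF good_continuous [OF assms(1) U]])
      (auto simp: eq local_section_in [OF U])
qed

text \<open>Finitely many closed pieces can be pasted. Closure-finiteness supplies such a finite
  family around the boundary of each cell.\<close>

lemma good_Union_cells:
  assumes "finite J" and "J \<subseteq> I" and "\<And>j. j \<in> J \<Longrightarrow> good (cell j) \<phi>"
  shows "good (\<Union>j\<in>J. cell j) \<phi>"
  unfolding good_def
proof (intro conjI ballI allI impI)
  fix p s g assume p: "p \<in> topspace (btotal P)" "s \<in> {0..1::real}" "bproj P p \<in> (\<Union>j\<in>J. cell j)"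
  then obtain j where "j \<in> J" "bproj P p \<in> cell j" by blast
  then show "\<phi> p s \<in> milnor_points" "R p s (\<phi> p s)" "\<phi> (bact P p g) s = milnor_act (\<phi> p s) g"
    using goodD [OF assms(3) p(1,2)] by blast+
next
  fix U \<sigma> assume U: "local_section U \<sigma>"
  let ?B = "\<Union>j\<in>J. cell j"
  let ?Z = "prod_topology (subtopology X (U \<inter> ?B)) unit_interval"
  show "continuous_map ?Z milnor_E (\<lambda>z. \<phi> (\<sigma> (fst z)) (snd z))"
  proof (rule pasting_lemma_closed [OF assms(1), where T = "\<lambda>j. (U \<inter> cell j) \<times> {0..1}"
        and f = "\<lambda>_ z. \<phi> (\<sigma> (fst z)) (snd z)"])
    fix j assume j: "j \<in> J"
    have "closedin (subtopology X (U \<inter> ?B)) ((U \<inter> ?B) \<inter> cell j)"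
      using closedin_cell assms(2) j by (intro closedin_subtopology_Int_closed) blast
    moreover have "(U \<inter> ?B) \<inter> cell j = U \<inter> cell j" using j by blast
    ultimately show "closedin ?Z ((U \<inter> cell j) \<times> {0..1})" by (simp add: closedin_prod_Times_iff)
    have "prod_topology (subtopology X (U \<inter> cell j)) unit_interval = subtopology ?Z ((U \<inter> cell j) \<times> {0..1})"
      by (rule prod_unit_interval_subtopology) (use j in blast)
    then show "continuous_map (subtopology ?Z ((U \<inter> cell j) \<times> {0..1})) milnor_E (\<lambda>z. \<phi> (\<sigma> (fst z)) (snd z))"
      using good_continuous [OF assms(3) [OF j] U] by (simp only:)
  qed auto
qed

text \<open>Over a chart the value at p is the value at \<open>\<sigma> (bproj P p)\<close>
  translated by \<open>\<gamma> p\<close>. The first is continuous on U \<times> [0, 1] by the weak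
  topology there, the second by the chart, and no topology on pieces of the total space
  enters.\<close>

lemma good_continuous_map:
  assumes good: "\<And>i. i \<in> I \<Longrightarrow> good (cell i) \<phi>"
  shows "continuous_map (prod_topology (btotal P) unit_interval) milnor_E (\<lambda>z. \<phi> (fst z) (snd z))"
proof (rule continuous_map_locally)
  let ?T = "prod_topology (btotal P) unit_interval"
  fix z assume z: "z \<in> topspace ?T"
  have "bproj P (fst z) \<in> topspace X" using z proj_in by auto
  then obtain U \<sigma> \<gamma> where U: "bproj P (fst z) \<in> U" and c: "chart X P U \<sigma> \<gamma>" by (rule chart_exists)
  have oU: "openin X U" using c by (simp add: chart_def)
  have 1: "continuous_map (prod_topology (subtopology X U) unit_interval) milnor_E (\<lambda>z. \<phi> (\<sigma> (fst z)) (snd z))"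
    by (rule continuous_map_cellwise [OF oU good_continuous [OF good chart_local_section [OF c]]])
  let ?V = "{z \<in> topspace ?T. bproj P (fst z) \<in> U}"
  have pc: "continuous_map ?T X (\<lambda>z. bproj P (fst z))"
    by (rule continuous_map_compose' [OF continuous_map_fst continuous_proj])
  have V: "openin ?T ?V" by (rule continuous_map_openin_preimage [OF pc oU])
  have "continuous_map (subtopology ?T ?V) (subtopology X U) (\<lambda>z. bproj P (fst z))"
    using continuous_map_from_subtopology [OF pc] by (auto simp: continuous_map_in_subtopology)
  then have 2: "continuous_map (subtopology ?T ?V) (prod_topology (subtopology X U) unit_interval)
      (\<lambda>z. (bproj P (fst z), snd z))"
    by (intro continuous_map_pairedI continuous_map_from_subtopology [OF continuous_map_snd])
  have 3: "continuous_map (subtopology ?T ?V) euclidean (\<lambda>z. \<gamma> (fst z))"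
    by (rule continuous_map_compose_subtopology [OF continuous_map_from_subtopology [OF continuous_map_fst]
          _ chart_continuous(2) [OF c]]) simp
  have "continuous_map (subtopology ?T ?V) milnor_E
      (\<lambda>z. milnor_act (\<phi> (\<sigma> (bproj P (fst z))) (snd z)) (\<gamma> (fst z)))"
    using continuous_milnor_act [OF continuous_map_compose' [OF 2 1] 3] by simp
  then have "continuous_map (subtopology ?T ?V) milnor_E (\<lambda>z. \<phi> (fst z) (snd z))"
  proof (rule continuous_map_eq)
    fix z assume "z \<in> topspace (subtopology ?T ?V)"
    then have z: "fst z \<in> topspace (btotal P)" "snd z \<in> {0..1}" "bproj P (fst z) \<in> U" by auto
    let ?x = "bproj P (fst z)"
    note s = chart_section_in [OF c z(3)]
    obtain i where i: "i \<in> I" "?x \<in> cell i" using s(2) open_cells_cover open_cell_subset by blast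
    have "\<phi> (bact P (\<sigma> ?x) (\<gamma> (fst z))) (snd z) = milnor_act (\<phi> (\<sigma> ?x) (snd z)) (\<gamma> (fst z))"
      by (rule goodD(3) [OF good [OF i(1)] s(1) z(2)]) (simp add: s i)
    then show "milnor_act (\<phi> (\<sigma> ?x) (snd z)) (\<gamma> (fst z)) = \<phi> (fst z) (snd z)"
      by (simp add: chart_decompose [OF c z(1,3)])
  qed
  then show "\<exists>V. openin ?T V \<and> z \<in> V \<and> continuous_map (subtopology ?T V) milnor_E (\<lambda>z. \<phi> (fst z) (snd z))"
    using V U z by (intro exI [of _ ?V]) auto
qed

text \<open>The lift \<open>\<rho>\<close> of the characteristic map is not a local section over an
  open set of X. In a chart, however, it differs from the composite of \<open>\<sigma>\<close> with
  \<open>\<Phi> i\<close> only by the continuous coordinate of \<open>\<rho>\<close>, so continuity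
  along \<open>\<sigma>\<close> suffices.\<close>

lemma good_on_boundary:
  assumes i: "i \<in> I" and B: "good B \<phi>" and bd: "\<Phi> i ` disk_boundary (d i) \<subseteq> B"
    and \<rho>: "continuous_map (closed_disk (d i)) (btotal P) \<rho>" "\<And>v. v \<in> disk (d i) \<Longrightarrow> bproj P (\<rho> v) = \<Phi> i v"
  shows "continuous_map (top_of_set (disk_boundary (d i) \<times> {0..1})) milnor_E (\<lambda>z. \<phi> (\<rho> (fst z)) (snd z))"
proof (rule continuous_map_locally)
  let ?S = "disk_boundary (d i)"
  let ?Z = "top_of_set (?S \<times> {0..1::real})"
  have SD: "?S \<subseteq> disk (d i)" by (rule disk_boundary_subset)
  have D: "?Z = prod_topology (subtopology (closed_disk (d i)) ?S) unit_interval"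
    using SD by (simp add: closed_disk_eq subtopology_subtopology inf.absorb2)
  have \<rho>c: "continuous_map ?Z (btotal P) (\<lambda>z. \<rho> (fst z))" unfolding D
    by (rule continuous_map_compose' [OF continuous_map_fst continuous_map_from_subtopology [OF \<rho>(1)]])
  have \<Phi>c: "continuous_map ?Z X (\<lambda>z. \<Phi> i (fst z))" unfolding D
    by (rule continuous_map_compose' [OF continuous_map_fst
          continuous_map_from_subtopology [OF characteristic_map [OF i]]])
  fix z assume z: "z \<in> topspace ?Z"
  then have "\<Phi> i (fst z) \<in> topspace X" using continuous_map_in_topspace [OF \<Phi>c] by blast
  then obtain U \<sigma> \<gamma> where U: "\<Phi> i (fst z) \<in> U" and c: "chart X P U \<sigma> \<gamma>" by (rule chart_exists)
  have oU: "openin X U" using c by (simp add: chart_def)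
  let ?V = "{z \<in> topspace ?Z. \<Phi> i (fst z) \<in> U}"
  have V: "openin ?Z ?V" by (rule continuous_map_openin_preimage [OF \<Phi>c oU])
  have "continuous_map (subtopology ?Z ?V) (subtopology X (U \<inter> B)) (\<lambda>z. \<Phi> i (fst z))"
    using continuous_map_from_subtopology [OF \<Phi>c] bd by (auto simp: continuous_map_in_subtopology)
  moreover have "continuous_map (subtopology ?Z ?V) unit_interval snd"
    unfolding D by (rule continuous_map_from_subtopology [OF continuous_map_snd])
  ultimately have 2: "continuous_map (subtopology ?Z ?V) (prod_topology (subtopology X (U \<inter> B)) unit_interval)
      (\<lambda>z. (\<Phi> i (fst z), snd z))"
    by (rule continuous_map_pairedI)
  have 3: "continuous_map (subtopology ?Z ?V) euclidean (\<lambda>z. \<gamma> (\<rho> (fst z)))"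
    by (rule continuous_map_compose_subtopology [OF continuous_map_from_subtopology [OF \<rho>c]
          _ chart_continuous(2) [OF c]]) (use SD in \<open>auto simp: \<rho>(2)\<close>)
  have "continuous_map (subtopology ?Z ?V) milnor_E
      (\<lambda>z. milnor_act (\<phi> (\<sigma> (\<Phi> i (fst z))) (snd z)) (\<gamma> (\<rho> (fst z))))"
    using continuous_milnor_act [OF continuous_map_compose' [OF 2
          good_continuous [OF B chart_local_section [OF c]]] 3] by simp
  then have "continuous_map (subtopology ?Z ?V) milnor_E (\<lambda>z. \<phi> (\<rho> (fst z)) (snd z))"
  proof (rule continuous_map_eq)
    fix z assume "z \<in> topspace (subtopology ?Z ?V)"
    then have z: "fst z \<in> ?S" "snd z \<in> {0..1}" "\<Phi> i (fst z) \<in> U" by auto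
    note s = chart_section_in [OF c z(3)]
    have vD: "fst z \<in> disk (d i)" using z SD by blast
    have p: "\<rho> (fst z) \<in> topspace (btotal P)" "bproj P (\<rho> (fst z)) = \<Phi> i (fst z)"
      using continuous_map_in_topspace [OF \<rho>(1)] vD \<rho>(2) by (auto simp: closed_disk_eq)
    have "\<phi> (bact P (\<sigma> (\<Phi> i (fst z))) (\<gamma> (\<rho> (fst z)))) (snd z)
        = milnor_act (\<phi> (\<sigma> (\<Phi> i (fst z))) (snd z)) (\<gamma> (\<rho> (fst z)))"
      by (rule goodD(3) [OF B s(1) z(2)]) (use s z bd in auto)
    then show "milnor_act (\<phi> (\<sigma> (\<Phi> i (fst z))) (snd z)) (\<gamma> (\<rho> (fst z))) = \<phi> (\<rho> (fst z)) (snd z)"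
      using chart_decompose [OF c p(1)] p(2) z(3) by simp
  qed
  then show "\<exists>V. openin ?Z V \<and> z \<in> V \<and> continuous_map (subtopology ?Z V) milnor_E (\<lambda>z. \<phi> (\<rho> (fst z)) (snd z))"
    using V U z by (intro exI [of _ ?V]) auto
qed

text \<open>A lift \<open>\<rho>\<close> of the characteristic map trivialises the bundle over the
  disk, so equivariant maps over the cell amount to maps of the disk times the interval into the
  join. Changing nothing outside the open cell lets cells of the same dimension be treated
  independently.\<close>

lemma cell_extension:
  assumes i: "i \<in> I" and lower: "\<And>j. j \<in> I \<Longrightarrow> d j < d i \<Longrightarrow> good (cell j) \<phi>"
  obtains \<phi>' where "good (cell i) \<phi>'" "\<And>p. bproj P p \<notin> open_cell i \<Longrightarrow> \<phi>' p = \<phi> p"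
proof -
  obtain J where J: "finite J" "J \<subseteq> {j \<in> I. d j < d i}"
      "\<Phi> i ` disk_boundary (d i) \<subseteq> (\<Union>j\<in>J. open_cell j)"
    using cell_boundary [OF i] .
  let ?B = "\<Union>j\<in>J. cell j"
  have B: "good ?B \<phi>" using J lower by (intro good_Union_cells) auto
  have bd: "\<Phi> i ` disk_boundary (d i) \<subseteq> ?B" using J(3) open_cell_subset by blast
  obtain \<rho> where \<rho>: "continuous_map (closed_disk (d i)) (btotal P) \<rho>"
      "\<And>v. v \<in> disk (d i) \<Longrightarrow> bproj P (\<rho> v) = \<Phi> i v"
    using disk_lift [OF characteristic_map [OF i]] by blast
  have \<rho>in: "\<rho> v \<in> topspace (btotal P)" if "v \<in> disk (d i)" for v
    using continuous_map_in_topspace [OF \<rho>(1)] that by (simp add: closed_disk_eq)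
  have bdD: "v \<in> disk (d i)" if "v \<in> disk_boundary (d i)" for v
    using that disk_boundary_subset by blast
  have "R (\<rho> v) s (\<phi> (\<rho> v) s)" if "v \<in> disk_boundary (d i)" "s \<in> {0..1}" for v s
    by (rule goodD(2) [OF B \<rho>in]) (use that bd bdD \<rho>(2) in auto)
  then obtain \<psi> where \<psi>: "continuous_map (top_of_set (disk (d i) \<times> {0..1::real})) milnor_E \<psi>"
      "\<And>v s. v \<in> disk_boundary (d i) \<Longrightarrow> s \<in> {0..1} \<Longrightarrow> \<psi> (v, s) = \<phi> (\<rho> v) s"
      "\<And>v s. v \<in> disk (d i) \<Longrightarrow> s \<in> {0..1} \<Longrightarrow> R (\<rho> v) s (\<psi> (v, s))"
    using disk_extension [OF i \<rho> good_on_boundary [OF i B bd \<rho>]] by (auto simp: Ball_def)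
  have \<psi>in: "\<psi> (v, s) \<in> milnor_points" if "v \<in> disk (d i)" "s \<in> {0..1}" for v s
    using continuous_map_in_topspace [OF \<psi>(1), of "(v, s)"] that by (simp add: topspace_milnor_E)
  define \<phi>' where "\<phi>' p s = (if bproj P p \<in> open_cell i
      then let v = inv_into (open_disk (d i)) (\<Phi> i) (bproj P p) in milnor_act (\<psi> (v, s)) (bdiv P (\<rho> v) p)
      else \<phi> p s)" for p s
  \<comment> \<open>The formula of the interior holds for every \<open>v\<close> of the closed disk.
    On the boundary, where \<open>\<Phi> i\<close> need not be injective, it is the equivariance of
    the old \<open>\<phi>\<close> that makes it independent of \<open>v\<close>.\<close>
  have \<phi>': "\<phi>' p s = milnor_act (\<psi> (v, s)) (bdiv P (\<rho> v) p)"
    if v: "v \<in> disk (d i)" and p: "p \<in> topspace (btotal P)" "bproj P p = \<Phi> i v" and s: "s \<in> {0..1}" for v p s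
  proof (cases "v \<in> open_disk (d i)")
    case True
    then have "bproj P p \<in> open_cell i" using p by (simp add: open_cell_def)
    then show ?thesis
      using inv_into_f_f [OF inj_on_open_disk [OF i] True] by (simp add: \<phi>'_def Let_def p)
  next
    case False
    then have vb: "v \<in> disk_boundary (d i)" using v disk_cases by blast
    then have "bproj P p \<notin> open_cell i" using boundary_disjoint [OF i] p by simp
    then have "\<phi>' p s = \<phi> p s" by (simp add: \<phi>'_def)
    also have "\<dots> = \<phi> (bact P (\<rho> v) (bdiv P (\<rho> v) p)) s"
      using p \<rho> v \<rho>in by (simp add: act_bdiv)
    also have "\<dots> = milnor_act (\<phi> (\<rho> v) s) (bdiv P (\<rho> v) p)"
      by (rule goodD(3) [OF B \<rho>in [OF v] s]) (use vb bd \<rho>(2) [OF v] in auto)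
    finally show ?thesis using \<psi>(2) [OF vb s] by simp
  qed
  have "good (cell i) \<phi>'"
    unfolding good_def
  proof (intro conjI ballI allI impI)
    fix p s g assume p: "p \<in> topspace (btotal P)" and s: "s \<in> {0..1::real}" and "bproj P p \<in> cell i"
    then obtain v where v: "v \<in> disk (d i)" "bproj P p = \<Phi> i v" by (auto simp: cell_def)
    note eq = \<phi>' [OF v(1) p v(2) s]
    have pr: "bproj P (\<rho> v) = bproj P p" using \<rho>(2) v by simp
    show "\<phi>' p s \<in> milnor_points" unfolding eq by (intro milnor_act_in \<psi>in v s)
    have "R (bact P (\<rho> v) (bdiv P (\<rho> v) p)) s (\<phi>' p s)" unfolding eq
      by (intro R_act \<rho>in \<psi>in \<psi>(3) v s)
    then show "R p s (\<phi>' p s)" by (simp add: act_bdiv \<rho>in v p pr)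
    have "\<phi>' (bact P p g) s = milnor_act (\<psi> (v, s)) (bdiv P (\<rho> v) (bact P p g))"
      by (rule \<phi>') (use v p s in \<open>simp_all add: act_in proj_act\<close>)
    then show "\<phi>' (bact P p g) s = milnor_act (\<phi>' p s) g"
      unfolding eq milnor_act_act by (simp add: bdiv_act_right \<rho>in v p pr)
  next
    fix U \<sigma> assume U: "local_section U \<sigma>"
    let ?W = "{z \<in> disk (d i) \<times> {0..1::real}. \<Phi> i (fst z) \<in> U}"
    have fst: "continuous_map (top_of_set ?W) (closed_disk (d i)) fst"
      by (auto simp: closed_disk_eq intro: continuous_on_fst continuous_on_id)
    show "continuous_map (prod_topology (subtopology X (U \<inter> cell i)) unit_interval) milnor_E
        (\<lambda>z. \<phi>' (\<sigma> (fst z)) (snd z))"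
    proof (rule continuous_map_on_cell [OF i])
      show "openin X U" using U by (simp add: local_section_def)
      have "continuous_map (top_of_set ?W) (btotal P) (\<lambda>z. \<sigma> (\<Phi> i (fst z)))"
        by (rule continuous_map_compose_subtopology [OF continuous_map_compose' [OF fst
                characteristic_map [OF i]], of U])
          (use U in \<open>auto simp: local_section_def\<close>)
      then have "continuous_map (top_of_set ?W) euclidean (\<lambda>z. bdiv P (\<rho> (fst z)) (\<sigma> (\<Phi> i (fst z))))"
        by (rule continuous_bdiv [OF continuous_map_compose' [OF fst \<rho>(1)]])
          (auto simp: \<rho>(2) local_section_in [OF U])
      moreover have "continuous_map (top_of_set ?W) milnor_E \<psi>"
        by (rule continuous_map_from_subtopology_mono [OF \<psi>(1)]) blast
      ultimately have "continuous_map (top_of_set ?W) milnor_E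
          (\<lambda>z. milnor_act (\<psi> z) (bdiv P (\<rho> (fst z)) (\<sigma> (\<Phi> i (fst z)))))"
        by (intro continuous_milnor_act)
      then show "continuous_map (top_of_set ?W) milnor_E
          (\<lambda>z. \<phi>' (\<sigma> (fst (\<Phi> i (fst z), snd z))) (snd (\<Phi> i (fst z), snd z)))"
      proof (rule continuous_map_eq)
        fix z assume "z \<in> topspace (top_of_set ?W)"
        then have z: "fst z \<in> disk (d i)" "snd z \<in> {0..1}" "\<Phi> i (fst z) \<in> U" by auto
        show "milnor_act (\<psi> z) (bdiv P (\<rho> (fst z)) (\<sigma> (\<Phi> i (fst z))))
            = \<phi>' (\<sigma> (fst (\<Phi> i (fst z), snd z))) (snd (\<Phi> i (fst z), snd z))"
          using \<phi>' [OF z(1) local_section_in(1,2) [OF U z(3)] z(2)] by simp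
      qed
    qed
  qed
  moreover have "\<phi>' p = \<phi> p" if "bproj P p \<notin> open_cell i" for p
    using that by (simp add: \<phi>'_def fun_eq_iff)
  ultimately show thesis by (rule that)
qed

text \<open>Cells are treated by dimension, all cells of one dimension at once. The value at a point
  changes only at the stage of the open cell below it. A closed cell meets only open cells of at
  most its own dimension, so over it the sequence is constant from one stage on and the limit is
  good.\<close>

theorem equivariant_extension:
  obtains \<phi> where
    "continuous_map (prod_topology (btotal P) unit_interval) milnor_E (\<lambda>z. \<phi> (fst z) (snd z))"
    "\<And>p s g. p \<in> topspace (btotal P) \<Longrightarrow> s \<in> {0..1} \<Longrightarrow> \<phi> (bact P p g) s = milnor_act (\<phi> p s) g"
    "\<And>p s. p \<in> topspace (btotal P) \<Longrightarrow> s \<in> {0..1} \<Longrightarrow> R p s (\<phi> p s)"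
proof -
  define c where "c x = (SOME i. i \<in> I \<and> x \<in> open_cell i)" for x
  have c: "c x = i" if "i \<in> I" "x \<in> open_cell i" for i x
  proof -
    have "c x \<in> I \<and> x \<in> open_cell (c x)" unfolding c_def by (rule someI [of _ i]) (use that in blast)
    then show ?thesis using open_cell_unique that by blast
  qed
  let ?Q = "\<lambda>n \<phi>. \<forall>i\<in>I. d i < n \<longrightarrow> good (cell i) \<phi>"
  have "\<exists>f. \<forall>n. ?Q n (f n) \<and> (\<forall>p. d (c (bproj P p)) \<noteq> n \<longrightarrow> f (Suc n) p = f n p)"
  proof (rule dependent_nat_choice)
    show "\<exists>\<phi>. ?Q 0 \<phi>" by simp
    fix \<phi> n assume \<phi>: "?Q n \<phi>"
    have "\<exists>\<phi>'. i \<in> I \<and> d i = n \<longrightarrow> good (cell i) \<phi>' \<and> (\<forall>p. bproj P p \<notin> open_cell i \<longrightarrow> \<phi>' p = \<phi> p)" for i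
      using cell_extension [of i \<phi>] \<phi> by metis
    then obtain F where F: "\<And>i. i \<in> I \<Longrightarrow> d i = n \<Longrightarrow> good (cell i) (F i)"
        "\<And>i p. i \<in> I \<Longrightarrow> d i = n \<Longrightarrow> bproj P p \<notin> open_cell i \<Longrightarrow> F i p = \<phi> p"
      by metis
    \<comment> \<open>The extensions over the individual n-cells are combined by taking, at each
      point, the one that belongs to the open cell below it.\<close>
    define \<phi>' where "\<phi>' p = (if d (c (bproj P p)) = n then F (c (bproj P p)) p else \<phi> p)" for p
    have "good (cell i) \<phi>'" if i: "i \<in> I" "d i < Suc n" for i
    proof (cases "d i = n")
      case True
      show ?thesis
      proof (rule good_cong [OF F(1) [OF i(1) True]])
        fix p assume p: "bproj P p \<in> cell i"
        show "\<phi>' p = F i p"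
        proof (rule cell_cases [OF i(1) p])
          assume "bproj P p \<in> open_cell i"
          then show ?thesis using c [OF i(1)] True by (simp add: \<phi>'_def)
        next
          fix j assume j: "j \<in> I" "d j < d i" "bproj P p \<in> open_cell j"
          then have "bproj P p \<notin> open_cell i" using open_cell_unique [OF i(1) j(1)] by blast
          then show ?thesis using c [OF j(1,3)] j True F(2) [OF i(1) True] by (simp add: \<phi>'_def)
        qed
      qed
    next
      case False
      then have less: "d i < n" using i by simp
      show ?thesis
      proof (rule good_cong)
        show "good (cell i) \<phi>" using \<phi> i less by blast
        fix p assume p: "bproj P p \<in> cell i"
        show "\<phi>' p = \<phi> p"
          by (rule cell_cases [OF i(1) p]) (use c less i in \<open>force simp: \<phi>'_def\<close>)+
      qed
    qed
    then have "?Q (Suc n) \<phi>' \<and> (\<forall>p. d (c (bproj P p)) \<noteq> n \<longrightarrow> \<phi>' p = \<phi> p)" by (simp add: \<phi>'_def)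
    then show "\<exists>\<phi>'. ?Q (Suc n) \<phi>' \<and> (\<forall>p. d (c (bproj P p)) \<noteq> n \<longrightarrow> \<phi>' p = \<phi> p)" by blast
  qed
  then obtain f where f: "\<And>n i. i \<in> I \<Longrightarrow> d i < n \<Longrightarrow> good (cell i) (f n)"
      "\<And>n p. d (c (bproj P p)) \<noteq> n \<Longrightarrow> f (Suc n) p = f n p"
    by metis
  have stable: "f n p = f (Suc (d (c (bproj P p)))) p" if "d (c (bproj P p)) < n" for n p
    using that
  proof (induction n)
    case (Suc n)
    show ?case
    proof (cases "d (c (bproj P p)) = n")
      case False
      then show ?thesis using Suc f(2) by simp
    qed simp
  qed simp
  define \<phi> where "\<phi> p = f (Suc (d (c (bproj P p)))) p" for p
  have good: "good (cell i) \<phi>" if i: "i \<in> I" for i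
  proof (rule good_cong [OF f(1) [OF i lessI]])
    fix p assume p: "bproj P p \<in> cell i"
    have "d (c (bproj P p)) \<le> d i"
      by (rule cell_cases [OF i p]) (use c i in force)+
    then show "\<phi> p = f (Suc (d i)) p" unfolding \<phi>_def using stable [of p "Suc (d i)"] by simp
  qed
  have cell: "\<exists>i\<in>I. bproj P p \<in> cell i" if "p \<in> topspace (btotal P)" for p
    using proj_in [OF that] open_cells_cover open_cell_subset by blast
  show thesis
  proof (rule that)
    show "continuous_map (prod_topology (btotal P) unit_interval) milnor_E (\<lambda>z. \<phi> (fst z) (snd z))"
      by (rule good_continuous_map [OF good])
    fix p s g assume p: "p \<in> topspace (btotal P)" "s \<in> {0..1::real}"
    then obtain i where "i \<in> I" "bproj P p \<in> cell i" using cell by blast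
    then show "\<phi> (bact P p g) s = milnor_act (\<phi> p s) g" "R p s (\<phi> p s)"
      using goodD(2,3) [OF good p] by blast+
  qed
qed

end

section \<open>The classification\<close>

text \<open>\<open>F\<close> is constant on fibres because the action is transitive there. Over a
  chart the induced map is the composite of \<open>F\<close> with the section, which gives
  continuity without a statement on products of quotient maps.\<close>

lemma (in principal_bundle) descend_homotopy:
  assumes F: "continuous_map (prod_topology (btotal P) unit_interval) Y F"
    and inv: "\<And>p s g. p \<in> topspace (btotal P) \<Longrightarrow> s \<in> {0..1} \<Longrightarrow> F (bact P p g, s) = F (p, s)"
  obtains f where "continuous_map (prod_topology X unit_interval) Y f"
    "\<And>p s. p \<in> topspace (btotal P) \<Longrightarrow> s \<in> {0..1} \<Longrightarrow> f (bproj P p, s) = F (p, s)"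
proof -
  define f where "f z = F (SOME p. p \<in> topspace (btotal P) \<and> bproj P p = fst z, snd z)" for z
  have f: "f (bproj P p, s) = F (p, s)" if p: "p \<in> topspace (btotal P)" and s: "s \<in> {0..1}" for p s
  proof -
    define q where "q = (SOME q. q \<in> topspace (btotal P) \<and> bproj P q = bproj P p)"
    have q: "q \<in> topspace (btotal P)" "bproj P q = bproj P p"
      unfolding q_def using someI [of "\<lambda>q. q \<in> topspace (btotal P) \<and> bproj P q = bproj P p" p] p by auto
    have "f (bproj P p, s) = F (q, s)" by (simp add: f_def q_def)
    also have "\<dots> = F (bact P q (bdiv P q p), s)" by (rule inv [OF q(1) s, symmetric])
    finally show ?thesis using act_bdiv [OF q(1) p q(2)] by simp
  qed
  have "continuous_map (prod_topology X unit_interval) Y f"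
  proof (rule continuous_map_locally)
    let ?Z = "prod_topology X unit_interval"
    fix z assume z: "z \<in> topspace ?Z"
    then have "fst z \<in> topspace X" by auto
    then obtain U \<sigma> \<gamma> where U: "fst z \<in> U" and c: "chart X P U \<sigma> \<gamma>" by (rule chart_exists)
    let ?V = "U \<times> {0..1::real}"
    have "openin ?Z ?V" using c by (simp add: chart_def openin_prod_Times_iff)
    moreover have "continuous_map (prod_topology (subtopology X U) unit_interval) Y f"
    proof (rule continuous_map_eq)
      have "continuous_map (prod_topology (subtopology X U) unit_interval) (btotal P) (\<lambda>z. \<sigma> (fst z))"
        by (rule continuous_map_compose' [OF continuous_map_fst chart_continuous(1) [OF c]])
      from continuous_map_compose' [OF continuous_map_pairedI [OF this continuous_map_snd] F]
      show "continuous_map (prod_topology (subtopology X U) unit_interval) Y (\<lambda>z. F (\<sigma> (fst z), snd z))" .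
      fix z assume "z \<in> topspace (prod_topology (subtopology X U) unit_interval)"
      then have z: "fst z \<in> U" "snd z \<in> {0..1}" by auto
      show "F (\<sigma> (fst z), snd z) = f z"
        using f [OF chart_section_in(1) [OF c z(1)] z(2)] chart_section_in(3) [OF c z(1)] by simp
    qed
    ultimately show "\<exists>V. openin ?Z V \<and> z \<in> V \<and> continuous_map (subtopology ?Z V) Y f"
      using U z by (intro exI [of _ ?V]) (auto simp: prod_unit_interval_subtopology')
  qed
  with f show thesis using that by blast
qed

lemma (in principal_bundle) fibre_nonempty:
  assumes "x \<in> topspace X"
  obtains p where "p \<in> topspace (btotal P)" "bproj P p = x"
  using chart_exists [OF assms] chart_section_in by metis

lemma pullback_simps:
  "btotal (pullback X f Q) = subtopology (prod_topology X (btotal Q)) {(x, q). f x = bproj Q q}"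
  "bproj (pullback X f Q) = fst"
  "bact (pullback X f Q) z g = (fst z, bact Q (snd z) g)"
  by (simp_all add: pullback_def case_prod_unfold)

lemma G_bundle_pullback_milnor:
  "continuous_map X milnor_B f \<Longrightarrow> G_bundle X (pullback X f (milnor_bundle :: ('g::topological_group_add formal_sum, _, 'g) gbundle))"
  by (rule principal_bundle.pullback_bundle) (simp_all add: principal_bundle_def G_bundle_milnor)

definition milnor_base_point :: "'g::topological_group_add formal_sum" where
  "milnor_base_point = (\<lambda>i. if i = 0 then (1, 0) else (0, 0))"

lemma milnor_base_point_in: "milnor_base_point \<in> milnor_points"
  by (rule milnor_pointsI [of _ 1]) (auto simp: milnor_base_point_def)

text \<open>The relation \<open>?R\<close> puts the fibre over \<open>x0\<close> into the base
  orbit, which makes the induced map pointed. The extension theorem produces a homotopy; its slice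
  at time 0 is the classifying map.\<close>

theorem classifying_map_exists:
  fixes P :: "('p, 'x, 'g::topological_group_add) gbundle"
  assumes cw: "cw_complex X I d \<Phi>" and x0: "x0 \<in> cw_vertices I d \<Phi>" and P: "G_bundle X P"
  shows "\<exists>f\<in>pointed_maps X x0 milnor_B milnor_base. bundle_equivalent P (pullback X f milnor_bundle)"
proof -
  interpret cw X I d \<Phi> by unfold_locales (rule cw)
  interpret principal_bundle X P by unfold_locales (rule P)
  obtain i0 where i0: "i0 \<in> I" "d i0 = 0" "x0 \<in> open_cell i0"
    using x0 by (auto simp: cw_vertices_def open_cell_def)
  then have x0X: "x0 \<in> topspace X" using open_cells_cover by blast
  let ?R = "\<lambda>p (s :: real) (e :: 'g formal_sum). bproj P p = x0 \<longrightarrow> milnor_orbit e = milnor_base"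
  interpret cw_extension X I d \<Phi> P ?R
  proof
    fix p s e g assume "p \<in> topspace (btotal P)" "e \<in> milnor_points" "?R p s e"
    then show "?R (bact P p g) s (milnor_act e g)" by (simp add: proj_act milnor_orbit_act)
  next
    fix i \<rho> \<psi> assume i: "i \<in> I" and \<rho>: "\<And>v. v \<in> disk (d i) \<Longrightarrow> bproj P (\<rho> v) = \<Phi> i v"
      and \<psi>: "continuous_map (top_of_set (disk_boundary (d i) \<times> {0..1::real})) milnor_E \<psi>"
        "\<And>v s. v \<in> disk_boundary (d i) \<Longrightarrow> s \<in> {0..1} \<Longrightarrow> ?R (\<rho> v) s (\<psi> (v, s))"
    obtain \<psi>' where \<psi>': "continuous_map (top_of_set (disk (d i) \<times> {0..1::real})) milnor_E \<psi>'"
        "\<And>v s. v \<in> disk_boundary (d i) \<Longrightarrow> s \<in> {0..1} \<Longrightarrow> \<psi>' (v, s) = \<psi> (v, s)"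
        "disk_boundary (d i) = {} \<Longrightarrow> \<psi>' = (\<lambda>_. milnor_base_point)"
      using milnor_disk_extension [OF \<psi>(1) milnor_base_point_in] by metis
    have "?R (\<rho> v) s (\<psi>' (v, s))" if v: "v \<in> disk (d i)" and s: "s \<in> {0..1}" for v s
    proof (cases "v \<in> disk_boundary (d i)")
      case True
      then show ?thesis using \<psi>(2) [OF True s] \<psi>'(2) [OF True s] by simp
    next
      case False
      show ?thesis
      proof
        assume "bproj P (\<rho> v) = x0"
        then have "x0 \<in> open_cell i" using \<rho> [OF v] False disk_cases [OF v] by (auto simp: open_cell_def)
        \<comment> \<open>Away from the boundary of the disk only the cell \<open>i0\<close> can hit
          \<open>x0\<close>. It is a vertex with empty boundary, so its value is the prescribed base
          point.\<close>
        then have "i = i0" using open_cell_unique [OF i i0(1) _ i0(3)] by blast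
        then have "disk_boundary (d i) = {}" using i0(2) by (simp add: disk_boundary_eq disk_norm_def)
        then show "milnor_orbit (\<psi>' (v, s)) = milnor_base"
          using \<psi>'(3) by (simp add: milnor_base_def milnor_base_point_def)
      qed
    qed
    with \<psi>' show "\<exists>\<psi>'. continuous_map (top_of_set (disk (d i) \<times> {0..1::real})) milnor_E \<psi>' \<and>
        (\<forall>v\<in>disk_boundary (d i). \<forall>s\<in>{0..1}. \<psi>' (v, s) = \<psi> (v, s)) \<and>
        (\<forall>v\<in>disk (d i). \<forall>s\<in>{0..1}. ?R (\<rho> v) s (\<psi>' (v, s)))"
      by (intro exI [of _ \<psi>']) blast
  qed
  obtain \<phi> where \<phi>: "continuous_map (prod_topology (btotal P) unit_interval) milnor_E (\<lambda>z. \<phi> (fst z) (snd z))"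
      "\<And>p s g. p \<in> topspace (btotal P) \<Longrightarrow> s \<in> {0..1} \<Longrightarrow> \<phi> (bact P p g) s = milnor_act (\<phi> p s) g"
      "\<And>p s. p \<in> topspace (btotal P) \<Longrightarrow> s \<in> {0..1} \<Longrightarrow> ?R p s (\<phi> p s)"
    using equivariant_extension by blast
  have \<phi>in: "\<phi> p s \<in> milnor_points" if "p \<in> topspace (btotal P)" "s \<in> {0..1}" for p s
    using continuous_map_in_topspace [OF \<phi>(1), of "(p, s)"] that by (simp add: topspace_milnor_E)
  obtain f where f: "continuous_map (prod_topology X unit_interval) milnor_B f"
      "\<And>p s. p \<in> topspace (btotal P) \<Longrightarrow> s \<in> {0..1} \<Longrightarrow> f (bproj P p, s) = milnor_orbit (\<phi> p s)"
  proof (rule descend_homotopy)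
    show "continuous_map (prod_topology (btotal P) unit_interval) milnor_B (\<lambda>z. milnor_orbit (\<phi> (fst z) (snd z)))"
      by (rule continuous_map_compose' [OF \<phi>(1) continuous_milnor_orbit])
  qed (auto simp: \<phi>(2) milnor_orbit_act \<phi>in)
  let ?f = "\<lambda>x. f (x, 0)"
  have slice: "continuous_map Z (prod_topology Z unit_interval) (\<lambda>z. (z, 0))" for Z :: "'z topology"
    by (intro continuous_map_pairedI) auto
  have fc: "continuous_map X milnor_B ?f" by (rule continuous_map_compose' [OF slice f(1)])
  obtain p0 where p0: "p0 \<in> topspace (btotal P)" "bproj P p0 = x0" using fibre_nonempty [OF x0X] .
  have "?f x0 = milnor_base" using f(2) [OF p0(1), of 0] \<phi>(3) [OF p0(1), of 0] p0(2) by simp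
  then have "?f \<in> pointed_maps X x0 milnor_B milnor_base" using fc by (simp add: pointed_maps_def)
  moreover have "bundle_equivalent P (pullback X ?f milnor_bundle)"
  proof (rule bundle_equivalent_pullbackI [OF P G_bundle_milnor fc])
    show "continuous_map (btotal P) (btotal milnor_bundle) (\<lambda>p. \<phi> p 0)"
      using continuous_map_compose' [OF slice \<phi>(1)] by simp
  qed (simp_all add: \<phi>(2) f(2))
  ultimately show ?thesis by blast
qed

theorem homotopic_imp_equivalent_pullbacks:
  fixes f f' :: "'x \<Rightarrow> 'g::topological_group_add formal_sum set"
  assumes cw: "cw_complex X I d \<Phi>" and hom: "homotopic_with (\<lambda>_. True) X milnor_B f f'"
  shows "bundle_equivalent (pullback X f milnor_bundle) (pullback X f' milnor_bundle)"
proof -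
  interpret cw X I d \<Phi> by unfold_locales (rule cw)
  let ?P = "pullback X f (milnor_bundle :: ('g formal_sum, _, 'g) gbundle)"
  have f: "continuous_map X milnor_B f" and f': "continuous_map X milnor_B f'"
    using hom homotopic_with_imp_continuous_maps by blast+
  interpret principal_bundle X ?P by unfold_locales (rule G_bundle_pullback_milnor [OF f])
  interpret M: principal_bundle milnor_B "milnor_bundle :: ('g formal_sum, _, 'g) gbundle"
    by unfold_locales (rule G_bundle_milnor)
  obtain h where h: "continuous_map (prod_topology unit_interval X) milnor_B h"
      "\<And>x. h (0, x) = f x" "\<And>x. h (1, x) = f' x"
    using hom unfolding homotopic_with_def by blast
  have sndc: "continuous_map (btotal ?P) milnor_E snd"
    by (simp add: pullback_simps continuous_map_from_subtopology continuous_map_snd)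
  have P: "snd p \<in> milnor_points" "f (fst p) = milnor_orbit (snd p)" if "p \<in> topspace (btotal ?P)" for p
    using that by (auto simp: pullback_simps topspace_milnor_E)
  \<comment> \<open>The first conjunct makes the family cover \<open>h\<close>; the second makes it
    start with the canonical map from the pullback to the join. At time 1 it is then a bundle map
    covering \<open>f'\<close>.\<close>
  let ?R = "\<lambda>p s e. milnor_orbit e = h (s, fst p) \<and> (s = 0 \<longrightarrow> e = snd p)"
  interpret cw_extension X I d \<Phi> ?P ?R
  proof
    fix p s e g assume "p \<in> topspace (btotal ?P)" "e \<in> milnor_points" "?R p s e"
    then show "?R (bact ?P p g) s (milnor_act e g)" by (simp add: pullback_simps milnor_orbit_act)
  next
    fix i \<rho> \<psi> assume i: "i \<in> I" and \<rho>: "continuous_map (closed_disk (d i)) (btotal ?P) \<rho>"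
        "\<And>v. v \<in> disk (d i) \<Longrightarrow> bproj ?P (\<rho> v) = \<Phi> i v"
      and \<psi>: "continuous_map (top_of_set (disk_boundary (d i) \<times> {0..1::real})) milnor_E \<psi>"
        "\<And>v s. v \<in> disk_boundary (d i) \<Longrightarrow> s \<in> {0..1} \<Longrightarrow> ?R (\<rho> v) s (\<psi> (v, s))"
    have fst\<rho>: "fst (\<rho> v) = \<Phi> i v" if "v \<in> disk (d i)" for v
      using \<rho>(2) [OF that] by (simp add: pullback_simps)
    have \<rho>in: "\<rho> v \<in> topspace (btotal ?P)" if "v \<in> disk (d i)" for v
      using continuous_map_in_topspace [OF \<rho>(1)] that by (simp add: closed_disk_eq)
    have bdD: "v \<in> disk (d i)" if "v \<in> disk_boundary (d i)" for v
      using that disk_boundary_subset by blast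
    have D: "top_of_set (disk (d i) \<times> {0..1}) = prod_topology (closed_disk (d i)) unit_interval"
      by (simp add: closed_disk_eq)
    obtain L where L: "continuous_map (top_of_set (disk (d i) \<times> {0..1::real})) milnor_E L"
      "\<And>v s. v \<in> disk (d i) \<Longrightarrow> s \<in> {0..1} \<Longrightarrow> milnor_orbit (L (v, s)) = h (s, \<Phi> i v)"
      "\<And>v s. v \<in> disk_boundary (d i) \<Longrightarrow> s \<in> {0..1} \<Longrightarrow> L (v, s) = \<psi> (v, s)"
      "\<And>v. v \<in> disk (d i) \<Longrightarrow> L (v, 0) = snd (\<rho> v)"
    proof (rule M.disk_relative_lift [of "d i" "\<lambda>z. h (snd z, \<Phi> i (fst z))" "\<lambda>v. snd (\<rho> v)" \<psi>,
          unfolded milnor_bundle_simps fst_conv snd_conv])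
      have "continuous_map (top_of_set (disk (d i) \<times> {0..1})) (prod_topology unit_interval X)
          (\<lambda>z. (snd z, \<Phi> i (fst z)))"
        unfolding D by (intro continuous_map_pairedI continuous_map_snd
            continuous_map_compose' [OF continuous_map_fst characteristic_map [OF i]])
      from continuous_map_compose' [OF this h(1)]
      show "continuous_map (top_of_set (disk (d i) \<times> {0..1})) milnor_B (\<lambda>z. h (snd z, \<Phi> i (fst z)))" .
      show "continuous_map (closed_disk (d i)) milnor_E (\<lambda>v. snd (\<rho> v))"
        by (rule continuous_map_compose' [OF \<rho>(1) sndc])
      show "milnor_orbit (snd (\<rho> v)) = h (0, \<Phi> i v)" if "v \<in> disk (d i)" for v
        using P(2) [OF \<rho>in [OF that]] fst\<rho> [OF that] by (simp add: h)
      show "milnor_orbit (\<psi> (v, s)) = h (s, \<Phi> i v)" if "v \<in> disk_boundary (d i)" "s \<in> {0..1}" for v s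
        using \<psi>(2) [OF that] fst\<rho> bdD that by simp
      show "\<psi> (v, 0) = snd (\<rho> v)" if "v \<in> disk_boundary (d i)" for v
        using \<psi>(2) [OF that, of 0] by simp
    qed (use \<psi> in auto)
    then show "\<exists>\<psi>'. continuous_map (top_of_set (disk (d i) \<times> {0..1::real})) milnor_E \<psi>' \<and>
        (\<forall>v\<in>disk_boundary (d i). \<forall>s\<in>{0..1}. \<psi>' (v, s) = \<psi> (v, s)) \<and>
        (\<forall>v\<in>disk (d i). \<forall>s\<in>{0..1}. ?R (\<rho> v) s (\<psi>' (v, s)))"
      by (intro exI [of _ L]) (simp add: fst\<rho>)
  qed
  obtain \<phi> where \<phi>: "continuous_map (prod_topology (btotal ?P) unit_interval) milnor_E (\<lambda>z. \<phi> (fst z) (snd z))"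
      "\<And>p s g. p \<in> topspace (btotal ?P) \<Longrightarrow> s \<in> {0..1} \<Longrightarrow> \<phi> (bact ?P p g) s = milnor_act (\<phi> p s) g"
      "\<And>p s. p \<in> topspace (btotal ?P) \<Longrightarrow> s \<in> {0..1} \<Longrightarrow> ?R p s (\<phi> p s)"
    using equivariant_extension by blast
  show ?thesis
  proof (rule bundle_equivalent_pullbackI [OF is_bundle G_bundle_milnor f'])
    have "continuous_map (btotal ?P) (prod_topology (btotal ?P) unit_interval) (\<lambda>z. (z, 1))"
      by (intro continuous_map_pairedI) auto
    from continuous_map_compose' [OF this \<phi>(1)]
    show "continuous_map (btotal ?P) (btotal milnor_bundle) (\<lambda>p. \<phi> p 1)" by simp
  qed (simp_all add: \<phi>(2,3) h(3) pullback_simps(2))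
qed

text \<open>On the pullback along \<open>f\<close>, both \<open>snd\<close> and \<open>snd\<close>
  after \<open>\<theta>\<close> are equivariant maps to the join; they cover \<open>f\<close> and
  \<open>f'\<close>. The formula \<open>milnor_join\<close> connects them equivariantly, and the
  orbits of its values give the homotopy.\<close>

theorem equivalent_pullbacks_imp_homotopic:
  fixes f f' :: "'x \<Rightarrow> 'g::topological_group_add formal_sum set"
  assumes f: "continuous_map X milnor_B f" and f': "continuous_map X milnor_B f'"
    and eqv: "bundle_equivalent (pullback X f milnor_bundle) (pullback X f' milnor_bundle)"
  shows "homotopic_with (\<lambda>_. True) X milnor_B f f'"
proof -
  let ?P = "pullback X f (milnor_bundle :: ('g formal_sum, _, 'g) gbundle)"
    and ?Q = "pullback X f' (milnor_bundle :: ('g formal_sum, _, 'g) gbundle)"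
  interpret principal_bundle X ?P by unfold_locales (rule G_bundle_pullback_milnor [OF f])
  obtain \<theta> where \<theta>: "homeomorphic_map (btotal ?P) (btotal ?Q) \<theta>"
      "\<And>p g. p \<in> topspace (btotal ?P) \<Longrightarrow> \<theta> (bact ?P p g) = bact ?Q (\<theta> p) g"
      "\<And>p. p \<in> topspace (btotal ?P) \<Longrightarrow> bproj ?Q (\<theta> p) = bproj ?P p"
    using eqv unfolding bundle_equivalent_def equivariant_on_def by blast
  have \<theta>c: "continuous_map (btotal ?P) (btotal ?Q) \<theta>" using \<theta>(1) homeomorphic_imp_continuous_map by blast
  have sndc: "continuous_map (btotal (pullback X k milnor_bundle)) milnor_E snd"
    for k :: "'x \<Rightarrow> 'g formal_sum set"
    by (simp add: pullback_simps continuous_map_from_subtopology continuous_map_snd)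
  have in_pullback: "snd p \<in> milnor_points \<and> k (fst p) = milnor_orbit (snd p)"
    if "p \<in> topspace (btotal (pullback X k milnor_bundle))"
    for p and k :: "'x \<Rightarrow> 'g formal_sum set"
    using that by (auto simp: pullback_simps topspace_milnor_E)
  note \<theta>in = continuous_map_in_topspace [OF \<theta>c]
  let ?J = "\<lambda>z. milnor_join (snd (fst z)) (snd (\<theta> (fst z))) (snd z)"
  have J: "continuous_map (prod_topology (btotal ?P) unit_interval) milnor_E ?J"
  proof (rule continuous_milnor_join)
    show "continuous_map (prod_topology (btotal ?P) unit_interval) milnor_E (\<lambda>z. snd (fst z))"
      by (rule continuous_map_compose' [OF continuous_map_fst sndc])
    show "continuous_map (prod_topology (btotal ?P) unit_interval) milnor_E (\<lambda>z. snd (\<theta> (fst z)))"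
      by (rule continuous_map_compose' [OF continuous_map_compose' [OF continuous_map_fst \<theta>c] sndc])
    show "continuous_map (prod_topology (btotal ?P) unit_interval) euclideanreal snd"
      using continuous_map_snd [of "btotal ?P" unit_interval] by (simp add: continuous_map_in_subtopology)
  qed
  obtain k where k: "continuous_map (prod_topology X unit_interval) milnor_B k"
      "\<And>p s. p \<in> topspace (btotal ?P) \<Longrightarrow> s \<in> {0..1} \<Longrightarrow> k (bproj ?P p, s) = milnor_orbit (?J (p, s))"
  proof (rule descend_homotopy)
    show "continuous_map (prod_topology (btotal ?P) unit_interval) milnor_B (\<lambda>z. milnor_orbit (?J z))"
      by (rule continuous_map_compose' [OF J continuous_milnor_orbit])
    fix p s g assume p: "p \<in> topspace (btotal ?P)"
    have "?J (bact ?P p g, s) = milnor_act (?J (p, s)) g"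
      unfolding fst_conv snd_conv \<theta>(2) [OF p]
      by (simp only: fst_conv snd_conv pullback_simps(3) milnor_bundle_simps milnor_join_act)
    moreover have "?J (p, s) \<in> milnor_points"
      using in_pullback [OF p] in_pullback [OF \<theta>in [OF p]] by (simp add: milnor_join_in)
    ultimately show "milnor_orbit (?J (bact ?P p g, s)) = milnor_orbit (?J (p, s))"
      by (simp only: milnor_orbit_act)
  qed blast
  have ends: "k (x, 0) = f x" "k (x, 1) = f' x" if x: "x \<in> topspace X" for x
  proof -
    obtain p where p: "p \<in> topspace (btotal ?P)" "bproj ?P p = x" using fibre_nonempty [OF x] .
    note p' = in_pullback [OF p(1)] and q' = in_pullback [OF \<theta>in [OF p(1)]]
    have "fst p = x" "fst (\<theta> p) = x" using p \<theta>(3) [OF p(1)] by (simp_all add: pullback_simps(2))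
    then show "k (x, 0) = f x" "k (x, 1) = f' x"
      using k(2) [OF p(1), of 0] k(2) [OF p(1), of 1] p p' q' by (simp_all add: milnor_join_0 milnor_join_1)
  qed
  have "continuous_map (prod_topology unit_interval X) (prod_topology X unit_interval) (\<lambda>z. (snd z, fst z))"
    by (intro continuous_map_pairedI continuous_map_fst continuous_map_snd)
  from continuous_map_compose' [OF this k(1)]
  have "continuous_map (prod_topology unit_interval X) milnor_B (\<lambda>z. k (snd z, fst z))" .
  then show ?thesis
    by (subst homotopic_with) (auto intro!: exI [of _ "\<lambda>z. k (snd z, fst z)"] simp: ends)
qed

text \<open>The bijection has to fix the type of the total spaces. The second conjunct, with
  \<open>'p\<close> arbitrary, says that bundles whose total space lies in another type are
  pullbacks as well.\<close>

theorem theorem2p10: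
  fixes X :: "'x topology" and x0 :: 'x
    and I :: "'i set" and d :: "'i \<Rightarrow> nat" and \<Phi> :: "'i \<Rightarrow> (nat \<Rightarrow> real) \<Rightarrow> 'x"
  defines "Maps \<equiv> pointed_maps X x0 (milnor_B :: 'g::topological_group_add formal_sum set topology)
                    milnor_base"
    and "Htpy \<equiv> free_homotopy_rel X x0 (milnor_B :: 'g formal_sum set topology) milnor_base"
  assumes "cw_complex X I d \<Phi>"
    and "x0 \<in> cw_vertices I d \<Phi>"
  shows "(\<exists>F. bij_betw F (Maps // Htpy)
                ((Bun X :: ('x \<times> 'g formal_sum, 'x, 'g) gbundle set) // Bun_rel X) \<and>
              (\<forall>f\<in>Maps. F (Htpy `` {f}) = Bun_rel X `` {pullback X f milnor_bundle})) \<and>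
         (\<forall>P :: ('p, 'x, 'g) gbundle. G_bundle X P \<longrightarrow>
              (\<exists>f\<in>Maps. bundle_equivalent P (pullback X f milnor_bundle)))"
proof (intro conjI allI impI)
  note cw = \<open>cw_complex X I d \<Phi>\<close> and x0 = \<open>x0 \<in> cw_vertices I d \<Phi>\<close>
  show "\<exists>f\<in>Maps. bundle_equivalent P (pullback X f milnor_bundle)"
    if "G_bundle X P" for P :: "('p, 'x, 'g) gbundle"
    unfolding Maps_def by (rule classifying_map_exists [OF cw x0 that])
  let ?pb = "\<lambda>f. pullback X f milnor_bundle :: ('x \<times> 'g formal_sum, 'x, 'g) gbundle"
  let ?B = "Bun X :: ('x \<times> 'g formal_sum, 'x, 'g) gbundle set"
  have pb: "?pb f \<in> ?B" if "f \<in> Maps" for f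
    using that G_bundle_pullback_milnor by (auto simp: Bun_def Maps_def pointed_maps_def)
  have rel: "(f, f') \<in> Htpy \<longleftrightarrow> (?pb f, ?pb f') \<in> Bun_rel X" if "f \<in> Maps" "f' \<in> Maps" for f f'
  proof -
    have "homotopic_with (\<lambda>_. True) X milnor_B f f' \<longleftrightarrow> bundle_equivalent (?pb f) (?pb f')"
      using that homotopic_imp_equivalent_pullbacks [OF cw] equivalent_pullbacks_imp_homotopic
      by (auto simp: Maps_def pointed_maps_def)
    then show ?thesis
      using that pb by (simp add: Htpy_def free_homotopy_rel_def Bun_rel_def flip: Maps_def)
  qed
  have eqM: "equiv Maps Htpy" unfolding Maps_def Htpy_def by (rule equiv_free_homotopy_rel)
  have eqB: "equiv ?B (Bun_rel X)" by (rule equiv_Bun_rel)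
  \<comment> \<open>All members of the union coincide when \<open>c\<close> is a homotopy class, so
    choosing a representative is avoided.\<close>
  define F where "F c = (\<Union>f\<in>c. Bun_rel X `` {?pb f})" for c
  have F: "F (Htpy `` {f}) = Bun_rel X `` {?pb f}" if f: "f \<in> Maps" for f
  proof -
    have "Bun_rel X `` {?pb f'} = Bun_rel X `` {?pb f}" if "f' \<in> Htpy `` {f}" for f'
    proof -
      have "f' \<in> Maps" "(f, f') \<in> Htpy" using that equiv_type [OF eqM] by auto
      then show ?thesis using rel [OF f] equiv_class_eq [OF eqB] by metis
    qed
    moreover have "f \<in> Htpy `` {f}" by (rule equiv_class_self [OF eqM f])
    ultimately show ?thesis unfolding F_def by blast
  qed
  have "bij_betw F (Maps // Htpy) (?B // Bun_rel X)"
    unfolding bij_betw_def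
  proof (intro conjI)
    show "inj_on F (Maps // Htpy)"
    proof (rule inj_onI)
      fix c c' assume "c \<in> Maps // Htpy" "c' \<in> Maps // Htpy" and eq: "F c = F c'"
      then obtain f f' where f: "f \<in> Maps" "c = Htpy `` {f}" and f': "f' \<in> Maps" "c' = Htpy `` {f'}"
        unfolding quotient_def by blast
      have "Bun_rel X `` {?pb f} = Bun_rel X `` {?pb f'}" using eq f f' by (simp add: F)
      then have "(?pb f, ?pb f') \<in> Bun_rel X" by (rule eq_equiv_class [OF _ eqB pb [OF f'(1)]])
      then show "c = c'" using rel [OF f(1) f'(1)] f f' equiv_class_eq [OF eqM] by blast
    qed
    show "F ` (Maps // Htpy) = ?B // Bun_rel X"
    proof
      show "F ` (Maps // Htpy) \<subseteq> ?B // Bun_rel X"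
      proof clarify
        fix c assume "c \<in> Maps // Htpy"
        then obtain f where "f \<in> Maps" "c = Htpy `` {f}" unfolding quotient_def by blast
        then show "F c \<in> ?B // Bun_rel X" using quotientI [OF pb] by (simp add: F)
      qed
      show "?B // Bun_rel X \<subseteq> F ` (Maps // Htpy)"
      proof
        fix C assume "C \<in> ?B // Bun_rel X"
        then obtain P where P: "P \<in> ?B" "C = Bun_rel X `` {P}" unfolding quotient_def by blast
        then obtain f where f: "f \<in> Maps" "bundle_equivalent P (?pb f)"
          using classifying_map_exists [OF cw x0, of P] by (auto simp: Bun_def Maps_def)
        then have "(P, ?pb f) \<in> Bun_rel X" using P(1) pb by (simp add: Bun_rel_def)
        then have "C = F (Htpy `` {f})" using P(2) equiv_class_eq [OF eqB] by (simp add: F f(1))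
        then show "C \<in> F ` (Maps // Htpy)" using quotientI [OF f(1)] by blast
      qed
    qed
  qed
  with F show "\<exists>F. bij_betw F (Maps // Htpy) (?B // Bun_rel X) \<and>
      (\<forall>f\<in>Maps. F (Htpy `` {f}) = Bun_rel X `` {pullback X f milnor_bundle})"
    by blast
qed

end
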